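(* Let $a,a'\in A$, $x\in a\,\mathcal W^{(+)}$, $y\in a'\,\mathcal W^{(+)}$, $z\in aa'\,\mathcal W^{(+)}$, and let $N^z_{x,y}=\sum_{w\in\overline W}\det(w)\,m^x_{zwy^{-1}}$ be the structure constants in $\chi_x\chi_y=\sum_{z\in aa'\mathcal W^{(+)}}N^z_{x,y}\chi_z$. Then $$N^z_{x,y}=\bar N^{\iota(z)}_{\iota(x)\,\iota(y)},$$ where $\bar N^{\nu}_{\lambda\mu}$ denotes the multiplicity of the irreducible $sl(3)$-module of highest weight $\nu$ in the tensor product of the irreducible modules of highest weights $\lambda$ and $\mu$.
   Context: Setting: $sl(3)$ with simple roots $\alpha_1,\alpha_2$, $\theta=\alpha_1+\alpha_2$, $\langle\alpha_i,\alpha_i\rangle=2$, root lattice $Q$, weight lattice $P$, fundamental weights $\bar\Lambda_1,\bar\Lambda_2$, $\bar\rho=\bar\Lambda_1+\bar\Lambda_2$, dominant weights $P_+$. $\overline W$ is the finite Weyl group with simple reflections $w_1,w_2$, $\det(w)=\pm1$, shifted action $w\cdot\lambda=w(\lambda+\bar\rho)-\bar\rho$. The extended affine Weyl group is $\widetilde W=\overline W\ltimes t_P$ (with $w\,t_\beta w^{-1}=t_{w(\beta)}$), the affine Weyl group is $W=\overline W\ltimes t_Q$. Each $y\in\widetilde W$ is uniquely $y=\bar y\,t_{-\lambda}$, $\bar y\in\overline W$, $\lambda\in P$. Let $\gamma=t_{\bar\Lambda_1}w_1w_2$ and $A=\{1,\gamma,\gamma^2\}$ (a cyclic group of order 3);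 $\widetilde W=W\rtimes A$. $\iota:\widetilde W\to Q$, $\iota(\bar y\,t_{-\lambda})=3\lambda+\bar y^{-1}\cdot0$. $\widetilde{\mathcal W}^{(+)}=\{\bar y\,t_{-\lambda}\in\widetilde W:\lambda\in P_+,\ \langle\lambda,\alpha_i\rangle>0 \text{ whenever } \bar y(\alpha_i)\text{ is a negative root},\ i=1,2\}$ and $\mathcal W^{(+)}=\widetilde{\mathcal W}^{(+)}\cap W$; $\iota$ maps $\widetilde{\mathcal W}^{(+)}$ into $P_+$. For $x\in\widetilde{\mathcal W}^{(+)}$ and $z\in\widetilde W$ put $m^x_z=\bar m^{\iota(x)}_{\iota(z)}$ if $z\in Wx$ and $m^x_z=0$ otherwise, where $\bar m^\lambda_\mu$ is the multiplicity of the weight $\mu$ in the irreducible $sl(3)$-module of highest weight $\lambda$; and $\chi_x=\sum_{z\in\widetilde W}m^x_z\,z\in\mathbb Z[\widetilde W]$ (a finite sum). *)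

theory Defs
  imports "Jordan_Normal_Form.VS_Connect" "HOL-Library.Product_Plus"
begin

section \<open>Weights and the finite Weyl group of $sl(3)$\<close>

text \<open>The pair $(a,b)$ stands for the integral weight $a\bar\Lambda_1 + b\bar\Lambda_2$. As
  $\langle\alpha_i,\alpha_i\rangle = 2$, the components of a weight are its products with
  $\alpha_1$ and $\alpha_2$.\<close>

type_synonym weight = "int \<times> int"

definition scale :: "int \<Rightarrow> weight \<Rightarrow> weight" where
  "scale k \<mu> = (k * fst \<mu>, k * snd \<mu>)"

definition \<Lambda>1 :: weight where "\<Lambda>1 = (1, 0)"
definition \<Lambda>2 :: weight where "\<Lambda>2 = (0, 1)"
definition \<rho> :: weight where "\<rho> = \<Lambda>1 + \<Lambda>2"

definition \<alpha>1 :: weight where "\<alpha>1 = (2, -1)"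
definition \<alpha>2 :: weight where "\<alpha>2 = (-1, 2)"

definition neg_roots :: "weight set" where
  "neg_roots = {- \<alpha>1, - \<alpha>2, - (\<alpha>1 + \<alpha>2)}"

definition root_lattice :: "weight set" where
  "root_lattice = {scale k \<alpha>1 + scale l \<alpha>2 | k l. True}"

definition dominant :: "weight set" where
  "dominant = {\<mu>. 0 \<le> fst \<mu> \<and> 0 \<le> snd \<mu>}"

definition refl1 :: "weight \<Rightarrow> weight" where
  "refl1 \<mu> = \<mu> - scale (fst \<mu>) \<alpha>1"

definition refl2 :: "weight \<Rightarrow> weight" where
  "refl2 \<mu> = \<mu> - scale (snd \<mu>) \<alpha>2"

inductive_set Wbar :: "(weight \<Rightarrow> weight) set" where
  Wbar_id: "id \<in> Wbar"
| Wbar_refl1: "w \<in> Wbar \<Longrightarrow> w \<circ> refl1 \<in> Wbar"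
| Wbar_refl2: "w \<in> Wbar \<Longrightarrow> w \<circ> refl2 \<in> Wbar"

text \<open>The determinant of a linear map of the weight lattice, in the basis of fundamental weights.\<close>

definition detW :: "(weight \<Rightarrow> weight) \<Rightarrow> int" where
  "detW w = fst (w \<Lambda>1) * snd (w \<Lambda>2) - fst (w \<Lambda>2) * snd (w \<Lambda>1)"

definition dot_action :: "(weight \<Rightarrow> weight) \<Rightarrow> weight \<Rightarrow> weight" where
  "dot_action w \<mu> = w (\<mu> + \<rho>) - \<rho>"


section \<open>The affine and extended affine Weyl groups\<close>

text \<open>The semidirect products are realised faithfully as groups of affine transformations of the
  weight lattice, with composition as multiplication; this gives
  $w\,t_\beta\,w^{-1} = t_{w(\beta)}$. Inverses are written \<open>inv_into UNIV\<close>, since \<open>inv\<close> is also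
  syntax of HOL-Algebra.\<close>

definition transl :: "weight \<Rightarrow> weight \<Rightarrow> weight" where
  "transl \<beta> \<mu> = \<mu> + \<beta>"

definition Wext :: "(weight \<Rightarrow> weight) set" where
  "Wext = {w \<circ> transl \<beta> | w \<beta>. w \<in> Wbar}"

definition Waff :: "(weight \<Rightarrow> weight) set" where
  "Waff = {w \<circ> transl \<beta> | w \<beta>. w \<in> Wbar \<and> \<beta> \<in> root_lattice}"

definition \<gamma> :: "weight \<Rightarrow> weight" where
  "\<gamma> = transl \<Lambda>1 \<circ> refl1 \<circ> refl2"

definition grpA :: "(weight \<Rightarrow> weight) set" where
  "grpA = {id, \<gamma>, \<gamma> \<circ> \<gamma>}"

text \<open>Meaningful for elements of \<open>Wext\<close>, whose decomposition $\bar y\,t_{-\lambda}$ is unique.\<close>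

definition \<iota> :: "(weight \<Rightarrow> weight) \<Rightarrow> weight" where
  "\<iota> y = (THE \<nu>. \<exists>w\<in>Wbar. \<exists>l. y = w \<circ> transl (- l) \<and>
                  \<nu> = scale 3 l + dot_action (inv_into UNIV w) 0)"

definition Wext_pos :: "(weight \<Rightarrow> weight) set" where
  "Wext_pos = {w \<circ> transl (- l) | w l. w \<in> Wbar \<and> l \<in> dominant \<and>
     (w \<alpha>1 \<in> neg_roots \<longrightarrow> 0 < fst l) \<and> (w \<alpha>2 \<in> neg_roots \<longrightarrow> 0 < snd l)}"

definition Waff_pos :: "(weight \<Rightarrow> weight) set" where
  "Waff_pos = Wext_pos \<inter> Waff"


section \<open>Finite-dimensional $sl(3)$-modules\<close>

definition sl3 :: "complex mat set" where
  "sl3 = {X \<in> carrier_mat 3 3. (\<Sum>i<3. X $$ (i, i)) = 0}"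

text \<open>A module is given in coordinates: its dimension and the matrices by which $sl(3)$ acts.
  Values of \<open>act\<close> outside \<open>sl3\<close> are irrelevant.\<close>

datatype repn = Repn (deg: nat) (act: "complex mat \<Rightarrow> complex mat")

definition is_repn :: "repn \<Rightarrow> bool" where
  "is_repn R \<longleftrightarrow>
     (\<forall>X\<in>sl3. act R X \<in> carrier_mat (deg R) (deg R)) \<and>
     (\<forall>X\<in>sl3. \<forall>Y\<in>sl3. act R (X + Y) = act R X + act R Y) \<and>
     (\<forall>c. \<forall>X\<in>sl3. act R (c \<cdot>\<^sub>m X) = c \<cdot>\<^sub>m act R X) \<and>
     (\<forall>X\<in>sl3. \<forall>Y\<in>sl3. act R (X * Y - Y * X) = act R X * act R Y - act R Y * act R X)"

definition invariant_subspace :: "repn \<Rightarrow> complex vec set \<Rightarrow> bool" where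
  "invariant_subspace R U \<longleftrightarrow>
     VectorSpace.subspace class_ring U (module_vec TYPE(complex) (deg R)) \<and>
     (\<forall>X\<in>sl3. \<forall>v\<in>U. act R X *\<^sub>v v \<in> U)"

definition irreducible_repn :: "repn \<Rightarrow> bool" where
  "irreducible_repn R \<longleftrightarrow> is_repn R \<and> 0 < deg R \<and>
     (\<forall>U. invariant_subspace R U \<longrightarrow> U = {0\<^sub>v (deg R)} \<or> U = carrier_vec (deg R))"

definition elem_mat :: "nat \<Rightarrow> nat \<Rightarrow> complex mat" where
  "elem_mat i j = mat 3 3 (\<lambda>kl. if kl = (i, j) then 1 else 0)"

text \<open>The Cartan subalgebra consists of the diagonal matrices and the positive root vectors are
  the strictly upper triangular elementary matrices. \<open>coroot i\<close> is the simple coroot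
  $\alpha_{i+1}^\vee$.\<close>

definition coroot :: "nat \<Rightarrow> complex mat" where
  "coroot i = elem_mat i i - elem_mat (Suc i) (Suc i)"

definition weight_space :: "repn \<Rightarrow> weight \<Rightarrow> complex vec set" where
  "weight_space R \<mu> = {v \<in> carrier_vec (deg R).
     act R (coroot 0) *\<^sub>v v = of_int (fst \<mu>) \<cdot>\<^sub>v v \<and>
     act R (coroot 1) *\<^sub>v v = of_int (snd \<mu>) \<cdot>\<^sub>v v}"

definition weight_mult :: "repn \<Rightarrow> weight \<Rightarrow> nat" where
  "weight_mult R \<mu> = vectorspace.dim class_ring
     (module_vec TYPE(complex) (deg R) \<lparr>carrier := weight_space R \<mu>\<rparr>)"

definition irreducible_of_highest_weight :: "repn \<Rightarrow> weight \<Rightarrow> bool" where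
  "irreducible_of_highest_weight R \<mu> \<longleftrightarrow> irreducible_repn R \<and>
     (\<exists>v\<in>weight_space R \<mu>. v \<noteq> 0\<^sub>v (deg R) \<and>
        (\<forall>j<3. \<forall>i<j. act R (elem_mat i j) *\<^sub>v v = 0\<^sub>v (deg R)))"

text \<open>Representative of the isomorphism class of irreducible modules of highest weight \<open>\<mu>\<close>
  (nonempty for dominant \<open>\<mu>\<close>).\<close>

definition irrep :: "weight \<Rightarrow> repn" where
  "irrep \<mu> = (SOME R. irreducible_of_highest_weight R \<mu>)"

definition mbar :: "weight \<Rightarrow> weight \<Rightarrow> nat" where
  "mbar l \<mu> = weight_mult (irrep l) \<mu>"

definition kron :: "complex mat \<Rightarrow> complex mat \<Rightarrow> complex mat" where
  "kron A B = mat (dim_row A * dim_row B) (dim_col A * dim_col B)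
     (\<lambda>(i, j). A $$ (i div dim_row B, j div dim_col B) * B $$ (i mod dim_row B, j mod dim_col B))"

definition tensor_repn :: "repn \<Rightarrow> repn \<Rightarrow> repn" where
  "tensor_repn R S = Repn (deg R * deg S)
     (\<lambda>X. kron (act R X) (1\<^sub>m (deg S)) + kron (1\<^sub>m (deg R)) (act S X))"

definition direct_sum_repn :: "repn list \<Rightarrow> repn" where
  "direct_sum_repn Rs = Repn (sum_list (map deg Rs)) (\<lambda>X. diag_block_mat (map (\<lambda>R. act R X) Rs))"

definition iso_repn :: "repn \<Rightarrow> repn \<Rightarrow> bool" where
  "iso_repn R S \<longleftrightarrow> deg R = deg S \<and>
     (\<exists>P\<in>carrier_mat (deg R) (deg R). invertible_mat P \<and> (\<forall>X\<in>sl3. P * act R X = act S X * P))"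

text \<open>The number of summands of highest weight \<open>\<nu>\<close> in a decomposition of \<open>R\<close> into irreducible
  modules; a decomposition exists and the number does not depend on it.\<close>

definition irrep_multiplicity :: "weight \<Rightarrow> repn \<Rightarrow> nat" where
  "irrep_multiplicity \<nu> R = (THE k. \<exists>Rs. (\<forall>S\<in>set Rs. irreducible_repn S) \<and>
     iso_repn R (direct_sum_repn Rs) \<and>
     k = length (filter (\<lambda>S. irreducible_of_highest_weight S \<nu>) Rs))"

definition Nbar :: "weight \<Rightarrow> weight \<Rightarrow> weight \<Rightarrow> nat" where
  "Nbar \<nu> l \<mu> = irrep_multiplicity \<nu> (tensor_repn (irrep l) (irrep \<mu>))"


section \<open>Multiplicities and structure constants for the extended affine Weyl group\<close>

definition mult_ext :: "(weight \<Rightarrow> weight) \<Rightarrow> (weight \<Rightarrow> weight) \<Rightarrow> nat" where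
  "mult_ext x z = (if z \<in> {u \<circ> x | u. u \<in> Waff} then mbar (\<iota> x) (\<iota> z) else 0)"

text \<open>The coefficient of $\chi_z$ in $\chi_x\chi_y$, where $\chi_x = \sum_z m^x_z\,z$.\<close>

definition structure_const ::
  "(weight \<Rightarrow> weight) \<Rightarrow> (weight \<Rightarrow> weight) \<Rightarrow> (weight \<Rightarrow> weight) \<Rightarrow> int" where
  "structure_const z x y =
     (\<Sum>w\<in>Wbar. detW w * int (mult_ext x (z \<circ> w \<circ> inv_into UNIV y)))"

end

theory Submission
  imports Defs "Jordan_Normal_Form.Char_Poly"
begin

text \<open>The map \<open>\<iota>\<close> is invariant under left multiplication by \<open>A\<close>, and \<open>\<iota>(z w y\<^sup>-\<^sup>1)\<close> lies in the
  Weyl group orbit of \<open>\<iota>(z) + \<rho> - w(\<iota>(y) + \<rho>)\<close>. As weight multiplicities are Weyl invariant, the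
  structure constant becomes the alternating sum of the multiplicities of these weights, and the
  claim is the Racah-Speiser formula for tensor product multiplicities.

  That formula is obtained as follows. Irreducible modules are determined by their highest weight,
  and occur in tensor powers of the standard module and its dual, so that they carry an invariant
  Hermitian form; hence their tensor products are completely reducible. Comparing traces of the
  Casimir operator on weight spaces shows that the product of an irreducible character with the Weyl
  denominator is supported on weights of one norm. The Weyl character formula follows, and the
  multiplicity of the highest weight \<open>\<nu>\<close> is the coefficient at \<open>\<nu> + \<rho>\<close> of the character times the
  denominator.\<close>

subsection \<open>Representations of $sl(3)$\<close>

text \<open>Two choices in the definitions shape the proof. \<open>irrep\<close> is an arbitrary
  irreducible module, so only its highest weight may be used: weight bases are built on a unitary
  model and carried over by uniqueness. \<open>irrep_multiplicity\<close> speaks of every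
  decomposition, whose summands are only known to be irreducible; each of them is a quotient of a
  module with a weight basis, which provides its highest weight and makes the count independent of
  the decomposition. Weight multiplicities are turned into \<open>count_list\<close> of a list of
  weights read off from diagonal coordinates, so that products of characters are finite sums. The
  norm condition comes from (c + 6 - 2 q(\<xi>)) altsum(\<xi>) = 0, where q is \<open>qform\<close>
  and c is the Casimir eigenvalue; completing the square gives c + 6 = 2 q(\<mu> + \<rho>). On the
  group side the factor 3 in \<open>\<iota>\<close> makes it blind to \<open>\<gamma>\<close>,
  because 3 \<Lambda>2 plus a rotated \<rho> is again \<rho>. The coset condition in
  \<open>mult_ext\<close> always holds, because the classes of \<open>x\<close> and \<open>y\<close>
  modulo the root lattice add up to that of \<open>z\<close>.\<close>

lemma elem_mat_carrier [simp]: "elem_mat i j \<in> carrier_mat 3 3"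
  by (simp add: elem_mat_def)

lemma sl3_carrier: "X \<in> sl3 \<Longrightarrow> X \<in> carrier_mat 3 3"
  by (simp add: sl3_def)

lemma coroot_carrier [simp]: "coroot i \<in> carrier_mat 3 3"
  by (simp add: coroot_def elem_mat_def minus_carrier_mat)

lemma elem_mat_dim [simp]: "dim_row (elem_mat i j) = 3" "dim_col (elem_mat i j) = 3"
  "dim_row (coroot i) = 3" "dim_col (coroot i) = 3"
  by (simp_all add: elem_mat_def coroot_def)

lemma elem_mat_sl3: "i \<noteq> j \<Longrightarrow> elem_mat i j \<in> sl3"
  by (auto simp: sl3_def elem_mat_def)

lemma sum_lessThan_3: "(\<Sum>i<(3::nat). f i) = f 0 + f 1 + (f 2 :: complex)"
  by (simp add: numeral_3_eq_3 numeral_2_eq_2 lessThan_Suc ac_simps)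

lemma sum_atLeast0_3: "(\<Sum>i\<in>{0..<(3::nat)}. f i) = f 0 + f 1 + (f 2 :: complex)"
  by (simp add: numeral_3_eq_3 numeral_2_eq_2 ac_simps)

lemma index_mult_mat_3:
  assumes "(A :: complex mat) \<in> carrier_mat 3 3" "B \<in> carrier_mat 3 3" "i < 3" "j < 3"
  shows "(A * B) $$ (i, j) = A $$ (i, 0) * B $$ (0, j) + A $$ (i, 1) * B $$ (1, j) + A $$ (i, 2) * B $$ (2, j)"
  using assms by (simp add: scalar_prod_def sum_atLeast0_3)

lemma coroot_sl3: "i < 2 \<Longrightarrow> coroot i \<in> sl3"
  by (auto simp: sl3_def coroot_def elem_mat_def sum_lessThan_3 less_2_cases_iff)

lemma sl3_add: "X \<in> sl3 \<Longrightarrow> Y \<in> sl3 \<Longrightarrow> X + Y \<in> sl3"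
proof -
  assume "X \<in> sl3" "Y \<in> sl3"
  hence "(\<Sum>i<3. (X + Y) $$ (i, i)) = (\<Sum>i<3. X $$ (i, i)) + (\<Sum>i<3. Y $$ (i, i))"
    by (subst sum.distrib[symmetric]) (auto simp: sl3_def)
  with \<open>X \<in> sl3\<close> \<open>Y \<in> sl3\<close> show ?thesis by (auto simp: sl3_def)
qed

lemma sl3_smult: "X \<in> sl3 \<Longrightarrow> c \<cdot>\<^sub>m X \<in> sl3"
proof -
  assume "X \<in> sl3"
  hence "(\<Sum>i<3. (c \<cdot>\<^sub>m X) $$ (i, i)) = c * (\<Sum>i<3. X $$ (i, i))"
    by (subst sum_distrib_left) (auto simp: sl3_def)
  with \<open>X \<in> sl3\<close> show ?thesis by (auto simp: sl3_def)
qed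

lemma sl3_bracket: "X \<in> sl3 \<Longrightarrow> Y \<in> sl3 \<Longrightarrow> X * Y - Y * X \<in> sl3"
proof -
  assume X: "X \<in> sl3" and Y: "Y \<in> sl3"
  have "(\<Sum>i<3. (X * Y - Y * X) $$ (i, i)) = (\<Sum>i<3. (X * Y) $$ (i, i)) - (\<Sum>i<3. (Y * X) $$ (i, i))"
    using X Y by (subst sum_subtractf[symmetric]) (auto simp: sl3_def)
  also have "\<dots> = 0"
    using sl3_carrier[OF X] sl3_carrier[OF Y]
    by (simp add: sum_lessThan_3 index_mult_mat_3 mult.commute del: index_mult_mat(1))
  finally show ?thesis using X Y by (auto simp: sl3_def)
qed

lemma elem_mat_mult:
  assumes "i < 3" "j < 3" "k < 3" "l < 3"
  shows "elem_mat i j * elem_mat k l = (if j = k then elem_mat i l else 0\<^sub>m 3 3)"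
  using assms
  by (intro eq_matI) (auto simp: elem_mat_def scalar_prod_def if_distrib sum.delta cong: if_cong)

lemma sl3_bracket_simps:
  "elem_mat 0 1 * elem_mat 1 2 - elem_mat 1 2 * elem_mat 0 1 = elem_mat 0 2"
  "elem_mat 2 1 * elem_mat 1 0 - elem_mat 1 0 * elem_mat 2 1 = elem_mat 2 0"
  "elem_mat 0 1 * elem_mat 1 0 - elem_mat 1 0 * elem_mat 0 1 = coroot 0"
  "elem_mat 1 2 * elem_mat 2 1 - elem_mat 2 1 * elem_mat 1 2 = coroot 1"
proof -
  have [simp]: "elem_mat i j - 0\<^sub>m 3 3 = elem_mat i j" for i j
    by (intro eq_matI) (auto simp: elem_mat_def)
  show "elem_mat 0 1 * elem_mat 1 2 - elem_mat 1 2 * elem_mat 0 1 = elem_mat 0 2"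
    "elem_mat 2 1 * elem_mat 1 0 - elem_mat 1 0 * elem_mat 2 1 = elem_mat 2 0"
    "elem_mat 0 1 * elem_mat 1 0 - elem_mat 1 0 * elem_mat 0 1 = coroot 0"
    "elem_mat 1 2 * elem_mat 2 1 - elem_mat 2 1 * elem_mat 1 2 = coroot 1"
    by (simp_all add: elem_mat_mult coroot_def numeral_2_eq_2)
qed

text \<open>A diagonal matrix of trace zero has entries a, b, -a-b, which is a times the first
  coroot plus a + b times the second; hence the last two coefficients.\<close>

lemma sl3_expansion:
  assumes "X \<in> sl3"
  shows "X = X $$ (0,1) \<cdot>\<^sub>m elem_mat 0 1 + (X $$ (0,2) \<cdot>\<^sub>m elem_mat 0 2 + (X $$ (1,0) \<cdot>\<^sub>m elem_mat 1 0
    + (X $$ (1,2) \<cdot>\<^sub>m elem_mat 1 2 + (X $$ (2,0) \<cdot>\<^sub>m elem_mat 2 0 + (X $$ (2,1) \<cdot>\<^sub>m elem_mat 2 1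
    + (X $$ (0,0) \<cdot>\<^sub>m coroot 0 + (X $$ (0,0) + X $$ (1,1)) \<cdot>\<^sub>m coroot 1))))))"
    (is "X = ?Y")
proof (rule eq_matI)
  have tr: "X $$ (0,0) + X $$ (1,1) + X $$ (2,2) = 0" and X: "X \<in> carrier_mat 3 3"
    using assms by (auto simp: sl3_def sum_lessThan_3)
  have tr': "X $$ (2,2) = - X $$ (0,0) - X $$ (1,1)"
    using tr by (simp add: add_eq_0_iff algebra_simps)
  show "dim_row X = dim_row ?Y" "dim_col X = dim_col ?Y" using X by (auto simp: coroot_def elem_mat_def)
  fix i j assume "i < dim_row ?Y" "j < dim_col ?Y"
  hence "i < 3" "j < 3" by auto
  have ix: "elem_mat a b $$ (i, j) = (if i = a \<and> j = b then 1 else 0)" if "i < 3" "j < 3" for a b i j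
    using that by (simp add: elem_mat_def)
  have cx: "coroot a $$ (i, j) = (if i = a \<and> j = a then 1 else 0) - (if i = Suc a \<and> j = Suc a then 1 else 0)"
    if "i < 3" "j < 3" for a i j
    using that by (simp add: coroot_def ix)
  have "i \<in> {0, 1, 2}" "j \<in> {0, 1, 2}" using \<open>i < 3\<close> \<open>j < 3\<close> by auto
  thus "X $$ (i, j) = ?Y $$ (i, j)"
    using tr' by (elim insertE emptyE; hypsubst) (simp_all add: ix cx numeral_2_eq_2)
qed

text \<open>The Lie algebra is generated by the simple root vectors.\<close>

lemma sl3_induct [consumes 1, case_names e1 e2 f1 f2 add smult bracket]:
  assumes "X \<in> sl3"
    and "P (elem_mat 0 1)" "P (elem_mat 1 2)" "P (elem_mat 1 0)" "P (elem_mat 2 1)"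
    and add: "\<And>X Y. X \<in> sl3 \<Longrightarrow> Y \<in> sl3 \<Longrightarrow> P X \<Longrightarrow> P Y \<Longrightarrow> P (X + Y)"
    and smult: "\<And>c X. X \<in> sl3 \<Longrightarrow> P X \<Longrightarrow> P (c \<cdot>\<^sub>m X)"
    and bracket: "\<And>X Y. X \<in> sl3 \<Longrightarrow> Y \<in> sl3 \<Longrightarrow> P X \<Longrightarrow> P Y \<Longrightarrow> P (X * Y - Y * X)"
  shows "P X"
proof -
  have P: "P (elem_mat 0 2)" "P (elem_mat 2 0)" "P (coroot 0)" "P (coroot 1)"
    using assms(2-5) bracket[of "elem_mat 0 1" "elem_mat 1 2"] bracket[of "elem_mat 2 1" "elem_mat 1 0"]
      bracket[of "elem_mat 0 1" "elem_mat 1 0"] bracket[of "elem_mat 1 2" "elem_mat 2 1"]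
    by (simp_all add: elem_mat_sl3 sl3_bracket_simps del: One_nat_def)
  show ?thesis
    by (subst sl3_expansion[OF assms(1)], intro add smult assms(2-5) P sl3_add sl3_smult
        elem_mat_sl3 coroot_sl3) auto
qed

locale sl3_repn =
  fixes R :: repn
  assumes is_repn: "is_repn R"
begin

abbreviation "n \<equiv> deg R"

text \<open>A name for the action lets simp push sums, scalars and zero through it, with only
  \<open>sl3\<close> and \<open>carrier_vec n\<close> as side conditions.\<close>

definition op :: "complex mat \<Rightarrow> complex vec \<Rightarrow> complex vec" where
  "op X v = act R X *\<^sub>v v"

lemma act_carrier: "X \<in> sl3 \<Longrightarrow> act R X \<in> carrier_mat n n"
  and act_add: "X \<in> sl3 \<Longrightarrow> Y \<in> sl3 \<Longrightarrow> act R (X + Y) = act R X + act R Y"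
  and act_smult: "X \<in> sl3 \<Longrightarrow> act R (c \<cdot>\<^sub>m X) = c \<cdot>\<^sub>m act R X"
  and act_bracket: "X \<in> sl3 \<Longrightarrow> Y \<in> sl3 \<Longrightarrow>
    act R (X * Y - Y * X) = act R X * act R Y - act R Y * act R X"
  using is_repn by (auto simp: is_repn_def)

lemma op_carrier [simp]: "X \<in> sl3 \<Longrightarrow> v \<in> carrier_vec n \<Longrightarrow> op X v \<in> carrier_vec n"
  using act_carrier[of X] by (auto simp: op_def)

lemma op_add [simp]: "X \<in> sl3 \<Longrightarrow> v \<in> carrier_vec n \<Longrightarrow> w \<in> carrier_vec n \<Longrightarrow> op X (v + w) = op X v + op X w"
  using act_carrier mult_add_distrib_mat_vec unfolding op_def by blast

lemma op_smult [simp]: "X \<in> sl3 \<Longrightarrow> v \<in> carrier_vec n \<Longrightarrow> op X (c \<cdot>\<^sub>v v) = c \<cdot>\<^sub>v op X v"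
  using act_carrier mult_mat_vec unfolding op_def by blast

lemma op_zero [simp]: "X \<in> sl3 \<Longrightarrow> op X (0\<^sub>v n) = 0\<^sub>v n"
  using act_carrier[of X] by (auto simp: op_def)

lemma op_mat_add: "X \<in> sl3 \<Longrightarrow> Y \<in> sl3 \<Longrightarrow> v \<in> carrier_vec n \<Longrightarrow> op (X + Y) v = op X v + op Y v"
  using act_carrier[of X] act_carrier[of Y] by (simp add: op_def act_add add_mult_distrib_mat_vec)

lemma op_mat_smult: "X \<in> sl3 \<Longrightarrow> v \<in> carrier_vec n \<Longrightarrow> op (c \<cdot>\<^sub>m X) v = c \<cdot>\<^sub>v op X v"
  using act_carrier[of X] by (auto simp: op_def act_smult)

lemma op_bracket:
  assumes "X \<in> sl3" "Y \<in> sl3" "v \<in> carrier_vec n"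
  shows "op (X * Y - Y * X) v = op X (op Y v) - op Y (op X v)"
proof -
  have "op (X * Y - Y * X) v = (act R X * act R Y - act R Y * act R X) *\<^sub>v v"
    using assms by (simp add: op_def act_bracket)
  also have "\<dots> = (act R X * act R Y) *\<^sub>v v - (act R Y * act R X) *\<^sub>v v"
    using assms act_carrier[of X] act_carrier[of Y] by (intro minus_mult_distrib_mat_vec[of _ n n]) auto
  finally show ?thesis
    using assms act_carrier[of X] act_carrier[of Y] by (simp add: op_def)
qed

lemma op_commute:
  assumes "X \<in> sl3" "Y \<in> sl3" "v \<in> carrier_vec n"
  shows "op X (op Y v) = op Y (op X v) + op (X * Y - Y * X) v"
proof -
  have "op X (op Y v) \<in> carrier_vec n" "op Y (op X v) \<in> carrier_vec n" using assms by auto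
  thus ?thesis by (subst op_bracket[OF assms]) (intro eq_vecI, auto)
qed

end

section \<open>Invariant subspaces\<close>

lemma subspace_iff:
  "VectorSpace.subspace class_ring U (module_vec TYPE(complex) n) \<longleftrightarrow>
     U \<subseteq> carrier_vec n \<and> 0\<^sub>v n \<in> U \<and> (\<forall>u\<in>U. \<forall>v\<in>U. u + v \<in> U) \<and> (\<forall>c. \<forall>u\<in>U. c \<cdot>\<^sub>v u \<in> U)"
  (is "?L \<longleftrightarrow> ?R")
proof -
  have vs: "vectorspace class_ring (module_vec TYPE(complex) n)" by (rule vec_vs)
  have m: "Module.module class_ring (module_vec TYPE(complex) n)" by (rule vec_module)
  show ?thesis
  proof
    assume ?L
    then interpret LinearCombinations.submodule class_ring U "module_vec TYPE(complex) n"
      by (simp add: VectorSpace.subspace_def)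
    show ?R
      using subset zero_closed m_closed smult_closed
      by (auto simp: module_vec_simps)
  next
    assume ?R
    thus ?L
      by (auto simp: VectorSpace.subspace_def vs LinearCombinations.submodule_def m module_vec_simps)
  qed
qed

text \<open>The matrices that preserve a subspace are closed under sums, scalars and brackets, so
  the four simple root vectors suffice by \<open>sl3_induct\<close>.\<close>

lemma invariant_subspaceI:
  assumes R: "is_repn R" and "U \<subseteq> carrier_vec (deg R)" "0\<^sub>v (deg R) \<in> U"
    and add: "\<And>u v. u \<in> U \<Longrightarrow> v \<in> U \<Longrightarrow> u + v \<in> U"
    and smult: "\<And>c u. u \<in> U \<Longrightarrow> c \<cdot>\<^sub>v u \<in> U"
    and gen: "\<And>u. u \<in> U \<Longrightarrow> act R (elem_mat 0 1) *\<^sub>v u \<in> U" "\<And>u. u \<in> U \<Longrightarrow> act R (elem_mat 1 2) *\<^sub>v u \<in> U"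
      "\<And>u. u \<in> U \<Longrightarrow> act R (elem_mat 1 0) *\<^sub>v u \<in> U" "\<And>u. u \<in> U \<Longrightarrow> act R (elem_mat 2 1) *\<^sub>v u \<in> U"
  shows "invariant_subspace R U"
proof -
  interpret sl3_repn R by (unfold_locales) (rule R)
  have U: "u \<in> carrier_vec n" if "u \<in> U" for u using assms(2) that by auto
  have diff: "u - v \<in> U" if "u \<in> U" "v \<in> U" for u v
  proof -
    have "u - v = u + (-1) \<cdot>\<^sub>v v" using U[OF that(1)] U[OF that(2)] by (intro eq_vecI) auto
    thus ?thesis using add smult that by auto
  qed
  have "\<forall>u\<in>U. op X u \<in> U" if "X \<in> sl3" for X
    using that
  proof (induction X rule: sl3_induct)
    case (add X Y)
    thus ?case using U assms(4) by (simp add: op_mat_add)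
  next
    case (smult c X)
    thus ?case using U assms(5) by (simp add: op_mat_smult)
  next
    case (bracket X Y)
    thus ?case using U diff by (simp add: op_bracket)
  qed (use gen in \<open>simp_all add: op_def\<close>)
  thus ?thesis
    using assms by (auto simp: invariant_subspace_def subspace_iff op_def)
qed

lemma invariant_subspaceD:
  assumes "invariant_subspace R U"
  shows "U \<subseteq> carrier_vec (deg R)" "0\<^sub>v (deg R) \<in> U" "\<And>u v. u \<in> U \<Longrightarrow> v \<in> U \<Longrightarrow> u + v \<in> U"
    "\<And>c u. u \<in> U \<Longrightarrow> c \<cdot>\<^sub>v u \<in> U" "\<And>X u. X \<in> sl3 \<Longrightarrow> u \<in> U \<Longrightarrow> act R X *\<^sub>v u \<in> U"
  using assms by (auto simp: invariant_subspace_def subspace_iff)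

section \<open>Matrices as linear maps, and dimension counts\<close>

lemma eq_mat_vecI:
  assumes A: "(A :: complex mat) \<in> carrier_mat m n" and B: "B \<in> carrier_mat m n"
    and eq: "\<And>v. v \<in> carrier_vec n \<Longrightarrow> A *\<^sub>v v = B *\<^sub>v v"
  shows "A = B"
proof (rule eq_matI)
  fix i j assume "i < dim_row B" "j < dim_col B"
  hence ij: "i < m" "j < n" using B by auto
  have "(A *\<^sub>v unit_vec n j) $ i = (B *\<^sub>v unit_vec n j) $ i" using eq by simp
  thus "A $$ (i, j) = B $$ (i, j)" using A B ij by simp
qed (use A B in auto)

lemma one_mat_iff:
  assumes "(A :: complex mat) \<in> carrier_mat m n" "B \<in> carrier_mat n m"
  shows "A * B = 1\<^sub>m m \<longleftrightarrow> (\<forall>v\<in>carrier_vec m. A *\<^sub>v (B *\<^sub>v v) = v)"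
proof
  assume AB: "A * B = 1\<^sub>m m"
  show "\<forall>v\<in>carrier_vec m. A *\<^sub>v (B *\<^sub>v v) = v"
  proof
    fix v :: "complex vec" assume v: "v \<in> carrier_vec m"
    have "A *\<^sub>v (B *\<^sub>v v) = (A * B) *\<^sub>v v" using assms v by (intro assoc_mult_mat_vec[symmetric]) auto
    thus "A *\<^sub>v (B *\<^sub>v v) = v" using AB v by simp
  qed
next
  assume "\<forall>v\<in>carrier_vec m. A *\<^sub>v (B *\<^sub>v v) = v"
  thus "A * B = 1\<^sub>m m"
    using assms by (intro eq_mat_vecI[of _ m m]) auto
qed

text \<open>\<open>P * Q\<close> and \<open>Q * P\<close> have the same trace, and in characteristic
  zero the trace of an identity matrix determines its size.\<close>

lemma inverse_pair_dim:
  assumes P: "(P :: complex mat) \<in> carrier_mat m n" and Q: "Q \<in> carrier_mat n m"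
    and "P * Q = 1\<^sub>m m" "Q * P = 1\<^sub>m n"
  shows "m = n"
proof -
  have "of_nat m = (\<Sum>i<m. (P * Q) $$ (i, i))" using assms(3) by simp
  also have "\<dots> = (\<Sum>i<m. \<Sum>j<n. P $$ (i, j) * Q $$ (j, i))"
    using P Q by (auto simp: scalar_prod_def lessThan_atLeast0 intro!: sum.cong)
  also have "\<dots> = (\<Sum>j<n. \<Sum>i<m. Q $$ (j, i) * P $$ (i, j))"
    by (subst sum.swap) (simp add: mult.commute)
  also have "\<dots> = (\<Sum>j<n. (Q * P) $$ (j, j))"
    using P Q by (auto simp: scalar_prod_def lessThan_atLeast0 intro!: sum.cong)
  also have "\<dots> = (of_nat n :: complex)" using assms(4) by simp
  finally show ?thesis by simp
qed

text \<open>With more columns than rows, padding by zero rows gives a square matrix \<open>B\<close>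
  with the same kernel. Row \<open>m\<close> of \<open>B\<close> is zero, so \<open>B\<close> cannot
  reach the unit vector \<open>m\<close> and is singular.\<close>

lemma injective_dim_le:
  assumes A: "(A :: complex mat) \<in> carrier_mat m n"
    and inj: "\<And>v. v \<in> carrier_vec n \<Longrightarrow> A *\<^sub>v v = 0\<^sub>v m \<Longrightarrow> v = 0\<^sub>v n"
  shows "n \<le> m"
proof (rule ccontr)
  assume "\<not> n \<le> m"
  hence mn: "m < n" by simp
  define B where "B = mat n n (\<lambda>(i, j). if i < m then A $$ (i, j) else 0)"
  have B: "B \<in> carrier_mat n n" by (simp add: B_def)
  have B': "B *\<^sub>v v = vec n (\<lambda>i. if i < m then (A *\<^sub>v v) $ i else 0)" if "v \<in> carrier_vec n" for v
    using A that mn by (intro eq_vecI) (auto simp: B_def scalar_prod_def)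
  show False
  proof (cases "det B = 0")
    case True
    then obtain v where v: "v \<in> carrier_vec n" "v \<noteq> 0\<^sub>v n" "B *\<^sub>v v = 0\<^sub>v n"
      using det_0_iff_vec_prod_zero_field[OF B] by blast
    have "(A *\<^sub>v v) $ i = 0" if "i < m" for i
    proof -
      have "(B *\<^sub>v v) $ i = 0" using v(3) that mn by simp
      thus ?thesis using that mn by (simp only: B'[OF v(1)]) simp
    qed
    hence "A *\<^sub>v v = 0\<^sub>v m" using A by (intro eq_vecI) auto
    thus False using inj v by blast
  next
    case False
    then obtain C where C: "C \<in> carrier_mat n n" "B * C = 1\<^sub>m n"
      using det_non_zero_imp_unit[OF B False, of "()"]
      by (auto simp: Units_def ring_mat_def)
    have "B *\<^sub>v (C *\<^sub>v unit_vec n m) = unit_vec n m"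
      using C B one_mat_iff[OF B C(1)] by auto
    hence "(B *\<^sub>v (C *\<^sub>v unit_vec n m)) $ m = 1" using mn by simp
    moreover have "(B *\<^sub>v (C *\<^sub>v unit_vec n m)) $ m = 0"
      using C mn by (subst B') auto
    ultimately show False by simp
  qed
qed

text \<open>The bridge from matrices to the abstract dimension in \<open>weight_mult\<close>:
  \<open>J\<close> parametrises the subspace and \<open>L\<close> reads off coordinates.\<close>

lemma dim_eqI:
  assumes U: "VectorSpace.subspace class_ring U (module_vec TYPE(complex) n)"
    and J: "J \<in> carrier_mat n r" and L: "L \<in> carrier_mat r n"
    and JU: "\<And>x. x \<in> carrier_vec r \<Longrightarrow> J *\<^sub>v x \<in> U"
    and JL: "\<And>u. u \<in> U \<Longrightarrow> J *\<^sub>v (L *\<^sub>v u) = u"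
    and LJ: "\<And>x. x \<in> carrier_vec r \<Longrightarrow> L *\<^sub>v (J *\<^sub>v x) = x"
  shows "vectorspace.dim class_ring (module_vec TYPE(complex) n \<lparr>carrier := U\<rparr>) = r"
proof -
  interpret r: vec_space "TYPE(complex)" r .
  have vsU: "vectorspace class_ring (module_vec TYPE(complex) n \<lparr>carrier := U\<rparr>)"
    by (rule vectorspace.subspace_is_vs[OF vec_vs U])
  interpret T: linear_map class_ring "module_vec TYPE(complex) r"
    "module_vec TYPE(complex) n \<lparr>carrier := U\<rparr>" "\<lambda>x. J *\<^sub>v x"
  proof (intro linear_map.intro mod_hom.intro mod_hom_axioms.intro)
    show "vectorspace class_ring (module_vec TYPE(complex) r)" by (rule vec_vs)
    show "Module.module class_ring (module_vec TYPE(complex) r)" by (rule vec_module)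
    show "Module.module class_ring (module_vec TYPE(complex) n \<lparr>carrier := U\<rparr>)"
      using vsU by (simp add: vectorspace_def)
    show "(*\<^sub>v) J \<in> LinearCombinations.module_hom class_ring (module_vec TYPE(complex) r)
       (module_vec TYPE(complex) n \<lparr>carrier := U\<rparr>)"
      using J JU mult_add_distrib_mat_vec[OF J] mult_mat_vec[OF J]
      by (auto simp: LinearCombinations.module_hom_def module_vec_simps)
  qed (rule vsU)
  have "r.dim = T.W.dim"
  proof (rule T.dim_eq)
    show "inj_on ((*\<^sub>v) J) (carrier (module_vec TYPE(complex) r))"
      using LJ by (intro inj_on_inverseI[where g = "\<lambda>u. L *\<^sub>v u"]) (auto simp: module_vec_simps)
    show "(*\<^sub>v) J ` carrier (module_vec TYPE(complex) r) = carrier (module_vec TYPE(complex) n\<lparr>carrier := U\<rparr>)"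
    proof (safe)
      fix u assume "u \<in> carrier (module_vec TYPE(complex) n\<lparr>carrier := U\<rparr>)"
      hence u: "u \<in> U" by simp
      hence "u \<in> carrier_vec n" using U by (auto simp: subspace_iff)
      thus "u \<in> (*\<^sub>v) J ` carrier (module_vec TYPE(complex) r)"
        using JL[OF u] L by (intro image_eqI[of _ _ "L *\<^sub>v u"]) (auto simp: module_vec_simps)
    qed (use JU in \<open>auto simp: module_vec_simps\<close>)
  qed simp
  thus ?thesis by (simp add: r.dim_is_n)
qed

section \<open>Intertwiners and isomorphism\<close>

definition intertwines :: "repn \<Rightarrow> repn \<Rightarrow> complex mat \<Rightarrow> bool" where
  "intertwines R S K \<longleftrightarrow> K \<in> carrier_mat (deg S) (deg R) \<and>
     (\<forall>X\<in>sl3. \<forall>v\<in>carrier_vec (deg R). K *\<^sub>v (act R X *\<^sub>v v) = act S X *\<^sub>v (K *\<^sub>v v))"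

lemma intertwinesD:
  assumes "intertwines R S K"
  shows "K \<in> carrier_mat (deg S) (deg R)"
    "X \<in> sl3 \<Longrightarrow> v \<in> carrier_vec (deg R) \<Longrightarrow> K *\<^sub>v (act R X *\<^sub>v v) = act S X *\<^sub>v (K *\<^sub>v v)"
    "v \<in> carrier_vec (deg R) \<Longrightarrow> K *\<^sub>v v \<in> carrier_vec (deg S)"
  using assms by (auto simp: intertwines_def)

lemma is_repn_carrier: "is_repn R \<Longrightarrow> X \<in> sl3 \<Longrightarrow> act R X \<in> carrier_mat (deg R) (deg R)"
  by (simp add: is_repn_def)

lemma is_repn_carrier_vec [simp]:
  "is_repn R \<Longrightarrow> X \<in> sl3 \<Longrightarrow> v \<in> carrier_vec (deg R) \<Longrightarrow> act R X *\<^sub>v v \<in> carrier_vec (deg R)"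
  using is_repn_carrier[of R X] by simp

lemma intertwines_mat:
  assumes "intertwines R S K" "is_repn R" "is_repn S" "X \<in> sl3"
  shows "K * act R X = act S X * K"
proof (rule eq_mat_vecI[of _ "deg S" "deg R"])
  note c = intertwinesD(1)[OF assms(1)] is_repn_carrier[OF assms(2,4)] is_repn_carrier[OF assms(3,4)]
  show "K * act R X \<in> carrier_mat (deg S) (deg R)" "act S X * K \<in> carrier_mat (deg S) (deg R)"
    using c by auto
  fix v :: "complex vec" assume "v \<in> carrier_vec (deg R)"
  thus "K * act R X *\<^sub>v v = act S X * K *\<^sub>v v"
    using c intertwinesD(2)[OF assms(1,4)] by simp
qed

lemma intertwines_comp:
  assumes "intertwines R S K" "intertwines S T K'" "is_repn R"
  shows "intertwines R T (K' * K)"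
proof -
  note K = intertwinesD[OF assms(1)] and K' = intertwinesD[OF assms(2)]
  show ?thesis
    unfolding intertwines_def
    using K(1) K'(1) K(2,3) K'(2) assms(3) by (auto simp: assoc_mult_mat_vec[OF K'(1) K(1)])
qed

text \<open>With a mutually inverse pair of intertwiners no equality of degrees has to be carried
  along; it is recovered by \<open>inverse_pair_dim\<close>. That the inverse matrix intertwines
  follows by inserting \<open>P * Q\<close> in front of the vector.\<close>

lemma iso_repn_iff:
  assumes R: "is_repn R" and S: "is_repn S"
  shows "iso_repn R S \<longleftrightarrow> (\<exists>P Q. intertwines R S P \<and> intertwines S R Q \<and>
    (\<forall>v\<in>carrier_vec (deg R). Q *\<^sub>v (P *\<^sub>v v) = v) \<and> (\<forall>v\<in>carrier_vec (deg S). P *\<^sub>v (Q *\<^sub>v v) = v))"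
    (is "?L \<longleftrightarrow> ?R")
proof
  assume ?L
  then obtain P where dg: "deg R = deg S" and P: "P \<in> carrier_mat (deg R) (deg R)"
    and inv: "invertible_mat P" and com: "\<And>X. X \<in> sl3 \<Longrightarrow> P * act R X = act S X * P"
    by (auto simp: iso_repn_def)
  from inv obtain Q where "inverts_mat P Q" "inverts_mat Q P" by (auto simp: invertible_mat_def)
  hence PQ: "P * Q = 1\<^sub>m (deg R)" and QP: "Q * P = 1\<^sub>m (dim_row Q)"
    using P by (auto simp: inverts_mat_def)
  have "dim_col (P * Q) = deg R" "dim_col (Q * P) = dim_row Q" using PQ QP by simp_all
  hence Q: "Q \<in> carrier_mat (deg R) (deg R)" using P by auto
  have 1: "Q *\<^sub>v (P *\<^sub>v v) = v" if "v \<in> carrier_vec (deg R)" for v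
    using QP one_mat_iff[OF Q P] Q that by auto
  have 2: "P *\<^sub>v (Q *\<^sub>v v) = v" if "v \<in> carrier_vec (deg R)" for v
    using PQ one_mat_iff[OF P Q] that by auto
  have com': "P *\<^sub>v (act R X *\<^sub>v v) = act S X *\<^sub>v (P *\<^sub>v v)" if X: "X \<in> sl3" and v: "v \<in> carrier_vec (deg R)" for X v
    using com[OF X] P v is_repn_carrier[OF R X] is_repn_carrier[OF S X] dg
    by (metis assoc_mult_mat_vec)
  have "intertwines R S P"
    using P com' dg by (simp add: intertwines_def)
  moreover have "intertwines S R Q"
    unfolding intertwines_def
  proof (intro conjI ballI)
    fix X and v :: "complex vec" assume X: "X \<in> sl3" and v: "v \<in> carrier_vec (deg S)"
    have w: "Q *\<^sub>v v \<in> carrier_vec (deg R)" using Q v dg by auto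
    have "Q *\<^sub>v (act S X *\<^sub>v v) = Q *\<^sub>v (act S X *\<^sub>v (P *\<^sub>v (Q *\<^sub>v v)))"
      using 2 v dg by simp
    also have "\<dots> = Q *\<^sub>v (P *\<^sub>v (act R X *\<^sub>v (Q *\<^sub>v v)))"
      using com'[OF X w] by simp
    also have "\<dots> = act R X *\<^sub>v (Q *\<^sub>v v)"
      using w R X by (intro 1) simp
    finally show "Q *\<^sub>v (act S X *\<^sub>v v) = act R X *\<^sub>v (Q *\<^sub>v v)" .
  qed (use Q dg in auto)
  ultimately show ?R using 1 2 dg by auto
next
  assume ?R
  then obtain P Q where P: "intertwines R S P" and Q: "intertwines S R Q"
    and 1: "\<And>v. v\<in>carrier_vec (deg R) \<Longrightarrow> Q *\<^sub>v (P *\<^sub>v v) = v"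
    and 2: "\<And>v. v\<in>carrier_vec (deg S) \<Longrightarrow> P *\<^sub>v (Q *\<^sub>v v) = v" by blast
  note Pc = intertwinesD(1)[OF P] and Qc = intertwinesD(1)[OF Q]
  have PQ: "P * Q = 1\<^sub>m (deg S)" "Q * P = 1\<^sub>m (deg R)"
    using one_mat_iff[OF Pc Qc] one_mat_iff[OF Qc Pc] 1 2 by auto
  hence dg: "deg S = deg R" by (rule inverse_pair_dim[OF Pc Qc])
  have "invertible_mat P"
    using PQ Pc Qc dg by (auto simp: invertible_mat_def inverts_mat_def square_mat.simps)
  thus ?L
    using dg Pc intertwines_mat[OF P R S] by (auto simp: iso_repn_def)
qed

lemma iso_repn_refl: "is_repn R \<Longrightarrow> iso_repn R R"
  by (subst iso_repn_iff) (auto intro!: exI[of _ "1\<^sub>m (deg R)"] simp: intertwines_def)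

lemma iso_repn_sym:
  assumes "is_repn R" "is_repn S" "iso_repn R S"
  shows "iso_repn S R"
  using assms(3) iso_repn_iff[OF assms(1,2)] iso_repn_iff[OF assms(2,1)] by blast

lemma iso_repn_trans:
  assumes R: "is_repn R" and S: "is_repn S" and T: "is_repn T" and "iso_repn R S" "iso_repn S T"
  shows "iso_repn R T"
proof -
  from assms(4) obtain P Q where P: "intertwines R S P" "intertwines S R Q"
    "\<And>v. v\<in>carrier_vec (deg R) \<Longrightarrow> Q *\<^sub>v (P *\<^sub>v v) = v"
    "\<And>v. v\<in>carrier_vec (deg S) \<Longrightarrow> P *\<^sub>v (Q *\<^sub>v v) = v" by (auto simp: iso_repn_iff R S)
  from assms(5) obtain P' Q' where P': "intertwines S T P'" "intertwines T S Q'"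
    "\<And>v. v\<in>carrier_vec (deg S) \<Longrightarrow> Q' *\<^sub>v (P' *\<^sub>v v) = v"
    "\<And>v. v\<in>carrier_vec (deg T) \<Longrightarrow> P' *\<^sub>v (Q' *\<^sub>v v) = v" by (auto simp: iso_repn_iff S T)
  note c = intertwinesD[OF P(1)] intertwinesD[OF P(2)] intertwinesD[OF P'(1)] intertwinesD[OF P'(2)]
  have "(Q * Q') *\<^sub>v ((P' * P) *\<^sub>v v) = v" if "v \<in> carrier_vec (deg R)" for v
    using c that P(3) P'(3) by (simp add: assoc_mult_mat_vec[OF c(7) c(1)] assoc_mult_mat_vec[OF c(4) c(10)])
  moreover have "(P' * P) *\<^sub>v ((Q * Q') *\<^sub>v v) = v" if "v \<in> carrier_vec (deg T)" for v
    using c that P(4) P'(4) by (simp add: assoc_mult_mat_vec[OF c(7) c(1)] assoc_mult_mat_vec[OF c(4) c(10)])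
  ultimately show ?thesis
    using intertwines_comp[OF P(1) P'(1) R] intertwines_comp[OF P'(2) P(2) T]
    by (subst iso_repn_iff[OF R T]) blast
qed

text \<open>Compressing a representation to the range of \<open>J\<close>, with \<open>L\<close> a left inverse of \<open>J\<close>; this covers
  subrepresentations as well as changes of basis.\<close>

definition compress :: "complex mat \<Rightarrow> complex mat \<Rightarrow> repn \<Rightarrow> repn" where
  "compress L J R = Repn (dim_col J) (\<lambda>X. L * act R X * J)"

lemma compress_sel [simp]: "deg (compress L J R) = dim_col J" "act (compress L J R) X = L * act R X * J"
  by (simp_all add: compress_def)

text \<open>By \<open>LJ\<close>, the product \<open>J * L\<close> is a projection onto the range of
  \<open>J\<close>, and \<open>inv\<close> says that this range is invariant. The factor
  \<open>J * L\<close> inside a product of two compressed operators therefore acts as the identity,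
  so brackets are preserved.\<close>

lemma
  assumes R: "is_repn R" and J: "J \<in> carrier_mat (deg R) r" and L: "L \<in> carrier_mat r (deg R)"
    and LJ: "\<And>x. x \<in> carrier_vec r \<Longrightarrow> L *\<^sub>v (J *\<^sub>v x) = x"
    and inv: "\<And>X x. X \<in> sl3 \<Longrightarrow> x \<in> carrier_vec r \<Longrightarrow>
        J *\<^sub>v (L *\<^sub>v (act R X *\<^sub>v (J *\<^sub>v x))) = act R X *\<^sub>v (J *\<^sub>v x)"
  shows is_repn_compress: "is_repn (compress L J R)"
    and intertwines_compress: "intertwines (compress L J R) R J"
proof -
  interpret sl3_repn R by (unfold_locales) (rule R)
  have A: "L * act R X * J \<in> carrier_mat r r" if "X \<in> sl3" for X
    using J L act_carrier[OF that] by auto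
  have A': "(L * act R X * J) *\<^sub>v v = L *\<^sub>v (act R X *\<^sub>v (J *\<^sub>v v))" if "X \<in> sl3" "v \<in> carrier_vec r" for X v
    using J L act_carrier[OF that(1)] that(2) by (simp add: assoc_mult_mat_vec[of _ r n _ r])
  have LA: "L * act R X \<in> carrier_mat r n" if "X \<in> sl3" for X
    using L act_carrier[OF that] by auto
  show "is_repn (compress L J R)"
    unfolding is_repn_def compress_sel
  proof (intro conjI ballI allI)
    show "L * act R X * J \<in> carrier_mat (dim_col J) (dim_col J)" if "X \<in> sl3" for X
      using A[OF that] J by auto
    show "L * act R (X + Y) * J = L * act R X * J + L * act R Y * J" if "X \<in> sl3" "Y \<in> sl3" for X Y
      using that J L act_carrier[OF that(1)] act_carrier[OF that(2)] LA[OF that(1)] LA[OF that(2)]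
      by (simp add: act_add mult_add_distrib_mat[of L r n] add_mult_distrib_mat[of _ r n])
    show "L * act R (c \<cdot>\<^sub>m X) * J = c \<cdot>\<^sub>m (L * act R X * J)" if "X \<in> sl3" for c X
      using that J L act_carrier[OF that] LA[OF that]
      by (simp add: act_smult mult_smult_distrib[of L r n] mult_smult_assoc_mat[of _ r n])
    show "L * act R (X * Y - Y * X) * J = L * act R X * J * (L * act R Y * J) - L * act R Y * J * (L * act R X * J)"
      if X: "X \<in> sl3" and Y: "Y \<in> sl3" for X Y
    proof (rule eq_mat_vecI[of _ r r])
      note XY = sl3_bracket[OF X Y]
      show "L * act R (X * Y - Y * X) * J \<in> carrier_mat r r"
        "L * act R X * J * (L * act R Y * J) - L * act R Y * J * (L * act R X * J) \<in> carrier_mat r r"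
        using A[OF X] A[OF Y] A[OF XY] by (auto intro!: minus_carrier_mat)
      fix v :: "complex vec" assume v: "v \<in> carrier_vec r"
      have Jv: "J *\<^sub>v v \<in> carrier_vec n" using J v by auto
      have prod: "(L * act R X * J * (L * act R Y * J)) *\<^sub>v v = L *\<^sub>v (op X (op Y (J *\<^sub>v v)))"
        if "X \<in> sl3" "Y \<in> sl3" for X Y
      proof -
        have w: "L *\<^sub>v (act R Y *\<^sub>v (J *\<^sub>v v)) \<in> carrier_vec r"
          using L Jv op_carrier[OF that(2) Jv] by (simp add: op_def)
        have "(L * act R X * J * (L * act R Y * J)) *\<^sub>v v = (L * act R X * J) *\<^sub>v ((L * act R Y * J) *\<^sub>v v)"
          using A[OF that(1)] A[OF that(2)] v by (intro assoc_mult_mat_vec)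
        thus ?thesis using that w v inv[OF that(2) v] by (simp add: A' op_def)
      qed
      have "(L * act R X * J * (L * act R Y * J) - L * act R Y * J * (L * act R X * J)) *\<^sub>v v
        = L *\<^sub>v (op X (op Y (J *\<^sub>v v))) - L *\<^sub>v (op Y (op X (J *\<^sub>v v)))"
        by (subst minus_mult_distrib_mat_vec[OF mult_carrier_mat[OF A[OF X] A[OF Y]]
              mult_carrier_mat[OF A[OF Y] A[OF X]] v]) (simp only: prod[OF X Y] prod[OF Y X])
      also have "\<dots> = L *\<^sub>v (op (X * Y - Y * X) (J *\<^sub>v v))"
        using L Jv X Y by (simp add: op_bracket mult_minus_distrib_mat_vec[OF L])
      finally show "(L * act R (X * Y - Y * X) * J) *\<^sub>v v =
        (L * act R X * J * (L * act R Y * J) - L * act R Y * J * (L * act R X * J)) *\<^sub>v v"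
        by (simp add: A'[OF XY v] op_def)
    qed
  qed
  show "intertwines (compress L J R) R J"
    unfolding intertwines_def compress_sel using J inv by (auto simp: A')
qed

lemma is_repnI:
  assumes car: "\<And>X. X \<in> sl3 \<Longrightarrow> act R X \<in> carrier_mat (deg R) (deg R)"
    and add: "\<And>X Y v. X \<in> sl3 \<Longrightarrow> Y \<in> sl3 \<Longrightarrow> v \<in> carrier_vec (deg R) \<Longrightarrow>
      act R (X + Y) *\<^sub>v v = act R X *\<^sub>v v + act R Y *\<^sub>v v"
    and smult: "\<And>c X v. X \<in> sl3 \<Longrightarrow> v \<in> carrier_vec (deg R) \<Longrightarrow>
      act R (c \<cdot>\<^sub>m X) *\<^sub>v v = c \<cdot>\<^sub>v (act R X *\<^sub>v v)"
    and bracket: "\<And>X Y v. X \<in> sl3 \<Longrightarrow> Y \<in> sl3 \<Longrightarrow> v \<in> carrier_vec (deg R) \<Longrightarrow>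
      act R (X * Y - Y * X) *\<^sub>v v = act R X *\<^sub>v (act R Y *\<^sub>v v) - act R Y *\<^sub>v (act R X *\<^sub>v v)"
  shows "is_repn R"
  unfolding is_repn_def
proof (intro conjI ballI allI car)
  let ?n = "deg R"
  fix X Y assume X: "X \<in> sl3" and Y: "Y \<in> sl3"
  note c = car[OF X] car[OF Y]
  show "act R (X + Y) = act R X + act R Y"
    using c car[OF sl3_add[OF X Y]] X Y
    by (intro eq_mat_vecI[of _ ?n ?n]) (auto simp: add add_mult_distrib_mat_vec[of _ ?n ?n])
  show "act R (X * Y - Y * X) = act R X * act R Y - act R Y * act R X"
    using c car[OF sl3_bracket[OF X Y]] X Y
    by (intro eq_mat_vecI[of _ ?n ?n]) (auto simp: bracket minus_mult_distrib_mat_vec[of _ ?n ?n]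
        assoc_mult_mat_vec[of _ ?n ?n _ ?n] intro!: minus_carrier_mat)
next
  let ?n = "deg R"
  fix c X assume X: "X \<in> sl3"
  show "act R (c \<cdot>\<^sub>m X) = c \<cdot>\<^sub>m act R X"
    using car[OF X] car[OF sl3_smult[OF X]] X
    by (intro eq_mat_vecI[of _ ?n ?n]) (auto simp: smult)
qed

section \<open>Direct sums\<close>

lemma vec_append_cases:
  assumes "v \<in> carrier_vec (a + b)"
  obtains u w where "u \<in> carrier_vec a" "w \<in> carrier_vec b" "v = u @\<^sub>v w"
  using that[of "vec_first v a" "vec_last v b"] vec_first_last_append[OF assms] by simp

lemma four_block_mat_mult_append:
  assumes "A \<in> carrier_mat a c" "B \<in> carrier_mat a d" "C \<in> carrier_mat b c" "D \<in> carrier_mat b d"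
    "u \<in> carrier_vec c" "w \<in> carrier_vec d"
  shows "four_block_mat A B C D *\<^sub>v (u @\<^sub>v w) = (A *\<^sub>v u + B *\<^sub>v w) @\<^sub>v (C *\<^sub>v u + D *\<^sub>v (w :: complex vec))"
proof (rule eq_vecI)
  fix i assume "i < dim_vec ((A *\<^sub>v u + B *\<^sub>v w) @\<^sub>v (C *\<^sub>v u + D *\<^sub>v w))"
  hence i: "i < a + b" using assms by auto
  show "(four_block_mat A B C D *\<^sub>v (u @\<^sub>v w)) $ i = ((A *\<^sub>v u + B *\<^sub>v w) @\<^sub>v (C *\<^sub>v u + D *\<^sub>v w)) $ i"
  proof (cases "i < a")
    case True
    thus ?thesis using i assms
      by (simp add: row_four_block_mat(1)[OF assms(1-4) True]) (rule scalar_prod_append, auto)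
  next
    case False
    hence "i - a < b" using i by auto
    thus ?thesis using i assms False
      by (simp add: row_four_block_mat(2)[OF assms(1-4) False i]) (rule scalar_prod_append, auto)
  qed
qed (use assms in auto)

lemma four_block_diag_append:
  assumes "A \<in> carrier_mat a c" "D \<in> carrier_mat b d" "u \<in> carrier_vec c" "w \<in> carrier_vec d"
  shows "four_block_mat A (0\<^sub>m a d) (0\<^sub>m b c) D *\<^sub>v (u @\<^sub>v w) = (A *\<^sub>v u) @\<^sub>v (D *\<^sub>v (w :: complex vec))"
  using assms by (subst four_block_mat_mult_append[of _ a c _ d _ b]) auto

lemma append_vec_arith:
  assumes "u \<in> carrier_vec a" "u' \<in> carrier_vec a" "w \<in> carrier_vec b" "w' \<in> carrier_vec b"
  shows "(u @\<^sub>v w) + (u' @\<^sub>v w') = (u + u') @\<^sub>v (w + (w' :: complex vec))"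
    "(u @\<^sub>v w) - (u' @\<^sub>v w') = (u - u') @\<^sub>v (w - w')"
    "c \<cdot>\<^sub>v (u @\<^sub>v w) = (c \<cdot>\<^sub>v u) @\<^sub>v (c \<cdot>\<^sub>v w)"
  by (intro eq_vecI; use assms in auto)+

lemma append_vec_eq_iff:
  assumes "u \<in> carrier_vec a" "u' \<in> carrier_vec a"
  shows "(u @\<^sub>v w) = (u' @\<^sub>v w') \<longleftrightarrow> u = u' \<and> w = w'"
  using append_vec_eq[OF assms] by blast

lemma zero_vec_append: "0\<^sub>v (a + b) = 0\<^sub>v a @\<^sub>v 0\<^sub>v b"
  by (intro eq_vecI) auto

text \<open>The binary form of \<open>direct_sum_repn\<close>, in which vectors split into pairs and
  statements about lists reduce to one step of an induction.\<close>

definition dsum :: "repn \<Rightarrow> repn \<Rightarrow> repn" where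
  "dsum R S = Repn (deg R + deg S)
     (\<lambda>X. four_block_mat (act R X) (0\<^sub>m (deg R) (deg S)) (0\<^sub>m (deg S) (deg R)) (act S X))"

lemma deg_dsum [simp]: "deg (dsum R S) = deg R + deg S"
  by (simp add: dsum_def)

lemma act_dsum_append:
  assumes "is_repn R" "is_repn S" "X \<in> sl3" "u \<in> carrier_vec (deg R)" "w \<in> carrier_vec (deg S)"
  shows "act (dsum R S) X *\<^sub>v (u @\<^sub>v w) = (act R X *\<^sub>v u) @\<^sub>v (act S X *\<^sub>v w)"
  using assms is_repn_carrier[of R X] is_repn_carrier[of S X]
  by (simp add: dsum_def four_block_diag_append)

lemma is_repn_dsum:
  assumes R: "is_repn R" and S: "is_repn S"
  shows "is_repn (dsum R S)"
proof -
  interpret R: sl3_repn R by unfold_locales (rule R)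
  interpret S: sl3_repn S by unfold_locales (rule S)
  note act = act_dsum_append[OF R S]
  show ?thesis
  proof (rule is_repnI)
    fix X assume "X \<in> sl3"
    thus "act (dsum R S) X \<in> carrier_mat (deg (dsum R S)) (deg (dsum R S))"
      using is_repn_carrier[OF R] is_repn_carrier[OF S] by (simp add: dsum_def four_block_carrier_mat)
  next
    fix X Y and v :: "complex vec" assume X: "X \<in> sl3" and Y: "Y \<in> sl3" and v: "v \<in> carrier_vec (deg (dsum R S))"
    then obtain u w where uw: "u \<in> carrier_vec (deg R)" "w \<in> carrier_vec (deg S)" "v = u @\<^sub>v w"
      by (auto elim: vec_append_cases)
    show "act (dsum R S) (X + Y) *\<^sub>v v = act (dsum R S) X *\<^sub>v v + act (dsum R S) Y *\<^sub>v v"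
      using uw X Y R S R.op_mat_add[OF X Y uw(1)] S.op_mat_add[OF X Y uw(2)]
      by (simp add: act sl3_add append_vec_arith[where a = "deg R" and b = "deg S"] R.op_def S.op_def)
    show "act (dsum R S) (X * Y - Y * X) *\<^sub>v v =
       act (dsum R S) X *\<^sub>v (act (dsum R S) Y *\<^sub>v v) - act (dsum R S) Y *\<^sub>v (act (dsum R S) X *\<^sub>v v)"
      using uw X Y R S R.op_bracket[OF X Y uw(1)] S.op_bracket[OF X Y uw(2)]
      by (simp add: act sl3_bracket append_vec_arith[where a = "deg R" and b = "deg S"] R.op_def S.op_def)
  next
    fix c X and v :: "complex vec" assume X: "X \<in> sl3" and v: "v \<in> carrier_vec (deg (dsum R S))"
    then obtain u w where uw: "u \<in> carrier_vec (deg R)" "w \<in> carrier_vec (deg S)" "v = u @\<^sub>v w"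
      by (auto elim: vec_append_cases)
    show "act (dsum R S) (c \<cdot>\<^sub>m X) *\<^sub>v v = c \<cdot>\<^sub>v (act (dsum R S) X *\<^sub>v v)"
      using uw X R S R.op_mat_smult[OF X uw(1)] S.op_mat_smult[OF X uw(2)]
      by (simp add: act sl3_smult append_vec_arith[where a = "deg R" and b = "deg S"] R.op_def S.op_def)
  qed
qed

text \<open>The hypotheses make \<open>J1 * L1\<close> and \<open>J2 * L2\<close> complementary
  projections. Stacking \<open>L1\<close> on \<open>L2\<close> gives one direction of the
  isomorphism, placing \<open>J1\<close> beside \<open>J2\<close> gives the other.\<close>

lemma iso_dsumI:
  assumes T: "is_repn T" and R: "is_repn R" and S: "is_repn S"
    and J1: "intertwines R T J1" and J2: "intertwines S T J2"
    and L1: "intertwines T R L1" and L2: "intertwines T S L2"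
    and 11: "\<And>u. u \<in> carrier_vec (deg R) \<Longrightarrow> L1 *\<^sub>v (J1 *\<^sub>v u) = u"
    and 21: "\<And>u. u \<in> carrier_vec (deg R) \<Longrightarrow> L2 *\<^sub>v (J1 *\<^sub>v u) = 0\<^sub>v (deg S)"
    and 12: "\<And>w. w \<in> carrier_vec (deg S) \<Longrightarrow> L1 *\<^sub>v (J2 *\<^sub>v w) = 0\<^sub>v (deg R)"
    and 22: "\<And>w. w \<in> carrier_vec (deg S) \<Longrightarrow> L2 *\<^sub>v (J2 *\<^sub>v w) = w"
    and sum: "\<And>v. v \<in> carrier_vec (deg T) \<Longrightarrow> J1 *\<^sub>v (L1 *\<^sub>v v) + J2 *\<^sub>v (L2 *\<^sub>v v) = v"
  shows "iso_repn T (dsum R S)"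
proof -
  note [simp] = intertwinesD(3)[OF J1] intertwinesD(3)[OF J2] intertwinesD(3)[OF L1] intertwinesD(3)[OF L2]
  note J1c = intertwinesD(1)[OF J1] and J2c = intertwinesD(1)[OF J2] and L1c = intertwinesD(1)[OF L1]
    and L2c = intertwinesD(1)[OF L2]
  define P where "P = L1 @\<^sub>r L2"
  define Q where "Q = mat (deg T) (deg R + deg S) (\<lambda>(i, j). if j < deg R then J1 $$ (i, j) else J2 $$ (i, j - deg R))"
  have P: "P \<in> carrier_mat (deg R + deg S) (deg T)" unfolding P_def using L1c L2c by auto
  have Q: "Q \<in> carrier_mat (deg T) (deg R + deg S)" by (simp add: Q_def)
  have Pv: "P *\<^sub>v v = (L1 *\<^sub>v v) @\<^sub>v (L2 *\<^sub>v v)" if "v \<in> carrier_vec (deg T)" for v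
    unfolding P_def by (rule mat_mult_append[OF L1c L2c that])
  have Qv: "Q *\<^sub>v (u @\<^sub>v w) = J1 *\<^sub>v u + J2 *\<^sub>v w" if u: "u \<in> carrier_vec (deg R)" and w: "w \<in> carrier_vec (deg S)" for u w
  proof (rule eq_vecI)
    fix i assume "i < dim_vec (J1 *\<^sub>v u + J2 *\<^sub>v w)"
    hence i: "i < deg T" using J2c by simp
    have "row Q i = row J1 i @\<^sub>v row J2 i"
      using i J1c J2c by (intro eq_vecI) (auto simp: Q_def)
    thus "(Q *\<^sub>v (u @\<^sub>v w)) $ i = (J1 *\<^sub>v u + J2 *\<^sub>v w) $ i"
      using i J1c J2c Q u w
      by (simp add: scalar_prod_append[of _ "deg R" _ "deg S"] carrier_matD)
  qed (use Q J2c in auto)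
  have "intertwines T (dsum R S) P"
    unfolding intertwines_def
    using P T intertwinesD(2)[OF L1] intertwinesD(2)[OF L2] by (simp add: Pv act_dsum_append R S)
  moreover have "intertwines (dsum R S) T Q"
    unfolding intertwines_def
  proof (intro conjI ballI)
    fix X and v :: "complex vec" assume X: "X \<in> sl3" and v: "v \<in> carrier_vec (deg (dsum R S))"
    then obtain u w where uw: "u \<in> carrier_vec (deg R)" "w \<in> carrier_vec (deg S)" "v = u @\<^sub>v w"
      by (auto elim: vec_append_cases)
    show "Q *\<^sub>v (act (dsum R S) X *\<^sub>v v) = act T X *\<^sub>v (Q *\<^sub>v v)"
      using uw X R S T intertwinesD(2)[OF J1 X] intertwinesD(2)[OF J2 X]
      by (simp add: act_dsum_append Qv mult_add_distrib_mat_vec[OF is_repn_carrier[OF T X]])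
  qed (use Q in simp)
  moreover have "Q *\<^sub>v (P *\<^sub>v v) = v" if "v \<in> carrier_vec (deg T)" for v
    using that sum by (simp add: Pv Qv)
  moreover have "P *\<^sub>v (Q *\<^sub>v v) = v" if "v \<in> carrier_vec (deg (dsum R S))" for v
  proof -
    from that obtain u w where uw: "u \<in> carrier_vec (deg R)" "w \<in> carrier_vec (deg S)" "v = u @\<^sub>v w"
      by (auto elim: vec_append_cases)
    thus ?thesis
      using 11 12 21 22
      by (simp add: Pv Qv mult_add_distrib_mat_vec[OF L1c] mult_add_distrib_mat_vec[OF L2c])
  qed
  ultimately show ?thesis
    by (subst iso_repn_iff[OF T is_repn_dsum[OF R S]]) blast
qed

lemma iso_dsum_cong:
  assumes R: "is_repn R" and R': "is_repn R'" and S: "is_repn S" and S': "is_repn S'"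
    and "iso_repn R R'" "iso_repn S S'"
  shows "iso_repn (dsum R S) (dsum R' S')"
proof -
  from assms(5) obtain P Q where P: "intertwines R R' P" "intertwines R' R Q"
    "\<And>v. v\<in>carrier_vec (deg R) \<Longrightarrow> Q *\<^sub>v (P *\<^sub>v v) = v"
    "\<And>v. v\<in>carrier_vec (deg R') \<Longrightarrow> P *\<^sub>v (Q *\<^sub>v v) = v" by (auto simp: iso_repn_iff R R')
  from assms(6) obtain P' Q' where P': "intertwines S S' P'" "intertwines S' S Q'"
    "\<And>v. v\<in>carrier_vec (deg S) \<Longrightarrow> Q' *\<^sub>v (P' *\<^sub>v v) = v"
    "\<And>v. v\<in>carrier_vec (deg S') \<Longrightarrow> P' *\<^sub>v (Q' *\<^sub>v v) = v" by (auto simp: iso_repn_iff S S')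
  define D where "D = (\<lambda>A B. four_block_mat A (0\<^sub>m (dim_row A) (dim_col B)) (0\<^sub>m (dim_row B) (dim_col A)) (B :: complex mat))"
  have D: "D A B *\<^sub>v (u @\<^sub>v w) = (A *\<^sub>v u) @\<^sub>v (B *\<^sub>v w)"
    if "A \<in> carrier_mat a c" "B \<in> carrier_mat b d" "u \<in> carrier_vec c" "w \<in> carrier_vec d" for A B a b c d u w
    using that four_block_diag_append[OF that] by (simp add: D_def carrier_matD)
  have int: "intertwines (dsum R S) (dsum R' S') (D P P')"
    if "is_repn R" "is_repn R'" "is_repn S" "is_repn S'" "intertwines R R' P" "intertwines S S' P'" for R R' S S' P P'
    unfolding intertwines_def
  proof (intro conjI ballI)
    note c = intertwinesD[OF that(5)] intertwinesD[OF that(6)]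
    show "D P P' \<in> carrier_mat (deg (dsum R' S')) (deg (dsum R S))"
      using c(1,4) by (simp add: D_def four_block_carrier_mat)
    fix X and v :: "complex vec" assume X: "X \<in> sl3" and v: "v \<in> carrier_vec (deg (dsum R S))"
    then obtain u w where uw: "u \<in> carrier_vec (deg R)" "w \<in> carrier_vec (deg S)" "v = u @\<^sub>v w"
      by (auto elim: vec_append_cases)
    show "D P P' *\<^sub>v (act (dsum R S) X *\<^sub>v v) = act (dsum R' S') X *\<^sub>v (D P P' *\<^sub>v v)"
      using that(1-4) c uw X by (simp add: act_dsum_append D[OF c(1,4)])
  qed
  have inv: "D Q Q' *\<^sub>v (D P P' *\<^sub>v v) = v"
    if "intertwines R R' P" "intertwines S S' P'" "intertwines R' R Q" "intertwines S' S Q'"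
      "\<And>v. v\<in>carrier_vec (deg R) \<Longrightarrow> Q *\<^sub>v (P *\<^sub>v v) = v"
      "\<And>v. v\<in>carrier_vec (deg S) \<Longrightarrow> Q' *\<^sub>v (P' *\<^sub>v v) = v" "v \<in> carrier_vec (deg (dsum R S))" for R R' S S' P P' Q Q' v
  proof -
    note c = intertwinesD[OF that(1)] intertwinesD[OF that(2)] intertwinesD[OF that(3)] intertwinesD[OF that(4)]
    from that(7) obtain u w where uw: "u \<in> carrier_vec (deg R)" "w \<in> carrier_vec (deg S)" "v = u @\<^sub>v w"
      by (auto elim: vec_append_cases)
    thus ?thesis using c that(5,6) by (simp add: D[OF c(1,4)] D[OF c(7,10)])
  qed
  show ?thesis
    unfolding iso_repn_iff[OF is_repn_dsum[OF R S] is_repn_dsum[OF R' S']]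
    using int[OF R R' S S' P(1) P'(1)] int[OF R' R S' S P(2) P'(2)]
      inv[OF P(1) P'(1) P(2) P'(2) P(3) P'(3)] inv[OF P(2) P'(2) P(1) P'(1) P(4) P'(4)] by blast
qed

text \<open>Agreement is asked for on \<open>sl3\<close> alone: outside it the matrices may have any
  size, and there \<open>diag_block_mat\<close> and \<open>dsum\<close> can differ.\<close>

lemma is_repn_cong:
  assumes "deg R = deg S" "\<And>X. X \<in> sl3 \<Longrightarrow> act R X = act S X"
  shows "is_repn R \<longleftrightarrow> is_repn S"
  using assms sl3_add sl3_smult sl3_bracket unfolding is_repn_def by simp

lemma iso_repn_cong:
  assumes "deg R = deg S" "\<And>X. X \<in> sl3 \<Longrightarrow> act R X = act S X" "is_repn R"
  shows "iso_repn R S"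
  using assms is_repn_cong[OF assms(1,2)]
  by (subst iso_repn_iff) (auto intro!: exI[of _ "1\<^sub>m (deg R)"] simp: intertwines_def)

lemma direct_sum_repn_Nil: "is_repn (direct_sum_repn [])" "deg (direct_sum_repn []) = 0"
  by (auto simp: direct_sum_repn_def is_repn_def intro!: eq_matI)

lemma deg_direct_sum_Cons: "deg (direct_sum_repn (R # Rs)) = deg (dsum R (direct_sum_repn Rs))"
  by (simp add: direct_sum_repn_def)

text \<open>The two claims are intertwined: the block matrices of the list and of
  \<open>dsum\<close> coincide only once the tail is known to act by matrices of the right
  size.\<close>

lemma is_repn_direct_sum:
  assumes "\<forall>R\<in>set Rs. is_repn R"
  shows "is_repn (direct_sum_repn Rs)"
    and "Rs = R # Rs' \<Longrightarrow> X \<in> sl3 \<Longrightarrow> act (direct_sum_repn Rs) X = act (dsum R (direct_sum_repn Rs')) X"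
proof -
  have *: "act (direct_sum_repn (R # Rs)) X = act (dsum R (direct_sum_repn Rs)) X"
    if "is_repn R" "is_repn (direct_sum_repn Rs)" "X \<in> sl3" for R Rs X
    using is_repn_carrier[OF that(1,3)] is_repn_carrier[OF that(2,3)]
    by (simp add: direct_sum_repn_def dsum_def Let_def)
  have rep: "\<forall>R\<in>set Rs. is_repn R \<Longrightarrow> is_repn (direct_sum_repn Rs)" for Rs
  proof (induction Rs)
    case (Cons R Rs)
    thus ?case
      using is_repn_cong[OF deg_direct_sum_Cons *[of R Rs]] is_repn_dsum[of R "direct_sum_repn Rs"] by simp
  qed (simp add: direct_sum_repn_Nil)
  from rep assms show "is_repn (direct_sum_repn Rs)" by blast
  show "Rs = R # Rs' \<Longrightarrow> X \<in> sl3 \<Longrightarrow> act (direct_sum_repn Rs) X = act (dsum R (direct_sum_repn Rs')) X"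
    using * rep[of Rs'] assms by simp
qed

lemma iso_direct_sum_Cons:
  assumes "is_repn R" "\<forall>S\<in>set Rs. is_repn S"
  shows "iso_repn (direct_sum_repn (R # Rs)) (dsum R (direct_sum_repn Rs))"
  using assms by (intro iso_repn_cong is_repn_direct_sum deg_direct_sum_Cons) auto

lemma iso_direct_sum_append:
  assumes "\<forall>R\<in>set Rs. is_repn R" "\<forall>S\<in>set Ss. is_repn S"
  shows "iso_repn (dsum (direct_sum_repn Rs) (direct_sum_repn Ss)) (direct_sum_repn (Rs @ Ss))"
proof (rule iso_repn_cong)
  show "is_repn (dsum (direct_sum_repn Rs) (direct_sum_repn Ss))"
    using assms by (intro is_repn_dsum is_repn_direct_sum)
  fix X assume X: "X \<in> sl3"
  show "act (dsum (direct_sum_repn Rs) (direct_sum_repn Ss)) X = act (direct_sum_repn (Rs @ Ss)) X"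
    using is_repn_carrier[OF is_repn_direct_sum(1)[OF assms(1)] X]
      is_repn_carrier[OF is_repn_direct_sum(1)[OF assms(2)] X]
    by (simp add: direct_sum_repn_def dsum_def Let_def diag_block_mat_append)
qed (simp add: direct_sum_repn_def)

subsection \<open>Weight multiplicities\<close>

definition weight_diag :: "(weight \<Rightarrow> int) \<Rightarrow> weight list \<Rightarrow> complex mat" where
  "weight_diag f ws = mat (length ws) (length ws) (\<lambda>(i, j). if i = j then of_int (f (ws ! i)) else 0)"

lemma weight_diag_mult:
  "v \<in> carrier_vec (length ws) \<Longrightarrow> weight_diag f ws *\<^sub>v v = vec (length ws) (\<lambda>i. of_int (f (ws ! i)) * v $ i)"
  by (intro eq_vecI)
     (auto simp: weight_diag_def scalar_prod_def if_distrib[of "\<lambda>x. x * _"] sum.delta cong: if_cong)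

text \<open>Coordinates in which the Cartan subalgebra acts diagonally. Entry \<open>i\<close> of
  the list is the weight of the unit vector \<open>i\<close>, so the list records
  multiplicities.\<close>

definition diag_repn :: "repn \<Rightarrow> weight list \<Rightarrow> bool" where
  "diag_repn D ws \<longleftrightarrow> is_repn D \<and> deg D = length ws \<and>
     act D (coroot 0) = weight_diag fst ws \<and> act D (coroot 1) = weight_diag snd ws"

definition has_weights :: "repn \<Rightarrow> weight list \<Rightarrow> bool" where
  "has_weights R ws \<longleftrightarrow> (\<exists>D. diag_repn D ws \<and> iso_repn R D)"

lemma weight_space_diag:
  assumes "diag_repn D ws"
  shows "weight_space D \<mu> = {v \<in> carrier_vec (length ws). \<forall>i<length ws. v $ i \<noteq> 0 \<longrightarrow> ws ! i = \<mu>}"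
proof -
  have "vec (length ws) (\<lambda>i. of_int (f (ws ! i)) * v $ i) = of_int c \<cdot>\<^sub>v v \<longleftrightarrow>
      (\<forall>i<length ws. v $ i \<noteq> 0 \<longrightarrow> f (ws ! i) = c)" if "v \<in> carrier_vec (length ws)" for f c and v :: "complex vec"
    using that by (auto simp: vec_eq_iff)
  thus ?thesis
    using assms by (auto simp: weight_space_def diag_repn_def weight_diag_mult prod_eq_iff)
qed

lemma weight_space_subspace:
  assumes "is_repn R"
  shows "VectorSpace.subspace class_ring (weight_space R \<mu>) (module_vec TYPE(complex) (deg R))"
proof -
  interpret sl3_repn R by unfold_locales (rule assms)
  show ?thesis
    unfolding subspace_iff weight_space_def op_def[symmetric]
    by (auto simp: coroot_sl3 smult_add_distrib_vec[of _ n] smult_smult_assoc mult.commute)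
qed

lemma intertwines_weight_space:
  assumes "intertwines R S K" "v \<in> weight_space R \<mu>"
  shows "K *\<^sub>v v \<in> weight_space S \<mu>"
proof -
  note K = intertwinesD[OF assms(1)]
  have v: "v \<in> carrier_vec (deg R)" using assms(2) by (auto simp: weight_space_def)
  show ?thesis
    using assms(2) K(2)[OF coroot_sl3 v, of 0] K(2)[OF coroot_sl3 v, of 1] K(3)[OF v] mult_mat_vec[OF K(1) v]
    by (auto simp: weight_space_def)
qed

lemma weight_space_basis:
  assumes D: "diag_repn D ws"
  shows "\<exists>J\<in>carrier_mat (length ws) (count_list ws \<mu>). \<exists>L\<in>carrier_mat (count_list ws \<mu>) (length ws).
    (\<forall>x\<in>carrier_vec (count_list ws \<mu>). J *\<^sub>v x \<in> weight_space D \<mu> \<and> L *\<^sub>v (J *\<^sub>v x) = x) \<and>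
    (\<forall>u\<in>weight_space D \<mu>. J *\<^sub>v (L *\<^sub>v u) = u)"
proof -
  \<comment> \<open>The positions that carry the weight \<open>\<mu>\<close>: \<open>J\<close>
    inserts coordinates at these positions and \<open>L\<close> reads them off.\<close>
  define ix where "ix = filter (\<lambda>i. ws ! i = \<mu>) [0..<length ws]"
  define r where "r = length ix"
  have is_lt: "ix ! k < length ws" "ws ! (ix ! k) = \<mu>" if "k < r" for k
    using nth_mem[of k ix] that unfolding r_def by (auto simp: ix_def)
  have is_inj: "ix ! k = ix ! l \<longleftrightarrow> k = l" if "k < r" "l < r" for k l
    using that nth_eq_iff_index_eq[of ix] unfolding r_def by (auto simp: ix_def)
  have is_ex: "\<exists>k<r. ix ! k = i" if "i < length ws" "ws ! i = \<mu>" for i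
    using that in_set_conv_nth[of i ix] unfolding r_def by (auto simp: ix_def)
  have "r = length (filter (\<lambda>w. w = \<mu>) (map ((!) ws) [0..<length ws]))"
    by (simp add: r_def ix_def filter_map o_def)
  also have "\<dots> = count_list ws \<mu>"
  proof -
    have "(\<lambda>w. w = \<mu>) = (=) \<mu>" by auto
    thus ?thesis by (simp only: map_nth count_list_eq_length_filter)
  qed
  finally have r: "r = count_list ws \<mu>" .
  define J where "J = mat (length ws) r (\<lambda>(i, k). if i = ix ! k then 1 else 0 :: complex)"
  define L where "L = mat r (length ws) (\<lambda>(k, i). if i = ix ! k then 1 else 0 :: complex)"
  have J: "J \<in> carrier_mat (length ws) r" and L: "L \<in> carrier_mat r (length ws)" by (simp_all add: J_def L_def)
  have Lv: "L *\<^sub>v v = vec r (\<lambda>k. v $ (ix ! k))" if "v \<in> carrier_vec (length ws)" for v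
    using that is_lt
    by (intro eq_vecI) (auto simp: L_def scalar_prod_def if_distrib[of "\<lambda>x. x * _"] sum.delta cong: if_cong)
  have Jv: "J *\<^sub>v x = vec (length ws) (\<lambda>i. \<Sum>k<r. if i = ix ! k then x $ k else 0)" if "x \<in> carrier_vec r" for x
    using that
    by (intro eq_vecI) (auto simp: J_def scalar_prod_def lessThan_atLeast0 if_distrib[of "\<lambda>x. x * _"] cong: if_cong)
  have Jk: "(J *\<^sub>v x) $ (ix ! k) = x $ k" if "x \<in> carrier_vec r" "k < r" for x k
  proof -
    have "(J *\<^sub>v x) $ (ix ! k) = (\<Sum>l<r. if ix ! k = ix ! l then x $ l else 0)"
      using that is_lt by (simp add: Jv)
    also have "\<dots> = (\<Sum>l<r. if k = l then x $ l else 0)"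
      using that is_inj by (intro sum.cong) auto
    finally show ?thesis using that by (simp add: sum.delta)
  qed
  have J0: "(J *\<^sub>v x) $ i = 0" if "x \<in> carrier_vec r" "i < length ws" "ws ! i \<noteq> \<mu>" for x i
    using that is_lt by (auto simp: Jv intro!: sum.neutral)
  have LJ: "L *\<^sub>v (J *\<^sub>v x) = x" if "x \<in> carrier_vec r" for x
    using that J by (subst Lv) (auto simp: Jk intro!: eq_vecI)
  have JL: "J *\<^sub>v (L *\<^sub>v u) = u" if "u \<in> weight_space D \<mu>" for u
  proof (rule eq_vecI)
    have u: "u \<in> carrier_vec (length ws)" and u0: "\<And>i. i < length ws \<Longrightarrow> u $ i \<noteq> 0 \<Longrightarrow> ws ! i = \<mu>"
      using that by (auto simp: weight_space_diag[OF D])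
    have Lu: "L *\<^sub>v u \<in> carrier_vec r" using L u by auto
    show "dim_vec (J *\<^sub>v (L *\<^sub>v u)) = dim_vec u" using J u by auto
    fix i assume "i < dim_vec u"
    hence i: "i < length ws" using u by auto
    show "(J *\<^sub>v (L *\<^sub>v u)) $ i = u $ i"
    proof (cases "ws ! i = \<mu>")
      case True
      then obtain k where "k < r" "ix ! k = i" using is_ex i by blast
      thus ?thesis using Jk[OF Lu] u by (auto simp: Lv)
    qed (use J0[OF Lu i] u0[OF i] in auto)
  qed
  have JW: "J *\<^sub>v x \<in> weight_space D \<mu>" if "x \<in> carrier_vec r" for x
    using that J J0[OF that] by (auto simp: weight_space_diag[OF D])
  show ?thesis
    using J L LJ JL JW unfolding r by blast
qed

text \<open>Intertwiners preserve weight spaces, so the coordinates of the weight space of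
  \<open>D\<close> are pulled back to \<open>R\<close> along \<open>Q\<close> and read off after
  \<open>P\<close>.\<close>

lemma weight_mult_has_weights:
  assumes R: "is_repn R" and w: "has_weights R ws"
  shows "weight_mult R \<mu> = count_list ws \<mu>"
proof -
  from w obtain D where D: "diag_repn D ws" and iso: "iso_repn R D" by (auto simp: has_weights_def)
  have rD: "is_repn D" and dD: "deg D = length ws" using D by (auto simp: diag_repn_def)
  from iso obtain P Q where P: "intertwines R D P" "intertwines D R Q"
    "\<And>v. v\<in>carrier_vec (deg R) \<Longrightarrow> Q *\<^sub>v (P *\<^sub>v v) = v"
    "\<And>v. v\<in>carrier_vec (deg D) \<Longrightarrow> P *\<^sub>v (Q *\<^sub>v v) = v" by (auto simp: iso_repn_iff R rD)
  note Pc = intertwinesD(1)[OF P(1)] and Qc = intertwinesD(1)[OF P(2)]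
  define r where "r = count_list ws \<mu>"
  obtain J L where J: "J \<in> carrier_mat (length ws) r" and L: "L \<in> carrier_mat r (length ws)"
    and JW: "\<And>x. x \<in> carrier_vec r \<Longrightarrow> J *\<^sub>v x \<in> weight_space D \<mu>"
    and LJ: "\<And>x. x \<in> carrier_vec r \<Longrightarrow> L *\<^sub>v (J *\<^sub>v x) = x"
    and JL: "\<And>u. u \<in> weight_space D \<mu> \<Longrightarrow> J *\<^sub>v (L *\<^sub>v u) = u"
    using weight_space_basis[OF D, of \<mu>] unfolding r_def by blast
  have "vectorspace.dim class_ring (module_vec TYPE(complex) (deg R) \<lparr>carrier := weight_space R \<mu>\<rparr>) = r"
  proof (rule dim_eqI[OF weight_space_subspace[OF R], of "Q * J" _ "L * P"])
    show "Q * J \<in> carrier_mat (deg R) r" "L * P \<in> carrier_mat r (deg R)"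
      using J L Pc Qc dD by auto
    have QJ: "(Q * J) *\<^sub>v x = Q *\<^sub>v (J *\<^sub>v x)" if "x \<in> carrier_vec r" for x
      using J Qc dD that by (intro assoc_mult_mat_vec) auto
    have LP: "(L * P) *\<^sub>v x = L *\<^sub>v (P *\<^sub>v x)" if "x \<in> carrier_vec (deg R)" for x
      using L Pc dD that by (intro assoc_mult_mat_vec) auto
    show "(Q * J) *\<^sub>v x \<in> weight_space R \<mu>" if "x \<in> carrier_vec r" for x
      using intertwines_weight_space[OF P(2) JW[OF that]] that by (simp add: QJ)
    show "(L * P) *\<^sub>v ((Q * J) *\<^sub>v x) = x" if "x \<in> carrier_vec r" for x
      using that J dD Qc P(4)[of "J *\<^sub>v x"] by (simp add: QJ LP LJ)
    show "(Q * J) *\<^sub>v ((L * P) *\<^sub>v u) = u" if "u \<in> weight_space R \<mu>" for u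
    proof -
      have u: "u \<in> carrier_vec (deg R)" using that by (auto simp: weight_space_def)
      have "L *\<^sub>v (P *\<^sub>v u) \<in> carrier_vec r" using L Pc dD u by auto
      thus ?thesis
        using JL[OF intertwines_weight_space[OF P(1) that]] P(3)[OF u] u by (simp add: QJ LP)
    qed
  qed
  thus ?thesis by (simp add: weight_mult_def r_def)
qed

lemma has_weights_diag: "diag_repn D ws \<Longrightarrow> has_weights D ws"
  using iso_repn_refl by (auto simp: has_weights_def diag_repn_def)

lemma has_weights_iso:
  assumes "is_repn R" "is_repn S" "iso_repn R S" "has_weights S ws"
  shows "has_weights R ws"
proof -
  from assms(4) obtain D where D: "diag_repn D ws" "iso_repn S D" by (auto simp: has_weights_def)
  hence "is_repn D" by (simp add: diag_repn_def)
  with D assms(1-3) iso_repn_trans[of R S D] show ?thesis by (auto simp: has_weights_def)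
qed

lemma weight_diag_append:
  "weight_diag f (ws @ vs) = four_block_mat (weight_diag f ws) (0\<^sub>m (length ws) (length vs))
     (0\<^sub>m (length vs) (length ws)) (weight_diag f vs)"
  by (intro eq_matI) (auto simp: weight_diag_def nth_append)

lemma has_weights_dsum:
  assumes R: "is_repn R" and S: "is_repn S" and "has_weights R ws" "has_weights S vs"
  shows "has_weights (dsum R S) (ws @ vs)"
proof -
  from assms obtain D E where D: "diag_repn D ws" "iso_repn R D" and E: "diag_repn E vs" "iso_repn S E"
    by (auto simp: has_weights_def)
  have act: "act (dsum D E) X = four_block_mat (act D X) (0\<^sub>m (deg D) (deg E)) (0\<^sub>m (deg E) (deg D)) (act E X)" for X
    by (simp add: dsum_def)
  have "is_repn (dsum D E)"
    using D(1) E(1) is_repn_dsum by (simp add: diag_repn_def)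
  hence "diag_repn (dsum D E) (ws @ vs)"
    using D(1) E(1) by (simp add: diag_repn_def weight_diag_append act)
  moreover have "iso_repn (dsum R S) (dsum D E)"
    using R S D E by (intro iso_dsum_cong) (auto simp: diag_repn_def)
  ultimately show ?thesis by (auto simp: has_weights_def)
qed

lemma has_weights_direct_sum:
  assumes "list_all2 has_weights Rs wss" "\<forall>R\<in>set Rs. is_repn R"
  shows "has_weights (direct_sum_repn Rs) (concat wss)"
  using assms
proof (induction Rs wss rule: list_all2_induct)
  case Nil
  have "act (direct_sum_repn []) X = weight_diag f []" for X f
    by (auto simp: direct_sum_repn_def weight_diag_def)
  hence "diag_repn (direct_sum_repn []) []"
    by (simp add: diag_repn_def direct_sum_repn_Nil)
  thus ?case using has_weights_diag by simp
next
  case (Cons R Rs ws wss)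
  thus ?case
    using has_weights_iso[OF is_repn_direct_sum(1) is_repn_dsum iso_direct_sum_Cons]
      has_weights_dsum is_repn_direct_sum(1)[of Rs] is_repn_direct_sum(1)[of "R # Rs"] by simp
qed

subsection \<open>Tensor products\<close>

text \<open>This is the index convention of \<open>kron\<close>: an index \<open>i\<close> encodes
  the pair \<open>(i div k, i mod k)\<close>, which turns a sum over a Kronecker index into a double
  sum.\<close>

lemma sum_div_mod:
  fixes f :: "nat \<Rightarrow> nat \<Rightarrow> 'a :: comm_monoid_add"
  shows "(\<Sum>i<m * k. f (i div k) (i mod k)) = (\<Sum>a<m. \<Sum>b<k. f a b)"
proof -
  have "(\<Sum>i<m * k. f (i div k) (i mod k)) = (\<Sum>a<m. \<Sum>i\<in>{a * k..<a * k + k}. f (i div k) (i mod k))"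
    by (rule sum.nat_group[symmetric])
  also have "\<dots> = (\<Sum>a<m. \<Sum>b<k. f a b)"
  proof (rule sum.cong[OF refl])
    fix a
    have "i div k = a \<and> i mod k = i - a * k" if "a * k \<le> i" "i < a * k + k" for i
    proof -
      have "i div k = a" using that by (intro div_nat_eqI) (auto simp: mult.commute)
      thus ?thesis by (simp add: minus_div_mult_eq_mod[symmetric])
    qed
    thus "(\<Sum>i\<in>{a * k..<a * k + k}. f (i div k) (i mod k)) = (\<Sum>b<k. f a b)"
      by (intro sum.reindex_bij_witness[of _ "\<lambda>b. a * k + b" "\<lambda>i. i - a * k"]) auto
  qed
  finally show ?thesis .
qed

lemma div_mod_less:
  assumes "(i::nat) < m * k"
  shows "i div k < m" "i mod k < k"
proof -
  have "k > 0" using assms by (cases k) auto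
  thus "i mod k < k" by simp
  show "i div k < m" using assms by (simp add: less_mult_imp_div_less)
qed

definition kron_vec :: "complex vec \<Rightarrow> complex vec \<Rightarrow> complex vec" where
  "kron_vec v w = vec (dim_vec v * dim_vec w) (\<lambda>i. v $ (i div dim_vec w) * w $ (i mod dim_vec w))"

lemma kron_carrier [simp]:
  "A \<in> carrier_mat a b \<Longrightarrow> B \<in> carrier_mat c d \<Longrightarrow> kron A B \<in> carrier_mat (a * c) (b * d)"
  by (auto simp: kron_def)

lemma kron_index:
  "A \<in> carrier_mat a b \<Longrightarrow> B \<in> carrier_mat c d \<Longrightarrow> i < a * c \<Longrightarrow> j < b * d \<Longrightarrow>
    kron A B $$ (i, j) = A $$ (i div c, j div d) * B $$ (i mod c, j mod d)"
  by (auto simp: kron_def)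

lemma kron_vec_carrier [simp]:
  "v \<in> carrier_vec a \<Longrightarrow> w \<in> carrier_vec b \<Longrightarrow> kron_vec v w \<in> carrier_vec (a * b)"
  by (auto simp: kron_vec_def)

lemma mat_mult_index:
  "A \<in> carrier_mat a b \<Longrightarrow> B \<in> carrier_mat b c \<Longrightarrow> i < a \<Longrightarrow> j < c \<Longrightarrow>
    (A * B) $$ (i, j) = (\<Sum>k<b. A $$ (i, k) * (B $$ (k, j) :: complex))"
  by (auto simp: scalar_prod_def lessThan_atLeast0 intro!: sum.cong)

text \<open>The mixed product rule. In the summation over pairs each summand is a product of a term
  in the first index and a term in the second, so the double sum factors.\<close>

lemma kron_mult:
  assumes "A \<in> carrier_mat a b" "C \<in> carrier_mat b c" "B \<in> carrier_mat a' b'" "D \<in> carrier_mat b' c'"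
  shows "kron A B * kron C D = kron (A * C) (B * D)"
proof (rule eq_matI)
  fix i j assume "i < dim_row (kron (A * C) (B * D))" "j < dim_col (kron (A * C) (B * D))"
  hence ij: "i < a * a'" "j < c * c'" using assms by (auto simp: kron_def)
  note i = div_mod_less[OF ij(1)] and j = div_mod_less[OF ij(2)]
  have "(kron A B * kron C D) $$ (i, j) = (\<Sum>k<b * b'. kron A B $$ (i, k) * kron C D $$ (k, j))"
    using assms ij by (intro mat_mult_index) auto
  also have "\<dots> = (\<Sum>k<b * b'. (A $$ (i div a', k div b') * C $$ (k div b', j div c')) *
      (B $$ (i mod a', k mod b') * D $$ (k mod b', j mod c')))"
    using ij by (intro sum.cong) (auto simp: kron_index[OF assms(1,3)] kron_index[OF assms(2,4)])
  also have "\<dots> = (\<Sum>k<b. A $$ (i div a', k) * C $$ (k, j div c')) * (\<Sum>l<b'. B $$ (i mod a', l) * D $$ (l, j mod c'))"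
    by (subst sum_div_mod) (simp add: sum_product)
  also have "\<dots> = (A * C) $$ (i div a', j div c') * (B * D) $$ (i mod a', j mod c')"
    using assms i j by (simp add: mat_mult_index del: index_mult_mat)
  also have "\<dots> = kron (A * C) (B * D) $$ (i, j)"
    using assms ij by (intro kron_index[symmetric]) auto
  finally show "(kron A B * kron C D) $$ (i, j) = kron (A * C) (B * D) $$ (i, j)" .
qed (use assms in \<open>auto simp: kron_def\<close>)

lemma kron_mult_vec:
  assumes "A \<in> carrier_mat a b" "B \<in> carrier_mat a' b'" "v \<in> carrier_vec b" "w \<in> carrier_vec b'"
  shows "kron A B *\<^sub>v kron_vec v w = kron_vec (A *\<^sub>v v) (B *\<^sub>v w)"
proof (rule eq_vecI)
  fix i assume "i < dim_vec (kron_vec (A *\<^sub>v v) (B *\<^sub>v w))"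
  hence i: "i < a * a'" using assms by (auto simp: kron_vec_def)
  note i' = div_mod_less[OF i]
  have "(kron A B *\<^sub>v kron_vec v w) $ i = (\<Sum>k<b * b'. kron A B $$ (i, k) * kron_vec v w $ k)"
    using assms i by (auto simp: scalar_prod_def kron_vec_def kron_def lessThan_atLeast0 intro!: sum.cong)
  also have "\<dots> = (\<Sum>k<b * b'. (A $$ (i div a', k div b') * v $ (k div b')) * (B $$ (i mod a', k mod b') * w $ (k mod b')))"
    using assms i by (intro sum.cong) (auto simp: kron_index[OF assms(1,2)] kron_vec_def)
  also have "\<dots> = (\<Sum>k<b. A $$ (i div a', k) * v $ k) * (\<Sum>l<b'. B $$ (i mod a', l) * w $ l)"
    by (subst sum_div_mod) (simp add: sum_product)
  also have "\<dots> = kron_vec (A *\<^sub>v v) (B *\<^sub>v w) $ i"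
    using assms i i' by (auto simp: kron_vec_def scalar_prod_def lessThan_atLeast0 intro!: arg_cong2[of _ _ _ _ "(*)"] sum.cong)
  finally show "(kron A B *\<^sub>v kron_vec v w) $ i = kron_vec (A *\<^sub>v v) (B *\<^sub>v w) $ i" .
qed (use assms in \<open>auto simp: kron_vec_def kron_def\<close>)

lemma kron_arith:
  assumes "A \<in> carrier_mat a b" "A' \<in> carrier_mat a b" "B \<in> carrier_mat c d" "B' \<in> carrier_mat c d"
  shows "kron (A + A') B = kron A B + kron A' B" "kron A (B + B') = kron A B + kron A B'"
    "kron (A - A') B = kron A B - kron A' B" "kron A (B - B') = kron A B - kron A B'"
    "kron (x \<cdot>\<^sub>m A) B = x \<cdot>\<^sub>m kron A B" "kron A (x \<cdot>\<^sub>m B) = x \<cdot>\<^sub>m kron A B"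
proof -
  have i: "i div c < a" "i mod c < c" if "i < a * c" for i using div_mod_less[OF that] by auto
  have j: "j div d < b" "j mod d < d" if "j < b * d" for j using div_mod_less[OF that] by auto
  show "kron (A + A') B = kron A B + kron A' B" "kron A (B + B') = kron A B + kron A B'"
    "kron (A - A') B = kron A B - kron A' B" "kron A (B - B') = kron A B - kron A B'"
    "kron (x \<cdot>\<^sub>m A) B = x \<cdot>\<^sub>m kron A B" "kron A (x \<cdot>\<^sub>m B) = x \<cdot>\<^sub>m kron A B"
    using assms by (auto simp: kron_def i j algebra_simps intro!: eq_matI)
qed

lemma kron_one: "kron (1\<^sub>m a) (1\<^sub>m b) = 1\<^sub>m (a * b)"
proof (rule eq_matI)
  fix i j assume "i < dim_row (1\<^sub>m (a * b) :: complex mat)" "j < dim_col (1\<^sub>m (a * b) :: complex mat)"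
  hence ij: "i < a * b" "j < a * b" by auto
  have "i = j \<longleftrightarrow> i div b = j div b \<and> i mod b = j mod b"
    by (metis div_mult_mod_eq)
  thus "kron (1\<^sub>m a) (1\<^sub>m b) $$ (i, j) = 1\<^sub>m (a * b) $$ (i, j)"
    using ij div_mod_less[OF ij(1)] div_mod_less[OF ij(2)] by (auto simp: kron_def)
qed (auto simp: kron_def)

lemma deg_tensor [simp]: "deg (tensor_repn R S) = deg R * deg S"
  by (simp add: tensor_repn_def)

lemma act_tensor:
  "act (tensor_repn R S) X = kron (act R X) (1\<^sub>m (deg S)) + kron (1\<^sub>m (deg R)) (act S X)"
  by (simp add: tensor_repn_def)

text \<open>Multiplying out gives two mixed terms, \<open>kron (act R X) (act S Y)\<close> and
  \<open>kron (act R Y) (act S X)\<close>. Their sum is symmetric in \<open>X\<close> and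
  \<open>Y\<close> and cancels in the commutator.\<close>

lemma is_repn_tensor:
  assumes R: "is_repn R" and S: "is_repn S"
  shows "is_repn (tensor_repn R S)"
proof -
  let ?r = "deg R" and ?s = "deg S"
  interpret R: sl3_repn R by unfold_locales (rule R)
  interpret S: sl3_repn S by unfold_locales (rule S)
  note one = one_carrier_mat[of ?r] one_carrier_mat[of ?s]
  have c: "kron (act R X) (1\<^sub>m ?s) \<in> carrier_mat (?r * ?s) (?r * ?s)"
    "kron (1\<^sub>m ?r) (act S X) \<in> carrier_mat (?r * ?s) (?r * ?s)" if "X \<in> sl3" for X
    using R.act_carrier[OF that] S.act_carrier[OF that] by simp_all
  have mult: "(kron (act R X) (1\<^sub>m ?s) + kron (1\<^sub>m ?r) (act S X)) * (kron (act R Y) (1\<^sub>m ?s) + kron (1\<^sub>m ?r) (act S Y))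
      = (kron (act R X * act R Y) (1\<^sub>m ?s) + kron (act R X) (act S Y))
      + (kron (act R Y) (act S X) + kron (1\<^sub>m ?r) (act S X * act S Y))" (is "(?M + ?N) * (?M' + ?N') = _")
    if X: "X \<in> sl3" and Y: "Y \<in> sl3" for X Y
  proof -
    note a = R.act_carrier[OF X] R.act_carrier[OF Y] S.act_carrier[OF X] S.act_carrier[OF Y]
    have "(?M + ?N) * (?M' + ?N') = ?M * (?M' + ?N') + ?N * (?M' + ?N')"
      using c[OF X] c[OF Y] by (intro add_mult_distrib_mat) auto
    also have "?M * (?M' + ?N') = ?M * ?M' + ?M * ?N'"
      using c[OF X] c[OF Y] by (intro mult_add_distrib_mat) auto
    also have "?N * (?M' + ?N') = ?N * ?M' + ?N * ?N'"
      using c[OF X] c[OF Y] by (intro mult_add_distrib_mat) auto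
    also have "?M * ?M' = kron (act R X * act R Y) (1\<^sub>m ?s)"
      using a by (simp add: kron_mult[OF a(1,2) one(2) one(2)])
    also have "?M * ?N' = kron (act R X) (act S Y)"
      using a by (simp add: kron_mult[OF a(1) one(1) one(2) a(4)])
    also have "?N * ?M' = kron (act R Y) (act S X)"
      using a by (simp add: kron_mult[OF one(1) a(2) a(3) one(2)])
    also have "?N * ?N' = kron (1\<^sub>m ?r) (act S X * act S Y)"
      using a by (simp add: kron_mult[OF one(1) one(1) a(3,4)])
    finally show ?thesis .
  qed
  show ?thesis
    unfolding is_repn_def deg_tensor act_tensor
  proof (intro conjI ballI allI)
    fix X assume X: "X \<in> sl3"
    show "kron (act R X) (1\<^sub>m ?s) + kron (1\<^sub>m ?r) (act S X) \<in> carrier_mat (?r * ?s) (?r * ?s)"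
      using c[OF X] by simp
    show "kron (act R (k \<cdot>\<^sub>m X)) (1\<^sub>m ?s) + kron (1\<^sub>m ?r) (act S (k \<cdot>\<^sub>m X)) =
      k \<cdot>\<^sub>m (kron (act R X) (1\<^sub>m ?s) + kron (1\<^sub>m ?r) (act S X))" for k
      unfolding R.act_smult[OF X] S.act_smult[OF X]
        kron_arith(5)[OF R.act_carrier[OF X] R.act_carrier[OF X] one(2) one(2)]
        kron_arith(6)[OF one(1) one(1) S.act_carrier[OF X] S.act_carrier[OF X]]
      using c[OF X] by (intro eq_matI) (auto simp: distrib_left)
    fix Y assume Y: "Y \<in> sl3"
    note a = R.act_carrier[OF X] R.act_carrier[OF Y] S.act_carrier[OF X] S.act_carrier[OF Y]
    have aa: "act R X * act R Y \<in> carrier_mat ?r ?r" "act R Y * act R X \<in> carrier_mat ?r ?r"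
      "act S X * act S Y \<in> carrier_mat ?s ?s" "act S Y * act S X \<in> carrier_mat ?s ?s"
      using a by auto
    have k: "kron A B \<in> carrier_mat (?r * ?s) (?r * ?s)" if "A \<in> carrier_mat ?r ?r" "B \<in> carrier_mat ?s ?s" for A B
      using that by simp
    show "kron (act R (X + Y)) (1\<^sub>m ?s) + kron (1\<^sub>m ?r) (act S (X + Y)) =
       kron (act R X) (1\<^sub>m ?s) + kron (1\<^sub>m ?r) (act S X) + (kron (act R Y) (1\<^sub>m ?s) + kron (1\<^sub>m ?r) (act S Y))"
      using c[OF X] c[OF Y] unfolding R.act_add[OF X Y] S.act_add[OF X Y] kron_arith(1)[OF a(1,2) one(2) one(2)]
        kron_arith(2)[OF one(1) one(1) a(3,4)]
      by (intro eq_matI) auto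
    show "kron (act R (X * Y - Y * X)) (1\<^sub>m ?s) + kron (1\<^sub>m ?r) (act S (X * Y - Y * X)) =
       (kron (act R X) (1\<^sub>m ?s) + kron (1\<^sub>m ?r) (act S X)) * (kron (act R Y) (1\<^sub>m ?s) + kron (1\<^sub>m ?r) (act S Y)) -
       (kron (act R Y) (1\<^sub>m ?s) + kron (1\<^sub>m ?r) (act S Y)) * (kron (act R X) (1\<^sub>m ?s) + kron (1\<^sub>m ?r) (act S X))"
      unfolding mult[OF X Y] mult[OF Y X] R.act_bracket[OF X Y] S.act_bracket[OF X Y]
        kron_arith(3)[OF aa(1,2) one(2) one(2)] kron_arith(4)[OF one(1) one(1) aa(3,4)]
      using k[OF aa(1) one(2)] k[OF aa(2) one(2)] k[OF one(1) aa(3)] k[OF one(1) aa(4)] k[OF a(1,4)] k[OF a(2,3)]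
      by (intro eq_matI) (auto simp: algebra_simps)
  qed
qed

lemma intertwinesI_mat:
  assumes "K \<in> carrier_mat (deg S) (deg R)" "is_repn R" "is_repn S"
    "\<And>X. X \<in> sl3 \<Longrightarrow> K * act R X = act S X * K"
  shows "intertwines R S K"
  unfolding intertwines_def
proof (intro conjI ballI)
  fix X and v :: "complex vec" assume X: "X \<in> sl3" and v: "v \<in> carrier_vec (deg R)"
  show "K *\<^sub>v (act R X *\<^sub>v v) = act S X *\<^sub>v (K *\<^sub>v v)"
    using assoc_mult_mat_vec[OF assms(1) is_repn_carrier[OF assms(2) X] v]
      assoc_mult_mat_vec[OF is_repn_carrier[OF assms(3) X] assms(1) v] assms(4)[OF X] by simp
qed (rule assms(1))

lemma intertwines_tensor:
  assumes R: "is_repn R" and R': "is_repn R'" and S: "is_repn S" and S': "is_repn S'"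
    and K: "intertwines R R' K" and K': "intertwines S S' K'"
  shows "intertwines (tensor_repn R S) (tensor_repn R' S') (kron K K')"
proof (rule intertwinesI_mat)
  note c = intertwinesD(1)[OF K] intertwinesD(1)[OF K']
  show "kron K K' \<in> carrier_mat (deg (tensor_repn R' S')) (deg (tensor_repn R S))"
    using c by simp
  fix X assume X: "X \<in> sl3"
  note a = is_repn_carrier[OF R X] is_repn_carrier[OF R' X] is_repn_carrier[OF S X] is_repn_carrier[OF S' X]
  note one = one_carrier_mat
  have "kron K K' * (kron (act R X) (1\<^sub>m (deg S)) + kron (1\<^sub>m (deg R)) (act S X)) =
    kron K K' * kron (act R X) (1\<^sub>m (deg S)) + kron K K' * kron (1\<^sub>m (deg R)) (act S X)"
    using c a by (intro mult_add_distrib_mat[of _ "deg R' * deg S'" "deg R * deg S" _ "deg R * deg S"]) auto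
  also have "\<dots> = kron (act R' X * K) K' + kron K (act S' X * K')"
    using c a intertwines_mat[OF K R R' X] intertwines_mat[OF K' S S' X]
    by (simp add: kron_mult[OF c(1) a(1) c(2) one] kron_mult[OF c(1) one c(2) a(3)])
  also have "\<dots> = kron (act R' X) (1\<^sub>m (deg S')) * kron K K' + kron (1\<^sub>m (deg R')) (act S' X) * kron K K'"
    using c a by (simp add: kron_mult[OF a(2) c(1) one c(2)] kron_mult[OF one c(1) a(4) c(2)])
  also have "\<dots> = (kron (act R' X) (1\<^sub>m (deg S')) + kron (1\<^sub>m (deg R')) (act S' X)) * kron K K'"
    using c a by (intro add_mult_distrib_mat[symmetric, of _ "deg R' * deg S'" "deg R' * deg S'" _ _ "deg R * deg S"]) auto
  finally show "kron K K' * act (tensor_repn R S) X = act (tensor_repn R' S') X * kron K K'"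
    by (simp add: act_tensor)
qed (use R R' S S' is_repn_tensor in auto)

lemma iso_tensor_cong:
  assumes R: "is_repn R" and R': "is_repn R'" and S: "is_repn S" and S': "is_repn S'"
    and "iso_repn R R'" "iso_repn S S'"
  shows "iso_repn (tensor_repn R S) (tensor_repn R' S')"
proof -
  from assms(5) obtain P Q where P: "intertwines R R' P" "intertwines R' R Q"
    "\<And>v. v\<in>carrier_vec (deg R) \<Longrightarrow> Q *\<^sub>v (P *\<^sub>v v) = v"
    "\<And>v. v\<in>carrier_vec (deg R') \<Longrightarrow> P *\<^sub>v (Q *\<^sub>v v) = v" by (auto simp: iso_repn_iff R R')
  from assms(6) obtain P' Q' where P': "intertwines S S' P'" "intertwines S' S Q'"
    "\<And>v. v\<in>carrier_vec (deg S) \<Longrightarrow> Q' *\<^sub>v (P' *\<^sub>v v) = v"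
    "\<And>v. v\<in>carrier_vec (deg S') \<Longrightarrow> P' *\<^sub>v (Q' *\<^sub>v v) = v" by (auto simp: iso_repn_iff S S')
  note c = intertwinesD(1)[OF P(1)] intertwinesD(1)[OF P(2)] intertwinesD(1)[OF P'(1)] intertwinesD(1)[OF P'(2)]
  have e: "Q * P = 1\<^sub>m (deg R)" "P * Q = 1\<^sub>m (deg R')" "Q' * P' = 1\<^sub>m (deg S)" "P' * Q' = 1\<^sub>m (deg S')"
    using one_mat_iff[OF c(2,1)] one_mat_iff[OF c(1,2)] one_mat_iff[OF c(4,3)] one_mat_iff[OF c(3,4)] P P' by auto
  have k: "kron Q Q' * kron P P' = 1\<^sub>m (deg R * deg S)" "kron P P' * kron Q Q' = 1\<^sub>m (deg R' * deg S')"
    by (simp_all add: kron_mult[OF c(2,1) c(4,3)] kron_mult[OF c(1,2) c(3,4)] e kron_one)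
  show ?thesis
    using intertwines_tensor[OF R R' S S' P(1) P'(1)] intertwines_tensor[OF R' R S' S P(2) P'(2)]
      one_mat_iff[OF kron_carrier[OF c(2,4)] kron_carrier[OF c(1,3)]]
      one_mat_iff[OF kron_carrier[OF c(1,3)] kron_carrier[OF c(2,4)]] k
    by (auto simp: iso_repn_iff is_repn_tensor R R' S S')
qed

lemma count_list_sum: "count_list xs y = (\<Sum>i<length xs. if xs ! i = y then 1 else 0)"
proof (induction xs)
  case (Cons x xs)
  have "{..<length (x # xs)} = insert 0 (Suc ` {..<length xs})"
    by (auto simp: lessThan_Suc_eq_insert_0)
  thus ?case using Cons by (simp add: sum.reindex)
qed simp

text \<open>Listed in the order of the Kronecker basis, so that the tensor product of two diagonal
  models is itself diagonal with exactly this list.\<close>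

definition tensor_weights :: "weight list \<Rightarrow> weight list \<Rightarrow> weight list" where
  "tensor_weights ws vs = map (\<lambda>i. ws ! (i div length vs) + vs ! (i mod length vs)) [0..<length ws * length vs]"

text \<open>The product of two characters, written as a convolution over the weights of the first
  factor.\<close>

lemma count_tensor_weights:
  "count_list (tensor_weights ws vs) \<mu> = (\<Sum>i<length ws. count_list vs (\<mu> - ws ! i))"
proof -
  have "count_list (tensor_weights ws vs) \<mu> =
    (\<Sum>i<length ws * length vs. if ws ! (i div length vs) + vs ! (i mod length vs) = \<mu> then 1 else 0)"
    by (simp add: count_list_sum tensor_weights_def)
  also have "\<dots> = (\<Sum>a<length ws. \<Sum>b<length vs. if ws ! a + vs ! b = \<mu> then 1 else 0)"
    by (rule sum_div_mod)
  also have "\<dots> = (\<Sum>i<length ws. count_list vs (\<mu> - ws ! i))"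
    by (simp add: count_list_sum eq_diff_eq add.commute)
  finally show ?thesis .
qed

lemma diag_repn_tensor:
  assumes "diag_repn D ws" "diag_repn E vs"
  shows "diag_repn (tensor_repn D E) (tensor_weights ws vs)"
proof -
  have "kron (weight_diag f ws) (1\<^sub>m (length vs)) + kron (1\<^sub>m (length ws)) (weight_diag f vs)
      = weight_diag f (tensor_weights ws vs)" (is "?A = ?B") if "\<And>x y. f (x + y) = f x + f y" for f
  proof (rule eq_matI)
    let ?n = "length ws" and ?m = "length vs"
    fix i j assume "i < dim_row ?B" "j < dim_col ?B"
    hence ij: "i < ?n * ?m" "j < ?n * ?m" by (auto simp: weight_diag_def tensor_weights_def)
    note dm = div_mod_less[OF ij(1)] div_mod_less[OF ij(2)]
    have eq: "i = j \<longleftrightarrow> i div ?m = j div ?m \<and> i mod ?m = j mod ?m"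
      by (metis div_mult_mod_eq)
    have "?A $$ (i, j) = weight_diag f ws $$ (i div ?m, j div ?m) * 1\<^sub>m ?m $$ (i mod ?m, j mod ?m)
      + 1\<^sub>m ?n $$ (i div ?m, j div ?m) * weight_diag f vs $$ (i mod ?m, j mod ?m)"
      using ij by (auto simp: kron_def weight_diag_def)
    also have "\<dots> = ?B $$ (i, j)"
      using ij dm eq by (auto simp: weight_diag_def tensor_weights_def that)
    finally show "?A $$ (i, j) = ?B $$ (i, j)" .
  qed (auto simp: kron_def weight_diag_def tensor_weights_def)
  thus ?thesis
    using assms is_repn_tensor by (auto simp: diag_repn_def act_tensor tensor_weights_def)
qed

subsection \<open>Unitary representations\<close>

abbreviation adj :: "complex mat \<Rightarrow> complex mat" where
  "adj A \<equiv> map_mat cnj (transpose_mat A)"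

lemma adj_carrier [simp]: "A \<in> carrier_mat m n \<Longrightarrow> adj A \<in> carrier_mat n m"
  by auto

lemma adj_mult:
  assumes "A \<in> carrier_mat a b" "B \<in> carrier_mat b c"
  shows "adj (A * B) = adj B * adj A"
  using assms by (intro eq_matI) (auto simp: scalar_prod_def mult.commute)

lemma adj_sl3: "X \<in> sl3 \<Longrightarrow> adj X \<in> sl3"
proof -
  assume "X \<in> sl3"
  hence "(\<Sum>i<3. adj X $$ (i, i)) = cnj (\<Sum>i<3. X $$ (i, i))"
    by (subst cnj_sum) (auto simp: sl3_def intro!: sum.cong)
  with \<open>X \<in> sl3\<close> show ?thesis by (auto simp: sl3_def)
qed

text \<open>Equivalently, skew-Hermitian matrices act by skew-Hermitian matrices: the standard
  Hermitian form is invariant under the compact form su(3).\<close>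

definition unitary_repn :: "repn \<Rightarrow> bool" where
  "unitary_repn R \<longleftrightarrow> is_repn R \<and> (\<forall>X\<in>sl3. act R (adj X) = adj (act R X))"

definition highest_weight_vector :: "repn \<Rightarrow> weight \<Rightarrow> complex vec \<Rightarrow> bool" where
  "highest_weight_vector R \<mu> v \<longleftrightarrow> v \<in> weight_space R \<mu> \<and> v \<noteq> 0\<^sub>v (deg R) \<and>
     (\<forall>j<3. \<forall>i<j. act R (elem_mat i j) *\<^sub>v v = 0\<^sub>v (deg R))"

lemma unitary_tensor:
  assumes "unitary_repn R" "unitary_repn S"
  shows "unitary_repn (tensor_repn R S)"
proof -
  have R: "is_repn R" and S: "is_repn S" using assms by (auto simp: unitary_repn_def)
  have kron: "adj (kron A B) = kron (adj A) (adj B)" if "A \<in> carrier_mat a a" "B \<in> carrier_mat b b" for A B a b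
  proof (rule eq_matI)
    fix i j assume "i < dim_row (kron (adj A) (adj B))" "j < dim_col (kron (adj A) (adj B))"
    hence ij: "i < a * b" "j < a * b" using that by (auto simp: kron_def)
    thus "adj (kron A B) $$ (i, j) = kron (adj A) (adj B) $$ (i, j)"
      using that div_mod_less[OF ij(1)] div_mod_less[OF ij(2)] by (auto simp: kron_def)
  qed (auto simp: kron_def)
  have add: "adj (A + B) = adj A + adj B" if "A \<in> carrier_mat a b" "B \<in> carrier_mat a b" for A B a b
    using that by (intro eq_matI) auto
  have one: "map_mat cnj (1\<^sub>m n) = 1\<^sub>m n" for n by (intro eq_matI) auto
  show ?thesis
    unfolding unitary_repn_def
  proof (intro conjI ballI is_repn_tensor R S)
    fix X assume X: "X \<in> sl3"
    note c = is_repn_carrier[OF R X] is_repn_carrier[OF S X]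
    show "act (tensor_repn R S) (adj X) = adj (act (tensor_repn R S) X)"
      using assms X
      by (simp add: act_tensor unitary_repn_def kron[OF c(1) one_carrier_mat] kron[OF one_carrier_mat c(2)] one
          add[OF kron_carrier[OF c(1) one_carrier_mat] kron_carrier[OF one_carrier_mat c(2)]])
  qed
qed

lemma kron_vec_arith:
  assumes "v \<in> carrier_vec a" "w \<in> carrier_vec b"
  shows "kron_vec (c \<cdot>\<^sub>v v) w = c \<cdot>\<^sub>v kron_vec v w" "kron_vec v (c \<cdot>\<^sub>v w) = c \<cdot>\<^sub>v kron_vec v w"
    "kron_vec (0\<^sub>v a) w = 0\<^sub>v (a * b)" "kron_vec v (0\<^sub>v b) = 0\<^sub>v (a * b)"
proof -
  have i: "i div b < a" "i mod b < b" if "i < a * b" for i using div_mod_less[OF that] by auto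
  show "kron_vec (c \<cdot>\<^sub>v v) w = c \<cdot>\<^sub>v kron_vec v w" "kron_vec v (c \<cdot>\<^sub>v w) = c \<cdot>\<^sub>v kron_vec v w"
    "kron_vec (0\<^sub>v a) w = 0\<^sub>v (a * b)" "kron_vec v (0\<^sub>v b) = 0\<^sub>v (a * b)"
    using assms by (auto simp: kron_vec_def i intro!: eq_vecI)
qed

lemma act_tensor_kron_vec:
  assumes "is_repn R" "is_repn S" "X \<in> sl3" "v \<in> carrier_vec (deg R)" "w \<in> carrier_vec (deg S)"
  shows "act (tensor_repn R S) X *\<^sub>v kron_vec v w = kron_vec (act R X *\<^sub>v v) w + kron_vec v (act S X *\<^sub>v w)"
proof -
  note c = is_repn_carrier[OF assms(1,3)] is_repn_carrier[OF assms(2,3)]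
  show ?thesis
    unfolding act_tensor
    using assms c
    by (subst add_mult_distrib_mat_vec[OF kron_carrier[OF c(1) one_carrier_mat] kron_carrier[OF one_carrier_mat c(2)]])
       (auto simp: kron_mult_vec[OF c(1) one_carrier_mat] kron_mult_vec[OF one_carrier_mat c(2)])
qed

lemma highest_weight_vector_tensor:
  assumes R: "is_repn R" and S: "is_repn S"
    and v: "highest_weight_vector R \<mu> v" and w: "highest_weight_vector S \<nu> w"
  shows "highest_weight_vector (tensor_repn R S) (\<mu> + \<nu>) (kron_vec v w)"
proof -
  have vc: "v \<in> carrier_vec (deg R)" and wc: "w \<in> carrier_vec (deg S)" and v0: "v \<noteq> 0\<^sub>v (deg R)" and w0: "w \<noteq> 0\<^sub>v (deg S)"
    using v w by (auto simp: highest_weight_vector_def weight_space_def)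
  have hv: "act R (coroot 0) *\<^sub>v v = of_int (fst \<mu>) \<cdot>\<^sub>v v" "act R (coroot 1) *\<^sub>v v = of_int (snd \<mu>) \<cdot>\<^sub>v v"
    and hw: "act S (coroot 0) *\<^sub>v w = of_int (fst \<nu>) \<cdot>\<^sub>v w" "act S (coroot 1) *\<^sub>v w = of_int (snd \<nu>) \<cdot>\<^sub>v w"
    using v w by (auto simp: highest_weight_vector_def weight_space_def)
  have add: "c \<cdot>\<^sub>v u + d \<cdot>\<^sub>v u = (c + d) \<cdot>\<^sub>v (u :: complex vec)" for c d u
    by (intro eq_vecI) (auto simp: distrib_right)
  obtain i where i: "i < deg R" "v $ i \<noteq> 0" using vc v0 by (auto simp: vec_eq_iff)
  obtain j where j: "j < deg S" "w $ j \<noteq> 0" using wc w0 by (auto simp: vec_eq_iff)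
  \<comment> \<open>This position encodes the pair \<open>(i, j)\<close>; the entry of
    \<open>kron_vec v w\<close> there is the product of two nonzero entries, so the tensor is
    nonzero.\<close>
  have ij: "i * deg S + j < deg R * deg S"
    using i(1) j(1) mult_le_mono1[of "Suc i" "deg R" "deg S"] by simp
  have "kron_vec v w $ (i * deg S + j) \<noteq> 0"
    using ij i j vc wc by (simp add: kron_vec_def)
  hence "kron_vec v w \<noteq> 0\<^sub>v (deg R * deg S)" using ij by auto
  moreover have "act (tensor_repn R S) (elem_mat k l) *\<^sub>v kron_vec v w = 0\<^sub>v (deg R * deg S)" if "l < 3" "k < l" for k l
    using v w that R S vc wc
    by (simp add: act_tensor_kron_vec elem_mat_sl3 highest_weight_vector_def kron_vec_arith)
  moreover have "kron_vec v w \<in> weight_space (tensor_repn R S) (\<mu> + \<nu>)"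
    using R S vc wc hv hw
    by (simp add: weight_space_def act_tensor_kron_vec coroot_sl3 kron_vec_arith[OF vc wc] add)
  ultimately show ?thesis by (simp add: highest_weight_vector_def)
qed

lemma unitary_std: "unitary_repn (Repn 3 (\<lambda>X. X))" and unitary_dual: "unitary_repn (Repn 3 (\<lambda>X. - transpose_mat X))"
proof -
  show "unitary_repn (Repn 3 (\<lambda>X. X))"
    by (auto simp: unitary_repn_def is_repn_def sl3_carrier)
  have tr: "transpose_mat X \<in> carrier_mat 3 3" if "X \<in> sl3" for X using sl3_carrier[OF that] by auto
  have "is_repn (Repn 3 (\<lambda>X. - transpose_mat X))"
    unfolding is_repn_def repn.sel
  proof (intro conjI ballI allI)
    fix X Y c assume X: "X \<in> sl3" and Y: "Y \<in> sl3"
    note c = sl3_carrier[OF X] sl3_carrier[OF Y]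
    \<comment> \<open>The two signs cancel and transposition reverses products, so the commutator of
      the negated transposes is the negated transpose of the commutator.\<close>
    have "(- transpose_mat X) * (- transpose_mat Y) = transpose_mat (Y * X)"
      "(- transpose_mat Y) * (- transpose_mat X) = transpose_mat (X * Y)"
      using c by (simp_all add: transpose_mult[of _ 3 3 _ 3])
    thus "- transpose_mat (X * Y - Y * X) = - transpose_mat X * - transpose_mat Y - - transpose_mat Y * - transpose_mat X"
      using c by (intro eq_matI) auto
    show "- transpose_mat (X + Y) = - transpose_mat X + - transpose_mat Y"
      using c by (intro eq_matI) auto
  qed (use sl3_carrier in \<open>auto intro!: eq_matI\<close>)
  moreover have "- transpose_mat (adj X) = adj (- transpose_mat X)" if "X \<in> sl3" for X
    using sl3_carrier[OF that] by (intro eq_matI) auto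
  ultimately show "unitary_repn (Repn 3 (\<lambda>X. - transpose_mat X))"
    by (auto simp: unitary_repn_def)
qed

lemma elem_mat_unit_vec:
  "i < 3 \<Longrightarrow> j < 3 \<Longrightarrow> k < 3 \<Longrightarrow> elem_mat i j *\<^sub>v unit_vec 3 k = (if j = k then unit_vec 3 i else 0\<^sub>v 3)"
  by (intro eq_vecI) (auto simp: elem_mat_def)

lemma highest_weight_vector_std: "highest_weight_vector (Repn 3 (\<lambda>X. X)) \<Lambda>1 (unit_vec 3 0)"
proof -
  have "elem_mat i j *\<^sub>v unit_vec 3 0 = 0\<^sub>v 3" if "j < 3" "i < j" for i j
    using that by (subst elem_mat_unit_vec) auto
  moreover have "coroot 0 *\<^sub>v unit_vec 3 0 = 1 \<cdot>\<^sub>v unit_vec 3 0" "coroot 1 *\<^sub>v unit_vec 3 0 = 0 \<cdot>\<^sub>v unit_vec 3 0"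
    by (auto simp: coroot_def elem_mat_def intro!: eq_vecI)
  ultimately show ?thesis
    by (simp add: highest_weight_vector_def weight_space_def \<Lambda>1_def)
qed

text \<open>The weights of the dual are the negatives of those of the standard module, so its
  highest weight belongs to the last basis vector.\<close>

lemma highest_weight_vector_dual: "highest_weight_vector (Repn 3 (\<lambda>X. - transpose_mat X)) \<Lambda>2 (unit_vec 3 2)"
proof -
  have "- transpose_mat (elem_mat i j) *\<^sub>v unit_vec 3 2 = 0\<^sub>v 3" if "j < 3" "i < j" for i j
    using that by (intro eq_vecI) (auto simp: elem_mat_def)
  moreover have "- transpose_mat (coroot 0) *\<^sub>v unit_vec 3 2 = 0 \<cdot>\<^sub>v unit_vec 3 2"
    "- transpose_mat (coroot 1) *\<^sub>v unit_vec 3 2 = 1 \<cdot>\<^sub>v unit_vec 3 2"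
    by (auto simp: coroot_def elem_mat_def intro!: eq_vecI)
  ultimately show ?thesis
    by (simp add: highest_weight_vector_def weight_space_def \<Lambda>2_def)
qed

lemma unitary_trivial: "unitary_repn (Repn 1 (\<lambda>X. 0\<^sub>m 1 1))"
  by (auto simp: unitary_repn_def is_repn_def intro!: eq_matI)

lemma highest_weight_vector_trivial: "highest_weight_vector (Repn 1 (\<lambda>X. 0\<^sub>m 1 1)) 0 (unit_vec 1 0)"
  by (auto simp: highest_weight_vector_def weight_space_def intro!: eq_vecI)

text \<open>Highest weights add under tensor products, so the trivial, standard and dual modules,
  with highest weights 0, \<Lambda>1 and \<Lambda>2, reach every dominant weight.\<close>

lemma unitary_highest_weight_exists:
  assumes "\<mu> \<in> dominant"
  shows "\<exists>R v. unitary_repn R \<and> highest_weight_vector R \<mu> v"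
proof -
  define E where "E \<mu> \<longleftrightarrow> (\<exists>R v. unitary_repn R \<and> highest_weight_vector R \<mu> v)" for \<mu>
  have add: "E (\<mu> + \<nu>)" if "E \<mu>" "E \<nu>" for \<mu> \<nu>
    using that unitary_tensor highest_weight_vector_tensor unfolding E_def by (meson unitary_repn_def)
  have E: "E 0" "E \<Lambda>1" "E \<Lambda>2"
    using unitary_trivial highest_weight_vector_trivial unitary_std highest_weight_vector_std
      unitary_dual highest_weight_vector_dual unfolding E_def by blast+
  have a: "E (int a, 0)" for a
  proof (induction a)
    case 0
    thus ?case using E(1) by (simp add: zero_prod_def)
  next
    case (Suc a)
    thus ?case using add[OF Suc E(2)] by (simp add: \<Lambda>1_def algebra_simps)
  qed
  have ab: "E (int a, int b)" for a b
  proof (induction b)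
    case 0
    thus ?case using a by simp
  next
    case (Suc b)
    thus ?case using add[OF Suc E(3)] by (simp add: \<Lambda>2_def algebra_simps)
  qed
  have "\<mu> = (int (nat (fst \<mu>)), int (nat (snd \<mu>)))" using assms by (auto simp: dominant_def)
  thus ?thesis using ab E_def by metis
qed

section \<open>Orthonormal families and complete reducibility\<close>

lemma mult_mat_zero_vec: "A \<in> carrier_mat m n \<Longrightarrow> A *\<^sub>v 0\<^sub>v n = (0\<^sub>v m :: complex vec)"
  and zero_mat_mult_vec: "x \<in> carrier_vec n \<Longrightarrow> 0\<^sub>m m n *\<^sub>v x = (0\<^sub>v m :: complex vec)"
  by (auto intro!: eq_vecI)

lemma minus_vec_eq_zero:
  assumes "u \<in> carrier_vec n" "w \<in> carrier_vec n" "u - w = 0\<^sub>v n"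
  shows "u = (w :: complex vec)"
proof (rule eq_vecI)
  fix i assume i: "i < dim_vec w"
  have "(u - w) $ i = 0" using assms i by simp
  thus "u $ i = w $ i" using i by simp
qed (use assms in auto)

lemma add_minus_vec_cancel:
  "u \<in> carrier_vec n \<Longrightarrow> w \<in> carrier_vec n \<Longrightarrow> w + (u - w) = (u :: complex vec)"
  by (intro eq_vecI) auto

lemma adj_mult_index:
  assumes "A \<in> carrier_mat n r" "B \<in> carrier_mat n s" "k < r" "l < s"
  shows "(adj A * B) $$ (k, l) = (\<Sum>i<n. cnj (A $$ (i, k)) * B $$ (i, l))"
  using assms by (auto simp: scalar_prod_def lessThan_atLeast0 intro!: sum.cong)

lemma adj_mult_vec_index:
  assumes "A \<in> carrier_mat n r" "v \<in> carrier_vec n" "k < r"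
  shows "(adj A *\<^sub>v v) $ k = (\<Sum>i<n. cnj (A $$ (i, k)) * v $ i)"
  using assms by (auto simp: scalar_prod_def lessThan_atLeast0 intro!: sum.cong)

lemma adj_adj [simp]: "adj (adj A) = A"
  by (intro eq_matI) auto

text \<open>Columns with coefficient zero are exempt. In
  \<open>unitary_irreducible_has_weights\<close> orthogonality makes the coefficients of the columns
  of other weights vanish.\<close>

lemma mult_vec_in_subspace:
  assumes J: "J \<in> carrier_mat n r" and x: "x \<in> carrier_vec r" and cols: "\<And>k. k < r \<Longrightarrow> x $ k \<noteq> 0 \<Longrightarrow> col J k \<in> U"
    and U: "0\<^sub>v n \<in> U" "\<And>u v. u \<in> U \<Longrightarrow> v \<in> U \<Longrightarrow> u + v \<in> U" "\<And>c u. u \<in> U \<Longrightarrow> c \<cdot>\<^sub>v u \<in> U"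
  shows "J *\<^sub>v (x :: complex vec) \<in> U"
proof -
  have "vec n (\<lambda>i. \<Sum>k<m. J $$ (i, k) * x $ k) \<in> U" if "m \<le> r" for m
    using that
  proof (induction m)
    case 0
    have "vec n (\<lambda>i. \<Sum>k<0. J $$ (i, k) * x $ k) = 0\<^sub>v n" by (intro eq_vecI) auto
    thus ?case using U(1) by simp
  next
    case (Suc m)
    have eq: "vec n (\<lambda>i. \<Sum>k<Suc m. J $$ (i, k) * x $ k) = vec n (\<lambda>i. \<Sum>k<m. J $$ (i, k) * x $ k) + x $ m \<cdot>\<^sub>v col J m"
      using J Suc.prems by (intro eq_vecI) auto
    show ?case
    proof (cases "x $ m = 0")
      case True
      hence "vec n (\<lambda>i. \<Sum>k<Suc m. J $$ (i, k) * x $ k) = vec n (\<lambda>i. \<Sum>k<m. J $$ (i, k) * x $ k)" by simp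
      thus ?thesis using Suc by simp
    next
      case False
      thus ?thesis using Suc cols[of m] U(2,3) unfolding eq by simp
    qed
  qed
  moreover have "J *\<^sub>v x = vec n (\<lambda>i. \<Sum>k<r. J $$ (i, k) * x $ k)"
    using J x by (intro eq_vecI) (auto simp: scalar_prod_def lessThan_atLeast0 intro!: sum.cong)
  ultimately show ?thesis by simp
qed

text \<open>A maximal orthonormal family exists by dimension; were \<open>u\<close> not fixed by the projection
  \<open>J * adj J\<close>, normalising the difference would extend the family.\<close>

lemma orthonormal_family_exists:
  assumes G: "G \<subseteq> carrier_vec n"
    and smult: "\<And>c u. u \<in> G \<Longrightarrow> c \<cdot>\<^sub>v u \<in> G"
    and proj: "\<And>J r u. J \<in> carrier_mat n r \<Longrightarrow> adj J * J = 1\<^sub>m r \<Longrightarrow> (\<And>k. k < r \<Longrightarrow> col J k \<in> G) \<Longrightarrow>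
      u \<in> G \<Longrightarrow> u - J *\<^sub>v (adj J *\<^sub>v u) \<in> G"
  shows "\<exists>r J. J \<in> carrier_mat n r \<and> adj J * J = 1\<^sub>m r \<and> (\<forall>k<r. col J k \<in> G) \<and>
    (\<forall>u\<in>G. J *\<^sub>v (adj J *\<^sub>v u) = u)"
proof -
  \<comment> \<open>\<open>G\<close> is either an invariant subspace or the union of all weight
    spaces. The latter is in general not closed under addition; \<open>proj\<close> is the form of
    closure that both share.\<close>
  define ON where "ON r J \<longleftrightarrow> J \<in> carrier_mat n r \<and> adj J * J = 1\<^sub>m r \<and> (\<forall>k<r. col J k \<in> G)" for r J
  have bound: "r \<le> n" if "ON r J" for r J
  proof (rule injective_dim_le)
    show J: "J \<in> carrier_mat n r" using that by (simp add: ON_def)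
    fix v :: "complex vec" assume v: "v \<in> carrier_vec r" and "J *\<^sub>v v = 0\<^sub>v n"
    hence "adj J *\<^sub>v (J *\<^sub>v v) = 0\<^sub>v r" using J by auto
    thus "v = 0\<^sub>v r" using one_mat_iff[OF adj_carrier[OF J] J] that v by (simp add: ON_def)
  qed
  have "ON 0 (0\<^sub>m n 0)" by (auto simp: ON_def intro!: eq_matI)
  hence ex: "\<exists>r J. ON r J" by blast
  define r where "r = Max {r. \<exists>J. ON r J}"
  have fin: "finite {r. \<exists>J. ON r J}"
    by (rule finite_subset[of _ "{..n}"]) (use bound in auto)
  have "r \<in> {r. \<exists>J. ON r J}" unfolding r_def using fin ex by (intro Max_in) auto
  then obtain J where ON: "ON r J" by auto
  have max: "s \<le> r" if "ON s K" for s K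
    unfolding r_def using fin that by (intro Max_ge) auto
  have J: "J \<in> carrier_mat n r" and JJ: "adj J * J = 1\<^sub>m r" and col: "\<And>k. k < r \<Longrightarrow> col J k \<in> G"
    using ON by (auto simp: ON_def)
  note aJ = adj_carrier[OF J]
  have JJ': "adj J *\<^sub>v (J *\<^sub>v x) = x" if "x \<in> carrier_vec r" for x
    using one_mat_iff[OF aJ J] JJ that by blast
  have "J *\<^sub>v (adj J *\<^sub>v u) = u" if u: "u \<in> G" for u
  proof (rule ccontr)
    assume neq: "J *\<^sub>v (adj J *\<^sub>v u) \<noteq> u"
    define w where "w = u - J *\<^sub>v (adj J *\<^sub>v u)"
    have uc: "u \<in> carrier_vec n" using u G by auto
    have aJu: "adj J *\<^sub>v u \<in> carrier_vec r" using aJ uc by auto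
    have Jc: "J *\<^sub>v (adj J *\<^sub>v u) \<in> carrier_vec n" using J aJu by auto
    have w: "w \<in> carrier_vec n" using uc Jc by (simp add: w_def)
    have wG: "w \<in> G" unfolding w_def by (rule proj[OF J JJ col u])
    have "w \<noteq> 0\<^sub>v n"
    proof
      assume "w = 0\<^sub>v n"
      hence "u = J *\<^sub>v (adj J *\<^sub>v u)" using minus_vec_eq_zero[OF uc Jc] by (simp add: w_def)
      thus False using neq by simp
    qed
    then obtain i0 where i0: "i0 < n" "w $ i0 \<noteq> 0" using w by (auto simp: vec_eq_iff)
    define s where "s = (\<Sum>i<n. (cmod (w $ i))\<^sup>2)"
    have s: "s > 0" unfolding s_def using i0 by (intro sum_pos2[of _ i0]) auto
    define w' where "w' = complex_of_real (1 / sqrt s) \<cdot>\<^sub>v w"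
    have w'G: "w' \<in> G" and w'c: "w' \<in> carrier_vec n" using smult wG w by (auto simp: w'_def)
    have "(\<Sum>i<n. cnj (w $ i) * w $ i) = complex_of_real s"
      unfolding s_def of_real_sum by (intro sum.cong refl) (simp only: complex_norm_square mult.commute)
    moreover have "(\<Sum>i<n. cnj (w' $ i) * w' $ i) = (complex_of_real (1 / sqrt s))\<^sup>2 * (\<Sum>i<n. cnj (w $ i) * w $ i)"
      using w by (subst sum_distrib_left) (auto simp: w'_def power2_eq_square intro!: sum.cong)
    moreover have "(complex_of_real (1 / sqrt s))\<^sup>2 * complex_of_real s = 1"
    proof -
      have "(1 / sqrt s)\<^sup>2 * s = 1" using s by (simp add: power_divide)
      thus ?thesis by (metis of_real_1 of_real_mult of_real_power)
    qed
    ultimately have ww: "(\<Sum>i<n. cnj (w' $ i) * w' $ i) = 1" by simp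
    have "adj J *\<^sub>v w = 0\<^sub>v r"
      unfolding w_def using uc Jc aJu by (simp add: mult_minus_distrib_mat_vec[OF aJ] JJ')
    hence "adj J *\<^sub>v w' = 0\<^sub>v r"
      unfolding w'_def using w aJ by (subst mult_mat_vec[OF aJ w]) auto
    hence Jw: "(\<Sum>i<n. cnj (J $$ (i, k)) * w' $ i) = 0" if "k < r" for k
      using adj_mult_vec_index[OF J w'c that] that by simp
    have wJ: "(\<Sum>i<n. cnj (w' $ i) * J $$ (i, k)) = 0" if "k < r" for k
      using arg_cong[OF Jw[OF that], of cnj] by (simp add: mult.commute)
    define K where "K = mat n (Suc r) (\<lambda>(i, k). if k < r then J $$ (i, k) else w' $ i)"
    have K: "K \<in> carrier_mat n (Suc r)" by (simp add: K_def)
    have "adj K * K = 1\<^sub>m (Suc r)"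
    proof (rule eq_matI)
      fix k l assume kl: "k < dim_row (1\<^sub>m (Suc r) :: complex mat)" "l < dim_col (1\<^sub>m (Suc r) :: complex mat)"
      hence kl': "k < Suc r" "l < Suc r" by auto
      have "(\<Sum>i<n. cnj (J $$ (i, k)) * J $$ (i, l)) = (if k = l then 1 else 0)" if "k < r" "l < r"
        using adj_mult_index[OF J J that] JJ that by simp
      moreover have "(adj K * K) $$ (k, l) = (\<Sum>i<n. cnj (if k < r then J $$ (i, k) else w' $ i) * (if l < r then J $$ (i, l) else w' $ i))"
        using kl' by (subst adj_mult_index[OF K K kl']) (auto simp: K_def intro!: sum.cong)
      ultimately show "(adj K * K) $$ (k, l) = 1\<^sub>m (Suc r) $$ (k, l)"
        using kl' Jw wJ ww by (cases "k < r"; cases "l < r") auto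
    qed (use K in auto)
    moreover have "col K k \<in> G" if "k < Suc r" for k
    proof (cases "k < r")
      case True
      hence "col K k = col J k" using J by (intro eq_vecI) (auto simp: K_def)
      thus ?thesis using col True by simp
    next
      case False
      hence "col K k = w'" using that w'c by (intro eq_vecI) (auto simp: K_def)
      thus ?thesis using w'G by simp
    qed
    ultimately have "ON (Suc r) K" using K by (simp add: ON_def)
    from max[OF this] show False by simp
  qed
  thus ?thesis using J JJ col by blast
qed

text \<open>For orthonormal columns the left inverse is the adjoint, so the compression stays
  unitary. Taking adjoints in the relation of \<open>J\<close> with \<open>adj X\<close> shows that
  \<open>adj J\<close> intertwines as well.\<close>

lemma unitary_compress:
  assumes R: "unitary_repn R" and J: "J \<in> carrier_mat (deg R) r" and JJ: "adj J * J = 1\<^sub>m r"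
    and inv: "\<And>X x. X \<in> sl3 \<Longrightarrow> x \<in> carrier_vec r \<Longrightarrow>
        J *\<^sub>v (adj J *\<^sub>v (act R X *\<^sub>v (J *\<^sub>v x))) = act R X *\<^sub>v (J *\<^sub>v x)"
  defines "S \<equiv> compress (adj J) J R"
  shows "unitary_repn S" "intertwines S R J" "intertwines R S (adj J)" "deg S = r"
proof -
  let ?n = "deg R"
  have rR: "is_repn R" using R by (simp add: unitary_repn_def)
  note aJ = adj_carrier[OF J]
  have JJ': "adj J *\<^sub>v (J *\<^sub>v x) = x" if "x \<in> carrier_vec r" for x
    using one_mat_iff[OF aJ J] JJ that by blast
  have rS: "is_repn S" and iJ: "intertwines S R J"
    unfolding S_def using is_repn_compress[OF rR J aJ JJ' inv] intertwines_compress[OF rR J aJ JJ' inv] by auto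
  thus "intertwines S R J" by simp
  show dS: "deg S = r" using J by (simp add: S_def)
  have adjact: "act R (adj X) = adj (act R X)" if "X \<in> sl3" for X using R that by (simp add: unitary_repn_def)
  have actS: "act S X = adj J * act R X * J" for X by (simp add: S_def)
  have uS: "act S (adj X) = adj (act S X)" if X: "X \<in> sl3" for X
  proof -
    note c = is_repn_carrier[OF rR X]
    have "adj (adj J * act R X * J) = adj J * adj (adj J * act R X)"
      using J aJ c by (intro adj_mult[of _ r ?n _ r]) auto
    also have "adj (adj J * act R X) = adj (act R X) * adj (adj J)"
      by (rule adj_mult[OF aJ c])
    finally show ?thesis
      using J aJ c adjact[OF X] assoc_mult_mat[OF aJ adj_carrier[OF c] J] by (simp add: actS)
  qed
  thus "unitary_repn S" using rS by (simp add: unitary_repn_def)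
  show "intertwines R S (adj J)"
  proof (rule intertwinesI_mat[OF _ rR rS])
    show "adj J \<in> carrier_mat (deg S) (deg R)" using aJ dS by simp
    fix X assume X: "X \<in> sl3"
    note c = is_repn_carrier[OF rR X] and cS = is_repn_carrier[OF rS X] and aX = adj_sl3[OF X]
    have "adj J * act R X = adj (adj (act R X) * J)"
      using adj_mult[OF adj_carrier[OF c] J] by simp
    also have "adj (act R X) * J = J * act S (adj X)"
      using intertwines_mat[OF iJ rS rR aX] adjact[OF X] by simp
    also have "adj (J * act S (adj X)) = adj (act S (adj X)) * adj J"
      using J is_repn_carrier[OF rS aX] dS by (intro adj_mult[of _ ?n r _ r]) auto
    also have "\<dots> = act S X * adj J" using uS[OF X] by simp
    finally show "adj J * act R X = act S X * adj J" .
  qed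
qed

text \<open>The orthogonal complement of \<open>U\<close> is the kernel of the intertwiner
  \<open>adj J\<close>, hence invariant. Orthonormal bases of the two subspaces give complementary
  projections, to which \<open>iso_dsumI\<close> applies.\<close>

lemma unitary_split:
  assumes R: "unitary_repn R" and U: "invariant_subspace R U"
    and U0: "U \<noteq> {0\<^sub>v (deg R)}" and U1: "U \<noteq> carrier_vec (deg R)"
  shows "\<exists>S T J K. unitary_repn S \<and> unitary_repn T \<and> deg S < deg R \<and> deg T < deg R \<and>
    intertwines R S (adj J) \<and> intertwines R T (adj K) \<and> iso_repn R (dsum S T) \<and>
    (\<forall>v\<in>carrier_vec (deg R). J *\<^sub>v (adj J *\<^sub>v v) + K *\<^sub>v (adj K *\<^sub>v v) = v) \<and>
    J \<in> carrier_mat (deg R) (deg S) \<and> K \<in> carrier_mat (deg R) (deg T)"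
proof -
  let ?n = "deg R"
  have rR: "is_repn R" using R by (simp add: unitary_repn_def)
  have sub: "\<exists>r J. J \<in> carrier_mat ?n r \<and> adj J * J = 1\<^sub>m r \<and>
    (\<forall>x\<in>carrier_vec r. J *\<^sub>v x \<in> U) \<and> (\<forall>u\<in>U. J *\<^sub>v (adj J *\<^sub>v u) = u)"
    if "invariant_subspace R U" for U
  proof -
    note U = invariant_subspaceD[OF that]
    have "\<exists>r J. J \<in> carrier_mat ?n r \<and> adj J * J = 1\<^sub>m r \<and> (\<forall>k<r. col J k \<in> U) \<and>
      (\<forall>u\<in>U. J *\<^sub>v (adj J *\<^sub>v u) = u)"
    proof (rule orthonormal_family_exists[OF U(1) U(4)])
      fix J r u assume J: "J \<in> carrier_mat ?n r" "adj J * J = 1\<^sub>m r" "\<And>k. k < r \<Longrightarrow> col J k \<in> U" and u: "u \<in> U"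
      have uc: "u \<in> carrier_vec ?n" using u U(1) by auto
      have "J *\<^sub>v (adj J *\<^sub>v u) \<in> U"
        using J uc U by (intro mult_vec_in_subspace[of J ?n r]) auto
      hence "u + (-1) \<cdot>\<^sub>v (J *\<^sub>v (adj J *\<^sub>v u)) \<in> U" using U u by blast
      moreover have "u + (-1) \<cdot>\<^sub>v (J *\<^sub>v (adj J *\<^sub>v u)) = u - J *\<^sub>v (adj J *\<^sub>v u)"
        using uc J by (intro eq_vecI) auto
      ultimately show "u - J *\<^sub>v (adj J *\<^sub>v u) \<in> U" by simp
    qed
    then obtain r J where J: "J \<in> carrier_mat ?n r" "adj J * J = 1\<^sub>m r" "\<forall>k<r. col J k \<in> U"
      "\<forall>u\<in>U. J *\<^sub>v (adj J *\<^sub>v u) = u" by blast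
    moreover have "J *\<^sub>v x \<in> U" if "x \<in> carrier_vec r" for x
      using J U that by (intro mult_vec_in_subspace[of J ?n r]) auto
    ultimately show ?thesis by blast
  qed
  have red: "unitary_repn (compress (adj J) J R) \<and> intertwines (compress (adj J) J R) R J \<and>
     intertwines R (compress (adj J) J R) (adj J) \<and> deg (compress (adj J) J R) = r"
    if "invariant_subspace R U" "J \<in> carrier_mat ?n r" "adj J * J = 1\<^sub>m r"
    "\<forall>x\<in>carrier_vec r. J *\<^sub>v x \<in> U" "\<forall>u\<in>U. J *\<^sub>v (adj J *\<^sub>v u) = u" for U J r
    using unitary_compress[OF R that(2,3)] invariant_subspaceD(5)[OF that(1)] that(4,5) by blast
  obtain r J where J: "J \<in> carrier_mat ?n r" "adj J * J = 1\<^sub>m r"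
    "\<forall>x\<in>carrier_vec r. J *\<^sub>v x \<in> U" "\<forall>u\<in>U. J *\<^sub>v (adj J *\<^sub>v u) = u"
    using sub[OF U] by blast
  define S where "S = compress (adj J) J R"
  have S: "unitary_repn S" "intertwines S R J" "intertwines R S (adj J)" "deg S = r"
    using red[OF U J] by (auto simp: S_def)
  note aJ = adj_carrier[OF J(1)]
  have JJ: "adj J *\<^sub>v (J *\<^sub>v x) = x" if "x \<in> carrier_vec r" for x
    using one_mat_iff[OF aJ J(1)] J(2) that by blast
  define V where "V = {w \<in> carrier_vec ?n. adj J *\<^sub>v w = 0\<^sub>v r}"
  have V: "invariant_subspace R V"
    unfolding invariant_subspace_def subspace_iff
  proof (intro conjI ballI allI)
    show "V \<subseteq> carrier_vec ?n" by (auto simp: V_def)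
    show "0\<^sub>v ?n \<in> V" using aJ by (auto simp: V_def)
    show "u + v \<in> V" if "u \<in> V" "v \<in> V" for u v
      using that by (auto simp: V_def mult_add_distrib_mat_vec[OF aJ])
    show "c \<cdot>\<^sub>v u \<in> V" if "u \<in> V" for c u
      using that by (auto simp: V_def mult_mat_vec[OF aJ])
    show "act R X *\<^sub>v v \<in> V" if "X \<in> sl3" "v \<in> V" for X v
      using that intertwinesD(2)[OF S(3), of X v] rR is_repn_carrier[of S X] S(1,4)
      by (auto simp: V_def unitary_repn_def)
  qed
  obtain s K where K: "K \<in> carrier_mat ?n s" "adj K * K = 1\<^sub>m s"
    "\<forall>x\<in>carrier_vec s. K *\<^sub>v x \<in> V" "\<forall>u\<in>V. K *\<^sub>v (adj K *\<^sub>v u) = u"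
    using sub[OF V] by blast
  define T where "T = compress (adj K) K R"
  have T: "unitary_repn T" "intertwines T R K" "intertwines R T (adj K)" "deg T = s"
    using red[OF V K] by (auto simp: T_def)
  note aK = adj_carrier[OF K(1)]
  have KK: "adj K *\<^sub>v (K *\<^sub>v x) = x" if "x \<in> carrier_vec s" for x
    using one_mat_iff[OF aK K(1)] K(2) that by blast
  have JK: "adj J *\<^sub>v (K *\<^sub>v x) = 0\<^sub>v r" if "x \<in> carrier_vec s" for x
    using K(3) that by (auto simp: V_def)
  \<comment> \<open>One orthogonality relation comes from the definition of \<open>V\<close>; its
    adjoint is the other.\<close>
  have "adj J * K = 0\<^sub>m r s"
    using J K JK by (intro eq_mat_vecI[of _ r s]) (auto simp: assoc_mult_mat_vec[OF aJ K(1)])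
  hence "adj (adj J * K) = 0\<^sub>m s r" by (auto intro!: eq_matI)
  hence "adj K * J = 0\<^sub>m s r" using adj_mult[OF aJ K(1)] by simp
  hence KJ: "adj K *\<^sub>v (J *\<^sub>v x) = 0\<^sub>v s" if "x \<in> carrier_vec r" for x
    using that assoc_mult_mat_vec[OF aK J(1) that] zero_mat_mult_vec by simp
  have sum: "J *\<^sub>v (adj J *\<^sub>v v) + K *\<^sub>v (adj K *\<^sub>v v) = v" if v: "v \<in> carrier_vec ?n" for v
  proof -
    define w where "w = v - J *\<^sub>v (adj J *\<^sub>v v)"
    have av: "adj J *\<^sub>v v \<in> carrier_vec r" using aJ v by auto
    have Jv: "J *\<^sub>v (adj J *\<^sub>v v) \<in> carrier_vec ?n" using J(1) av by auto
    have w: "w \<in> V"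
      using v Jv av by (simp add: V_def w_def mult_minus_distrib_mat_vec[OF aJ] JJ)
    have "adj K *\<^sub>v w = adj K *\<^sub>v v"
      unfolding w_def using v Jv av aK by (simp add: mult_minus_distrib_mat_vec[OF aK] KJ)
    hence "K *\<^sub>v (adj K *\<^sub>v v) = w" using K(4) w by auto
    thus ?thesis using add_minus_vec_cancel[OF v Jv] by (simp add: w_def)
  qed
  have rS: "is_repn S" and rT: "is_repn T" using S(1) T(1) by (auto simp: unitary_repn_def)
  have iso: "iso_repn R (dsum S T)"
    by (rule iso_dsumI[OF rR rS rT S(2) T(2) S(3) T(3)]) (use JJ KK JK KJ sum S(4) T(4) in auto)
  hence deg: "deg R = deg S + deg T" by (auto simp: iso_repn_def)
  \<comment> \<open>Both parts are nonzero, so both degrees drop strictly, as the inductions on the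
    degree require.\<close>
  have "r \<noteq> 0"
  proof
    assume "r = 0"
    hence "u = 0\<^sub>v ?n" if "u \<in> U" for u
    proof -
      have "J *\<^sub>v (adj J *\<^sub>v u) = 0\<^sub>v ?n"
        using J(1) aJ \<open>r = 0\<close> by (intro eq_vecI) (auto simp: scalar_prod_def)
      thus ?thesis using J(4) that by auto
    qed
    hence "U = {0\<^sub>v ?n}" using invariant_subspaceD(2)[OF U] by blast
    thus False using U0 by simp
  qed
  moreover have "s \<noteq> 0"
  proof
    assume s: "s = 0"
    have "carrier_vec ?n \<subseteq> U"
    proof
      fix v :: "complex vec" assume v: "v \<in> carrier_vec ?n"
      have "K *\<^sub>v (adj K *\<^sub>v v) = 0\<^sub>v ?n"
        using K(1) aK s by (intro eq_vecI) (auto simp: scalar_prod_def)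
      hence "J *\<^sub>v (adj J *\<^sub>v v) = v" using sum[OF v] J(1) aJ v by simp
      moreover have "J *\<^sub>v (adj J *\<^sub>v v) \<in> U" using J(3) aJ v by auto
      ultimately show "v \<in> U" by simp
    qed
    thus False using U1 invariant_subspaceD(1)[OF U] by blast
  qed
  ultimately show ?thesis
    using S T iso deg sum J(1) K(1) by (intro exI[of _ S] exI[of _ T] exI[of _ J] exI[of _ K]) auto
qed

lemma irreducible_repnI:
  assumes "is_repn R" "0 < deg R" "\<not> (\<exists>U. invariant_subspace R U \<and> U \<noteq> {0\<^sub>v (deg R)} \<and> U \<noteq> carrier_vec (deg R))"
  shows "irreducible_repn R"
  using assms by (auto simp: irreducible_repn_def)

lemma unitary_decomposition:
  assumes "unitary_repn R"
  shows "\<exists>Rs. (\<forall>S\<in>set Rs. irreducible_repn S) \<and> iso_repn R (direct_sum_repn Rs)"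
  using assms
proof (induction "deg R" arbitrary: R rule: less_induct)
  case less
  have rR: "is_repn R" using less.prems by (simp add: unitary_repn_def)
  consider "deg R = 0" | "irreducible_repn R"
    | U where "invariant_subspace R U" "U \<noteq> {0\<^sub>v (deg R)}" "U \<noteq> carrier_vec (deg R)"
    using irreducible_repnI[OF rR] by blast
  thus ?case
  proof cases
    case 1
    have "iso_repn R (direct_sum_repn [])"
    proof (rule iso_repn_cong)
      fix X assume "X \<in> sl3"
      thus "act R X = act (direct_sum_repn []) X"
        using is_repn_carrier[OF rR, of X] 1 by (intro eq_matI) (auto simp: direct_sum_repn_def)
    qed (use rR 1 in \<open>auto simp: direct_sum_repn_def\<close>)
    thus ?thesis by (intro exI[of _ "[]"]) simp
  next
    case 2
    have "iso_repn R (direct_sum_repn [R])"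
      using rR by (intro iso_repn_cong) (auto simp: direct_sum_repn_def)
    thus ?thesis using 2 by (intro exI[of _ "[R]"]) simp
  next
    case 3
    obtain S T where ST: "unitary_repn S" "unitary_repn T" "deg S < deg R" "deg T < deg R" "iso_repn R (dsum S T)"
      using unitary_split[OF less.prems 3] by blast
    have rS: "is_repn S" and rT: "is_repn T" using ST by (auto simp: unitary_repn_def)
    obtain Rs where Rs: "\<forall>S\<in>set Rs. irreducible_repn S" "iso_repn S (direct_sum_repn Rs)"
      using less.hyps[OF ST(3,1)] by blast
    obtain Ts where Ts: "\<forall>S\<in>set Ts. irreducible_repn S" "iso_repn T (direct_sum_repn Ts)"
      using less.hyps[OF ST(4,2)] by blast
    have r: "\<forall>S\<in>set Rs. is_repn S" "\<forall>S\<in>set Ts. is_repn S" "\<forall>S\<in>set (Rs @ Ts). is_repn S"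
      using Rs Ts by (auto simp: irreducible_repn_def)
    note d = is_repn_direct_sum(1)[OF r(1)] is_repn_direct_sum(1)[OF r(2)] is_repn_direct_sum(1)[OF r(3)]
    have "iso_repn R (dsum (direct_sum_repn Rs) (direct_sum_repn Ts))"
      by (rule iso_repn_trans[OF rR is_repn_dsum[OF rS rT] is_repn_dsum[OF d(1,2)] ST(5)
            iso_dsum_cong[OF rS d(1) rT d(2) Rs(2) Ts(2)]])
    hence "iso_repn R (direct_sum_repn (Rs @ Ts))"
      by (rule iso_repn_trans[OF rR is_repn_dsum[OF d(1,2)] d(3)]) (rule iso_direct_sum_append[OF r(1,2)])
    thus ?thesis using Rs Ts by (intro exI[of _ "Rs @ Ts"]) auto
  qed
qed

lemma intertwines_highest_weight_vector:
  assumes R: "is_repn R" and K: "intertwines R S K" and v: "highest_weight_vector R \<mu> v" and "K *\<^sub>v v \<noteq> 0\<^sub>v (deg S)"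
  shows "highest_weight_vector S \<mu> (K *\<^sub>v v)"
proof -
  have vc: "v \<in> carrier_vec (deg R)" using v by (auto simp: highest_weight_vector_def weight_space_def)
  have "act S (elem_mat i j) *\<^sub>v (K *\<^sub>v v) = 0\<^sub>v (deg S)" if "j < 3" "i < j" for i j
    using that v intertwinesD(2)[OF K elem_mat_sl3 vc, of i j] mult_mat_zero_vec[OF intertwinesD(1)[OF K]]
    by (auto simp: highest_weight_vector_def)
  thus ?thesis
    using v assms(4) intertwines_weight_space[OF K] by (auto simp: highest_weight_vector_def)
qed

text \<open>The two projections of \<open>unitary_split\<close> add up to the identity, so one of
  them does not kill \<open>v\<close>; its image is again a highest weight vector of the same
  weight, in a module of smaller degree.\<close>

lemma unitary_irreducible_component:
  assumes "unitary_repn R" "highest_weight_vector R \<mu> v"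
  shows "\<exists>S w. unitary_repn S \<and> irreducible_repn S \<and> highest_weight_vector S \<mu> w"
  using assms
proof (induction "deg R" arbitrary: R v rule: less_induct)
  case less
  have rR: "is_repn R" using less.prems by (simp add: unitary_repn_def)
  have v: "v \<in> carrier_vec (deg R)" "v \<noteq> 0\<^sub>v (deg R)"
    using less.prems by (auto simp: highest_weight_vector_def weight_space_def)
  have "deg R \<noteq> 0" using v by (auto simp: vec_eq_iff)
  then consider "irreducible_repn R"
    | U where "invariant_subspace R U" "U \<noteq> {0\<^sub>v (deg R)}" "U \<noteq> carrier_vec (deg R)"
    using irreducible_repnI[OF rR] by blast
  thus ?case
  proof cases
    case 2
    obtain S T J K where ST: "unitary_repn S" "unitary_repn T" "deg S < deg R" "deg T < deg R"
      "intertwines R S (adj J)" "intertwines R T (adj K)"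
      "\<forall>v\<in>carrier_vec (deg R). J *\<^sub>v (adj J *\<^sub>v v) + K *\<^sub>v (adj K *\<^sub>v v) = v"
      "J \<in> carrier_mat (deg R) (deg S)" "K \<in> carrier_mat (deg R) (deg T)"
      using unitary_split[OF less.prems(1) 2] by blast
    have "adj J *\<^sub>v v \<noteq> 0\<^sub>v (deg S) \<or> adj K *\<^sub>v v \<noteq> 0\<^sub>v (deg T)"
    proof (rule ccontr)
      assume "\<not> ?thesis"
      hence "J *\<^sub>v 0\<^sub>v (deg S) + K *\<^sub>v 0\<^sub>v (deg T) = v" using ST(7) v by auto
      moreover have "J *\<^sub>v 0\<^sub>v (deg S) = 0\<^sub>v (deg R)" "K *\<^sub>v 0\<^sub>v (deg T) = 0\<^sub>v (deg R)" using ST(8,9) by auto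
      ultimately show False using v by auto
    qed
    thus ?thesis
      using less.hyps[OF ST(3,1)] less.hyps[OF ST(4,2)]
        intertwines_highest_weight_vector[OF rR ST(5) less.prems(2)]
        intertwines_highest_weight_vector[OF rR ST(6) less.prems(2)] by blast
  qed (use less.prems in blast)
qed

lemma irreducible_of_highest_weight_iff:
  "irreducible_of_highest_weight R \<mu> \<longleftrightarrow> irreducible_repn R \<and> (\<exists>v. highest_weight_vector R \<mu> v)"
  by (auto simp: irreducible_of_highest_weight_def highest_weight_vector_def)

lemma unitary_irreducible_exists:
  assumes "\<mu> \<in> dominant"
  shows "\<exists>R. unitary_repn R \<and> irreducible_of_highest_weight R \<mu>"
  using unitary_highest_weight_exists[OF assms] unitary_irreducible_component
  unfolding irreducible_of_highest_weight_iff by blast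

subsection \<open>Highest weight modules\<close>

lemma elem_mat_index: "i < 3 \<Longrightarrow> j < 3 \<Longrightarrow> elem_mat a b $$ (i, j) = (if i = a \<and> j = b then 1 else 0)"
  by (simp add: elem_mat_def)

lemma coroot_index:
  "i < 3 \<Longrightarrow> j < 3 \<Longrightarrow> coroot a $$ (i, j) = (if i = a \<and> j = a then 1 else 0) - (if i = Suc a \<and> j = Suc a then 1 else 0)"
  by (simp add: coroot_def elem_mat_index)

text \<open>Reduces a bracket of explicit 3 by 3 matrices to nine scalar identities, so that simp
  can verify the whole commutation table.\<close>

lemma bracketI:
  assumes "(A :: complex mat) \<in> carrier_mat 3 3" "B \<in> carrier_mat 3 3" "C \<in> carrier_mat 3 3"
    and "\<forall>i\<in>{0, 1, 2}. \<forall>j\<in>{0, 1, 2}. C $$ (i, j) =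
      A $$ (i, 0) * B $$ (0, j) + A $$ (i, 1) * B $$ (1, j) + A $$ (i, 2) * B $$ (2, j)
    - (B $$ (i, 0) * A $$ (0, j) + B $$ (i, 1) * A $$ (1, j) + B $$ (i, 2) * A $$ (2, j))"
  shows "A * B - B * A = C"
proof (rule eq_matI)
  fix i j assume "i < dim_row C" "j < dim_col C"
  hence ij: "i < 3" "j < 3" using assms(3) by auto
  hence "i \<in> {0, 1, 2}" "j \<in> {0, 1, 2}" by auto
  hence "C $$ (i, j) = A $$ (i, 0) * B $$ (0, j) + A $$ (i, 1) * B $$ (1, j) + A $$ (i, 2) * B $$ (2, j)
    - (B $$ (i, 0) * A $$ (0, j) + B $$ (i, 1) * A $$ (1, j) + B $$ (i, 2) * A $$ (2, j))"
    using assms(4) by blast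
  thus "(A * B - B * A) $$ (i, j) = C $$ (i, j)"
    using assms(1-3) ij by (simp add: index_mult_mat_3 del: index_mult_mat(1))
qed (use assms in auto)

section \<open>The commutation table and weight shifts\<close>

context sl3_repn
begin

abbreviation "E1 \<equiv> op (elem_mat 0 1)"
abbreviation "E2 \<equiv> op (elem_mat 1 2)"
abbreviation "E3 \<equiv> op (elem_mat 0 2)"
abbreviation "F1 \<equiv> op (elem_mat 1 0)"
abbreviation "F2 \<equiv> op (elem_mat 2 1)"
abbreviation "F3 \<equiv> op (elem_mat 2 0)"
abbreviation "H1 \<equiv> op (coroot 0)"
abbreviation "H2 \<equiv> op (coroot 1)"

text \<open>Stated with \<open>Suc 0\<close>, the form into which simp rewrites the index
  \<open>1\<close>. The same reason is behind the variants with \<open>One_nat_def\<close>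
  unfolded.\<close>

lemma in_sl3 [simp]:
  "elem_mat 0 (Suc 0) \<in> sl3" "elem_mat (Suc 0) 2 \<in> sl3" "elem_mat 0 2 \<in> sl3"
  "elem_mat (Suc 0) 0 \<in> sl3" "elem_mat 2 (Suc 0) \<in> sl3" "elem_mat 2 0 \<in> sl3"
  "coroot 0 \<in> sl3" "coroot (Suc 0) \<in> sl3"
  by (simp_all add: elem_mat_sl3 coroot_sl3)

lemma dim_op [simp]: "X \<in> sl3 \<Longrightarrow> v \<in> carrier_vec n \<Longrightarrow> dim_vec (op X v) = n"
  by (rule carrier_vecD[OF op_carrier])

lemma op_commuteI:
  assumes "X \<in> sl3" "Y \<in> sl3" "Z \<in> sl3" "v \<in> carrier_vec n" "X * Y - Y * X = c \<cdot>\<^sub>m Z"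
  shows "op X (op Y v) = op Y (op X v) + c \<cdot>\<^sub>v op Z v"
  using op_commute[OF assms(1,2,4)] op_mat_smult[OF assms(3,4)] assms(5) by simp

text \<open>All relations share one shape, with a zero multiple where the operators commute, so that
  a single proof covers the table. The rules for \<open>F1\<close> and \<open>F2\<close> move these
  operators to the right.\<close>

lemma commutation:
  assumes v: "v \<in> carrier_vec n"
  shows "F1 (E1 v) = E1 (F1 v) + (-1) \<cdot>\<^sub>v H1 v" "F1 (E2 v) = E2 (F1 v) + 0 \<cdot>\<^sub>v H1 v"
    "F1 (E3 v) = E3 (F1 v) + 1 \<cdot>\<^sub>v E2 v" "F1 (F2 v) = F2 (F1 v) + (-1) \<cdot>\<^sub>v F3 v"
    "F1 (F3 v) = F3 (F1 v) + 0 \<cdot>\<^sub>v F3 v" "F1 (H1 v) = H1 (F1 v) + 2 \<cdot>\<^sub>v F1 v"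
    "F1 (H2 v) = H2 (F1 v) + (-1) \<cdot>\<^sub>v F1 v"
    and "F2 (E1 v) = E1 (F2 v) + 0 \<cdot>\<^sub>v H1 v" "F2 (E2 v) = E2 (F2 v) + (-1) \<cdot>\<^sub>v H2 v"
    "F2 (E3 v) = E3 (F2 v) + (-1) \<cdot>\<^sub>v E1 v" "F2 (F1 v) = F1 (F2 v) + 1 \<cdot>\<^sub>v F3 v"
    "F2 (F3 v) = F3 (F2 v) + 0 \<cdot>\<^sub>v F3 v" "F2 (H1 v) = H1 (F2 v) + (-1) \<cdot>\<^sub>v F2 v"
    "F2 (H2 v) = H2 (F2 v) + 2 \<cdot>\<^sub>v F2 v"
    and "E1 (H1 v) = H1 (E1 v) + (-2) \<cdot>\<^sub>v E1 v" "E1 (H2 v) = H2 (E1 v) + 1 \<cdot>\<^sub>v E1 v"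
    "E2 (H1 v) = H1 (E2 v) + 1 \<cdot>\<^sub>v E2 v" "E2 (H2 v) = H2 (E2 v) + (-2) \<cdot>\<^sub>v E2 v"
    "E3 (H1 v) = H1 (E3 v) + (-1) \<cdot>\<^sub>v E3 v" "E3 (H2 v) = H2 (E3 v) + (-1) \<cdot>\<^sub>v E3 v"
    "F3 (H1 v) = H1 (F3 v) + 1 \<cdot>\<^sub>v F3 v" "F3 (H2 v) = H2 (F3 v) + 1 \<cdot>\<^sub>v F3 v"
    "E3 (F3 v) = F3 (E3 v) + 1 \<cdot>\<^sub>v op (coroot 0 + coroot 1) v"
  by (((rule op_commuteI[OF _ _ _ v], simp, simp, simp add: sl3_add, rule bracketI,
        simp_all add: elem_mat_index coroot_index))[1])+

lemmas commutation_FH = commutation(1,2,6,7,8,9,13,14)[unfolded One_nat_def]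

lemma weight_space_iff:
  "v \<in> weight_space R \<mu> \<longleftrightarrow> v \<in> carrier_vec n \<and> H1 v = of_int (fst \<mu>) \<cdot>\<^sub>v v \<and> H2 v = of_int (snd \<mu>) \<cdot>\<^sub>v v"
  by (simp add: weight_space_def op_def)

lemma weight_space_carrier: "v \<in> weight_space R \<mu> \<Longrightarrow> v \<in> carrier_vec n"
  by (simp add: weight_space_def)

text \<open>The hypotheses describe the bracket of \<open>X\<close> with a coroot in this order,
  whereas the root is read off from the opposite order; hence the signs in \<open>c\<close> and
  \<open>d\<close>.\<close>

lemma weight_shiftI:
  assumes v: "v \<in> weight_space R \<mu>" and X: "X \<in> sl3"
    and 1: "op X (H1 v) = H1 (op X v) + c \<cdot>\<^sub>v op X v" and 2: "op X (H2 v) = H2 (op X v) + d \<cdot>\<^sub>v op X v"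
    and c: "c = - of_int (fst \<alpha>)" and d: "d = - of_int (snd \<alpha>)"
  shows "op X v \<in> weight_space R (\<mu> + \<alpha>)"
proof -
  have *: "y = (a - c) \<cdot>\<^sub>v z" if "a \<cdot>\<^sub>v z = y + c \<cdot>\<^sub>v z" "y \<in> carrier_vec n" "z \<in> carrier_vec n"
    for a c and y z :: "complex vec"
  proof (rule eq_vecI)
    fix i assume "i < dim_vec ((a - c) \<cdot>\<^sub>v z)"
    hence i: "i < n" using that by simp
    have "(a \<cdot>\<^sub>v z) $ i = (y + c \<cdot>\<^sub>v z) $ i" using that(1) by simp
    thus "y $ i = ((a - c) \<cdot>\<^sub>v z) $ i" using i that(2,3) by (simp add: algebra_simps)
  qed (use that in auto)
  have vc: "v \<in> carrier_vec n" using v by (simp add: weight_space_iff)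
  have "of_int (fst \<mu>) \<cdot>\<^sub>v op X v = H1 (op X v) + c \<cdot>\<^sub>v op X v"
    "of_int (snd \<mu>) \<cdot>\<^sub>v op X v = H2 (op X v) + d \<cdot>\<^sub>v op X v"
    using 1 2 v X by (simp_all add: weight_space_iff)
  from *[OF this(1)] *[OF this(2)] show ?thesis
    using vc X c d by (simp add: weight_space_iff)
qed

lemma weight_shift:
  assumes "v \<in> weight_space R \<mu>"
  shows "E1 v \<in> weight_space R (\<mu> + \<alpha>1)" "E2 v \<in> weight_space R (\<mu> + \<alpha>2)"
    "F1 v \<in> weight_space R (\<mu> + - \<alpha>1)" "F2 v \<in> weight_space R (\<mu> + - \<alpha>2)"
    "E3 v \<in> weight_space R (\<mu> + (\<alpha>1 + \<alpha>2))" "F3 v \<in> weight_space R (\<mu> + - (\<alpha>1 + \<alpha>2))"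
  by ((rule weight_shiftI[OF assms _ commutation(15,16)] weight_shiftI[OF assms _ commutation(17,18)]
       weight_shiftI[OF assms _ commutation(6,7)] weight_shiftI[OF assms _ commutation(13,14)]
       weight_shiftI[OF assms _ commutation(19,20)] weight_shiftI[OF assms _ commutation(21,22)],
      use weight_space_carrier[OF assms] in \<open>simp_all add: \<alpha>1_def \<alpha>2_def\<close>)[1])+

end

section \<open>Sums of weight vectors and cyclic submodules\<close>

inductive_set wspan :: "repn \<Rightarrow> weight set \<Rightarrow> complex vec set" for R M where
  wspan_zero: "0\<^sub>v (deg R) \<in> wspan R M"
| wspan_step: "u \<in> wspan R M \<Longrightarrow> w \<in> weight_space R \<kappa> \<Longrightarrow> \<kappa> \<in> M \<Longrightarrow> u + w \<in> wspan R M"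

text \<open>The value on the coroot of \<theta>. Both simple roots have value 1, so subtracting a
  simple root lowers it by one.\<close>

definition ht :: "weight \<Rightarrow> int" where
  "ht \<mu> = fst \<mu> + snd \<mu>"

definition below :: "weight \<Rightarrow> weight set" where
  "below \<mu> = {\<mu> - (scale (int k) \<alpha>1 + scale (int l) \<alpha>2) | k l. True}"

lemma below_shift:
  assumes "\<kappa> \<in> below \<mu>"
  shows "\<kappa> + - \<alpha>1 \<in> below \<mu> - {\<mu>}" "\<kappa> + - \<alpha>2 \<in> below \<mu> - {\<mu>}"
proof -
  from assms obtain k l where \<kappa>: "\<kappa> = \<mu> - (scale (int k) \<alpha>1 + scale (int l) \<alpha>2)" by (auto simp: below_def)
  have "\<kappa> + - \<alpha>1 = \<mu> - (scale (int (Suc k)) \<alpha>1 + scale (int l) \<alpha>2)"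
    "\<kappa> + - \<alpha>2 = \<mu> - (scale (int k) \<alpha>1 + scale (int (Suc l)) \<alpha>2)"
    by (auto simp: \<kappa> scale_def \<alpha>1_def \<alpha>2_def prod_eq_iff algebra_simps)
  hence "\<kappa> + - \<alpha>1 \<in> below \<mu>" "\<kappa> + - \<alpha>2 \<in> below \<mu>" unfolding below_def by blast+
  moreover have "\<kappa> + - \<alpha>1 \<noteq> \<mu>" "\<kappa> + - \<alpha>2 \<noteq> \<mu>"
    by (auto simp: \<kappa> scale_def \<alpha>1_def \<alpha>2_def prod_eq_iff)
  ultimately show "\<kappa> + - \<alpha>1 \<in> below \<mu> - {\<mu>}" "\<kappa> + - \<alpha>2 \<in> below \<mu> - {\<mu>}" by auto
qed

lemma below_ht: "\<kappa> \<in> below \<mu> - {\<mu>} \<Longrightarrow> ht \<kappa> < ht \<mu>"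
  by (auto simp: below_def ht_def scale_def \<alpha>1_def \<alpha>2_def prod_eq_iff)

lemma below_self: "\<mu> \<in> below \<mu>"
  unfolding below_def by (rule CollectI, rule exI[of _ 0], rule exI[of _ 0]) (simp add: scale_def zero_prod_def[symmetric])

text \<open>Generated by lowering operators alone; stability under the coroots and the raising
  operators is the content of \<open>cyc_invariant\<close>.\<close>

inductive_set cyc :: "repn \<Rightarrow> complex vec \<Rightarrow> complex vec set" for R v where
  cyc_base: "v \<in> cyc R v"
| cyc_add: "u \<in> cyc R v \<Longrightarrow> w \<in> cyc R v \<Longrightarrow> u + w \<in> cyc R v"
| cyc_smult: "u \<in> cyc R v \<Longrightarrow> c \<cdot>\<^sub>v u \<in> cyc R v"
| cyc_f1: "u \<in> cyc R v \<Longrightarrow> act R (elem_mat 1 0) *\<^sub>v u \<in> cyc R v"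
| cyc_f2: "u \<in> cyc R v \<Longrightarrow> act R (elem_mat 2 1) *\<^sub>v u \<in> cyc R v"

context sl3_repn
begin

lemma vec_add_ac:
  "u \<in> carrier_vec n \<Longrightarrow> v \<in> carrier_vec n \<Longrightarrow> w \<in> carrier_vec n \<Longrightarrow> u + (v + w) = (u + v) + (w :: complex vec)"
  by (intro eq_vecI) auto

lemma wspan_carrier: "u \<in> wspan R M \<Longrightarrow> u \<in> carrier_vec n"
  by (induction rule: wspan.induct) (auto dest: weight_space_carrier)

lemma wspan_weight: "w \<in> weight_space R \<kappa> \<Longrightarrow> \<kappa> \<in> M \<Longrightarrow> w \<in> wspan R M"
  using wspan_step[OF wspan_zero, of w R \<kappa> M] weight_space_carrier[of w \<kappa>] by simp

lemma wspan_add: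
  assumes "w \<in> wspan R M" "u \<in> wspan R M"
  shows "u + w \<in> wspan R M"
  using assms
proof (induction rule: wspan.induct)
  case wspan_zero
  thus ?case using wspan_carrier by simp
next
  case (wspan_step w z \<kappa>)
  have "u + (w + z) = (u + w) + z"
    by (rule vec_add_ac[OF wspan_carrier[OF assms(2)] wspan_carrier[OF wspan_step(1)] weight_space_carrier[OF wspan_step(2)]])
  thus ?case using wspan.wspan_step[of "u + w" R M z \<kappa>] wspan_step by simp
qed

lemma wspan_smult: "u \<in> wspan R M \<Longrightarrow> c \<cdot>\<^sub>v u \<in> wspan R M"
proof (induction rule: wspan.induct)
  case wspan_zero
  have "c \<cdot>\<^sub>v 0\<^sub>v n = (0\<^sub>v n :: complex vec)" by (intro eq_vecI) auto
  thus ?case using wspan.wspan_zero[of R M] by simp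
next
  case (wspan_step u w \<kappa>)
  have "c \<cdot>\<^sub>v (u + w) = c \<cdot>\<^sub>v u + c \<cdot>\<^sub>v w"
    by (rule smult_add_distrib_vec[OF wspan_carrier[OF wspan_step(1)] weight_space_carrier[OF wspan_step(2)]])
  moreover have "c \<cdot>\<^sub>v w \<in> weight_space R \<kappa>"
    using wspan_step(2) by (simp add: weight_space_iff smult_smult_assoc mult.commute)
  ultimately show ?case using wspan.wspan_step[of "c \<cdot>\<^sub>v u" R M] wspan_step by simp
qed

lemma wspan_op:
  assumes "u \<in> wspan R M" "X \<in> sl3" "\<And>w \<kappa>. w \<in> weight_space R \<kappa> \<Longrightarrow> \<kappa> \<in> M \<Longrightarrow> op X w \<in> wspan R M'"
  shows "op X u \<in> wspan R M'"
  using assms(1)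
proof (induction rule: wspan.induct)
  case wspan_zero
  thus ?case using assms(2) wspan.wspan_zero by simp
next
  case (wspan_step u w \<kappa>)
  thus ?case using wspan_add[OF assms(3)[OF wspan_step(2,3)] wspan_step(4)]
    wspan_carrier[OF wspan_step(1)] weight_space_carrier[OF wspan_step(2)] assms(2) by simp
qed

lemma wspan_mono: "u \<in> wspan R M \<Longrightarrow> M \<subseteq> M' \<Longrightarrow> u \<in> wspan R M'"
  by (induction rule: wspan.induct) (auto intro: wspan.intros)

text \<open>Products of the operators \<open>H1 + H2 - c\<close> separate weights of different height.\<close>

fun annih :: "int list \<Rightarrow> complex vec \<Rightarrow> complex vec" where
  "annih [] u = u"
| "annih (c # cs) u = (H1 (annih cs u) + H2 (annih cs u)) - of_int c \<cdot>\<^sub>v annih cs u"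

lemma annih_carrier [simp]: "u \<in> carrier_vec n \<Longrightarrow> annih cs u \<in> carrier_vec n"
  by (induction cs) auto

lemma annih_add:
  assumes "u \<in> carrier_vec n" "w \<in> carrier_vec n"
  shows "annih cs (u + w) = annih cs u + annih cs w"
proof (induction cs)
  case (Cons c cs)
  show ?case
    by (rule eq_vecI) (use assms in \<open>auto simp: Cons algebra_simps carrier_vecD[OF annih_carrier]\<close>)
qed simp

lemma annih_weight:
  assumes "w \<in> weight_space R \<kappa>"
  shows "annih cs w = (\<Prod>c\<leftarrow>cs. of_int (ht \<kappa> - c)) \<cdot>\<^sub>v w"
proof (induction cs)
  case (Cons c cs)
  have w: "w \<in> carrier_vec n" "H1 w = of_int (fst \<kappa>) \<cdot>\<^sub>v w" "H2 w = of_int (snd \<kappa>) \<cdot>\<^sub>v w"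
    using assms by (auto simp: weight_space_iff)
  show ?case
    by (rule eq_vecI) (use w in \<open>auto simp: Cons ht_def algebra_simps\<close>)
qed simp

lemma wspan_annih:
  assumes "u \<in> wspan R M"
  shows "\<exists>cs. set cs \<subseteq> ht ` M \<and> annih cs u = 0\<^sub>v n"
  using assms
proof (induction rule: wspan.induct)
  case wspan_zero
  show ?case by (intro exI[of _ "[]"]) simp
next
  case (wspan_step u w \<kappa>)
  then obtain cs where cs: "set cs \<subseteq> ht ` M" "annih cs u = 0\<^sub>v n" by blast
  note uc = wspan_carrier[OF wspan_step(1)] and wc = weight_space_carrier[OF wspan_step(2)]
  define p where "p = (\<Prod>c\<leftarrow>cs. of_int (ht \<kappa> - c) :: complex)"
  have "annih cs (u + w) = p \<cdot>\<^sub>v w"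
    using uc wc cs(2) by (simp add: annih_add annih_weight[OF wspan_step(2)] p_def)
  hence "annih (ht \<kappa> # cs) (u + w) = 0\<^sub>v n"
    using wspan_step(2) wc by (intro eq_vecI) (auto simp: weight_space_iff ht_def algebra_simps)
  thus ?case using cs wspan_step(3) by (intro exI[of _ "ht \<kappa> # cs"]) auto
qed

text \<open>Some product of the operators in \<open>annih\<close> kills \<open>u\<close> as a sum of
  vectors of other heights, yet it multiplies \<open>u\<close>, as a vector of weight
  \<open>\<mu>\<close>, by a nonzero scalar.\<close>

lemma wspan_weight_zero:
  assumes "u \<in> wspan R M" "u \<in> weight_space R \<mu>" "\<And>\<kappa>. \<kappa> \<in> M \<Longrightarrow> ht \<kappa> \<noteq> ht \<mu>"
  shows "u = 0\<^sub>v n"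
proof -
  obtain cs where cs: "set cs \<subseteq> ht ` M" "annih cs u = 0\<^sub>v n" using wspan_annih[OF assms(1)] by blast
  have uc: "u \<in> carrier_vec n" using assms(1) by (rule wspan_carrier)
  have "ht \<mu> \<notin> set cs" using cs(1) assms(3) by force
  hence "(\<Prod>c\<leftarrow>cs. of_int (ht \<mu> - c) :: complex) \<noteq> 0"
    by (induction cs) auto
  moreover have "(\<Prod>c\<leftarrow>cs. of_int (ht \<mu> - c) :: complex) \<cdot>\<^sub>v u = 0\<^sub>v n"
    using cs(2) annih_weight[OF assms(2)] by simp
  ultimately show ?thesis
    using uc by (auto simp: vec_eq_iff)
qed

context
  fixes \<mu> v
  assumes hwv: "highest_weight_vector R \<mu> v"
begin

lemma hwv_weight: "v \<in> weight_space R \<mu>" and hwv_carrier: "v \<in> carrier_vec n" and hwv_nonzero: "v \<noteq> 0\<^sub>v n"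
  and hwv_E: "E1 v = 0\<^sub>v n" "E2 v = 0\<^sub>v n" "E3 v = 0\<^sub>v n"
proof -
  have E: "op (elem_mat i j) v = 0\<^sub>v n" if "j < 3" "i < j" for i j
    using hwv that by (simp add: highest_weight_vector_def op_def)
  show "E1 v = 0\<^sub>v n" "E2 v = 0\<^sub>v n" "E3 v = 0\<^sub>v n" by (rule E; simp)+
qed (use hwv in \<open>auto simp: highest_weight_vector_def weight_space_def\<close>)

text \<open>Lowering operators send \<open>v\<close> to strictly lower weights, so modulo those
  weights every element remains a multiple of \<open>v\<close>.\<close>

lemma cyc_decomposition:
  "u \<in> cyc R v \<Longrightarrow> \<exists>c. \<exists>w\<in>wspan R (below \<mu> - {\<mu>}). u = c \<cdot>\<^sub>v v + w"
proof (induction rule: cyc.induct)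
  case cyc_base
  show ?case
    by (rule exI[of _ 1], rule bexI[OF _ wspan_zero]) (use hwv_carrier in simp)
next
  case (cyc_add u u')
  then obtain c w c' w' where *: "u = c \<cdot>\<^sub>v v + w" "u' = c' \<cdot>\<^sub>v v + w'"
    "w \<in> wspan R (below \<mu> - {\<mu>})" "w' \<in> wspan R (below \<mu> - {\<mu>})" by blast
  have "u + u' = (c + c') \<cdot>\<^sub>v v + (w + w')"
    by (rule eq_vecI) (use * wspan_carrier[OF *(3)] wspan_carrier[OF *(4)] hwv_carrier in \<open>auto simp: algebra_simps\<close>)
  thus ?case using wspan_add[OF *(4,3)] by blast
next
  case (cyc_smult u c')
  then obtain c w where *: "u = c \<cdot>\<^sub>v v + w" "w \<in> wspan R (below \<mu> - {\<mu>})" by blast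
  have "c' \<cdot>\<^sub>v u = (c' * c) \<cdot>\<^sub>v v + c' \<cdot>\<^sub>v w"
    by (rule eq_vecI) (use * wspan_carrier[OF *(2)] hwv_carrier in \<open>auto simp: algebra_simps\<close>)
  thus ?case using wspan_smult[OF *(2)] by blast
next
  case (cyc_f1 u)
  then obtain c w where *: "u = c \<cdot>\<^sub>v v + w" "w \<in> wspan R (below \<mu> - {\<mu>})" by blast
  have F: "F1 w \<in> wspan R (below \<mu> - {\<mu>})" if "w \<in> wspan R (below \<mu>)" for w
    using that by (rule wspan_op) (simp, erule wspan_weight[OF weight_shift(3)], erule below_shift(1))
  have "c \<cdot>\<^sub>v F1 v + F1 w \<in> wspan R (below \<mu> - {\<mu>})"
    using F[OF wspan_weight[OF hwv_weight below_self]] F[OF wspan_mono[OF *(2)]]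
    by (intro wspan_add wspan_smult) auto
  moreover have "act R (elem_mat 1 0) *\<^sub>v u = 0 \<cdot>\<^sub>v v + (c \<cdot>\<^sub>v F1 v + F1 w)"
    using wspan_carrier[OF *(2)] hwv_carrier unfolding op_def[symmetric] *(1)
    by (intro eq_vecI) auto
  ultimately show ?case by blast
next
  case (cyc_f2 u)
  then obtain c w where *: "u = c \<cdot>\<^sub>v v + w" "w \<in> wspan R (below \<mu> - {\<mu>})" by blast
  have F: "F2 w \<in> wspan R (below \<mu> - {\<mu>})" if "w \<in> wspan R (below \<mu>)" for w
    using that by (rule wspan_op) (simp, erule wspan_weight[OF weight_shift(4)], erule below_shift(2))
  have "c \<cdot>\<^sub>v F2 v + F2 w \<in> wspan R (below \<mu> - {\<mu>})"
    using F[OF wspan_weight[OF hwv_weight below_self]] F[OF wspan_mono[OF *(2)]]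
    by (intro wspan_add wspan_smult) auto
  moreover have "act R (elem_mat 2 1) *\<^sub>v u = 0 \<cdot>\<^sub>v v + (c \<cdot>\<^sub>v F2 v + F2 w)"
    using wspan_carrier[OF *(2)] hwv_carrier unfolding op_def[symmetric] *(1)
    by (intro eq_vecI) auto
  ultimately show ?case by blast
qed

lemma cyc_wspan:
  assumes "u \<in> cyc R v"
  shows "u \<in> wspan R (below \<mu>)"
proof -
  obtain c w where *: "u = c \<cdot>\<^sub>v v + w" "w \<in> wspan R (below \<mu> - {\<mu>})"
    using cyc_decomposition[OF assms] by blast
  have "w \<in> wspan R (below \<mu>)" by (rule wspan_mono[OF *(2)]) auto
  thus ?thesis unfolding *(1)
    using wspan_smult[OF wspan_weight[OF hwv_weight below_self]] by (intro wspan_add)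
qed

lemma cyc_carrier: "u \<in> cyc R v \<Longrightarrow> u \<in> carrier_vec n"
  using cyc_wspan wspan_carrier by blast

text \<open>After subtracting its multiple of \<open>v\<close>, a vector of weight
  \<open>\<mu>\<close> is a sum of vectors of smaller height and must vanish. The top weight space
  of the submodule is thus a line.\<close>

lemma cyc_weight_space:
  assumes "u \<in> cyc R v" "u \<in> weight_space R \<mu>"
  shows "\<exists>c. u = c \<cdot>\<^sub>v v"
proof -
  obtain c w where *: "u = c \<cdot>\<^sub>v v + w" "w \<in> wspan R (below \<mu> - {\<mu>})"
    using cyc_decomposition[OF assms(1)] by blast
  note wc = wspan_carrier[OF *(2)] and uc = weight_space_carrier[OF assms(2)]
  have w: "w = u + (- c) \<cdot>\<^sub>v v"
    by (rule eq_vecI) (use * wc uc hwv_carrier in auto)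
  have "w \<in> weight_space R \<mu>"
    unfolding w using assms(2) hwv_weight uc hwv_carrier
    by (auto simp: weight_space_iff smult_add_distrib_vec[of _ n] smult_smult_assoc mult.commute)
  hence "w = 0\<^sub>v n"
    using below_ht by (intro wspan_weight_zero[OF *(2)]) fastforce+
  thus ?thesis using *(1) hwv_carrier by auto
qed

text \<open>By induction on the generation, a raising operator is commuted past one lowering
  operator. The correction is a coroot or zero, which is why stability under the coroots is
  established before the raising operators.\<close>

lemma cyc_invariant: "invariant_subspace R (cyc R v)"
proof (rule invariant_subspaceI[OF is_repn])
  note c = cyc_carrier
  have H1: "H1 u \<in> cyc R v" if "u \<in> cyc R v" for u
    using that
  proof (induction rule: cyc.induct)
    case cyc_base
    thus ?case using hwv_weight cyc.cyc_base[of v R] by (auto simp: weight_space_iff intro: cyc.cyc_smult)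
  next
    case (cyc_f1 u)
    have "H1 (F1 u) = F1 (H1 u) + (-2) \<cdot>\<^sub>v F1 u"
      using c[OF cyc_f1(1)] by (intro eq_vecI) (auto simp: commutation_FH)
    thus ?case using cyc_f1 unfolding op_def by (auto intro: cyc.intros[unfolded One_nat_def])
  next
    case (cyc_f2 u)
    have "H1 (F2 u) = F2 (H1 u) + 1 \<cdot>\<^sub>v F2 u"
      using c[OF cyc_f2(1)] by (intro eq_vecI) (auto simp: commutation_FH)
    thus ?case using cyc_f2 unfolding op_def by (auto intro: cyc.intros[unfolded One_nat_def])
  qed (use c in \<open>auto intro: cyc.intros[unfolded One_nat_def]\<close>)
  have H2: "H2 u \<in> cyc R v" if "u \<in> cyc R v" for u
    using that
  proof (induction rule: cyc.induct)
    case cyc_base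
    thus ?case using hwv_weight cyc.cyc_base[of v R] by (auto simp: weight_space_iff intro: cyc.cyc_smult)
  next
    case (cyc_f1 u)
    have "H2 (F1 u) = F1 (H2 u) + 1 \<cdot>\<^sub>v F1 u"
      using c[OF cyc_f1(1)] by (intro eq_vecI) (auto simp: commutation_FH)
    thus ?case using cyc_f1 unfolding op_def by (auto intro: cyc.intros[unfolded One_nat_def])
  next
    case (cyc_f2 u)
    have "H2 (F2 u) = F2 (H2 u) + (-2) \<cdot>\<^sub>v F2 u"
      using c[OF cyc_f2(1)] by (intro eq_vecI) (auto simp: commutation_FH)
    thus ?case using cyc_f2 unfolding op_def by (auto intro: cyc.intros[unfolded One_nat_def])
  qed (use c in \<open>auto intro: cyc.intros[unfolded One_nat_def]\<close>)
  have zero: "0\<^sub>v n \<in> cyc R v"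
  proof -
    have "0 \<cdot>\<^sub>v v = 0\<^sub>v n" using hwv_carrier by (intro eq_vecI) auto
    thus ?thesis using cyc_smult[OF cyc_base, of 0 v R] by simp
  qed
  show "act R (elem_mat 0 1) *\<^sub>v u \<in> cyc R v" if "u \<in> cyc R v" for u
    using that unfolding op_def[symmetric]
  proof (induction rule: cyc.induct)
    case cyc_base
    thus ?case using hwv_E zero by simp
  next
    case (cyc_f1 u)
    have "E1 (F1 u) = F1 (E1 u) + H1 u"
      using c[OF cyc_f1(1)] by (intro eq_vecI) (auto simp: commutation_FH)
    thus ?case using cyc_f1 H1[OF cyc_f1(1)] unfolding op_def by (auto intro: cyc.intros[unfolded One_nat_def])
  next
    case (cyc_f2 u)
    have "E1 (F2 u) = F2 (E1 u)"
      using c[OF cyc_f2(1)] by (intro eq_vecI) (auto simp: commutation_FH)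
    thus ?case using cyc_f2 unfolding op_def by (auto intro: cyc.intros[unfolded One_nat_def])
  qed (use c in \<open>auto intro: cyc.intros[unfolded One_nat_def]\<close>)
  show "act R (elem_mat 1 2) *\<^sub>v u \<in> cyc R v" if "u \<in> cyc R v" for u
    using that unfolding op_def[symmetric]
  proof (induction rule: cyc.induct)
    case cyc_base
    thus ?case using hwv_E zero by simp
  next
    case (cyc_f1 u)
    have "E2 (F1 u) = F1 (E2 u)"
      using c[OF cyc_f1(1)] by (intro eq_vecI) (auto simp: commutation_FH)
    thus ?case using cyc_f1 unfolding op_def by (auto intro: cyc.intros[unfolded One_nat_def])
  next
    case (cyc_f2 u)
    have "E2 (F2 u) = F2 (E2 u) + H2 u"
      using c[OF cyc_f2(1)] by (intro eq_vecI) (auto simp: commutation_FH)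
    thus ?case using cyc_f2 H2[OF cyc_f2(1)] unfolding op_def by (auto intro: cyc.intros[unfolded One_nat_def])
  qed (use c in \<open>auto intro: cyc.intros[unfolded One_nat_def]\<close>)
  show "0\<^sub>v n \<in> cyc R v" by (rule zero)
  show "cyc R v \<subseteq> carrier_vec n" using c by blast
qed (auto intro: cyc.intros[unfolded One_nat_def])

end

end

lemma highest_weight_vector_carrier: "highest_weight_vector R \<mu> v \<Longrightarrow> v \<in> carrier_vec (deg R)"
  by (auto simp: highest_weight_vector_def weight_space_def)

lemma irreducible_cyc:
  assumes "irreducible_repn R" "highest_weight_vector R \<mu> v"
  shows "cyc R v = carrier_vec (deg R)"
proof -
  interpret sl3_repn R by unfold_locales (use assms(1) in \<open>simp add: irreducible_repn_def\<close>)
  have "cyc R v \<noteq> {0\<^sub>v n}" using cyc_base[of v R] hwv_nonzero[OF assms(2)] by auto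
  thus ?thesis using cyc_invariant[OF assms(2)] assms(1) by (auto simp: irreducible_repn_def)
qed

section \<open>The Casimir operator\<close>

context sl3_repn
begin

text \<open>Three times the Casimir element of the trace form, so that its eigenvalues are integers.\<close>

definition cas :: "complex vec \<Rightarrow> complex vec" where
  "cas u = 2 \<cdot>\<^sub>v (H1 (H1 u) + H1 (H2 u) + H2 (H2 u)) +
     3 \<cdot>\<^sub>v (E1 (F1 u) + F1 (E1 u) + (E2 (F2 u) + F2 (E2 u)) + (E3 (F3 u) + F3 (E3 u)))"

lemma cas_add: "u \<in> carrier_vec n \<Longrightarrow> w \<in> carrier_vec n \<Longrightarrow> cas (u + w) = cas u + cas w"
  by (intro eq_vecI) (auto simp: cas_def algebra_simps)

lemma cas_smult: "u \<in> carrier_vec n \<Longrightarrow> cas (c \<cdot>\<^sub>v u) = c \<cdot>\<^sub>v cas u"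
  by (intro eq_vecI) (auto simp: cas_def algebra_simps)

text \<open>The rules are kept in two sets: the one for \<open>F1 (F2 v)\<close> and the one for
  \<open>F2 (F1 v)\<close> would rewrite each other forever.\<close>

lemmas commutation_F1 = commutation(1-7)[unfolded One_nat_def]
lemmas commutation_F2 = commutation(8-14)[unfolded One_nat_def]

text \<open>Commutation with the two simple lowering operators is all that is used, since
  \<open>cyc\<close> is generated from \<open>v\<close> by them.\<close>

lemma cas_F1: "u \<in> carrier_vec n \<Longrightarrow> cas (F1 u) = F1 (cas u)"
  by (intro eq_vecI) (auto simp: cas_def commutation_F1 algebra_simps)

lemma cas_F2: "u \<in> carrier_vec n \<Longrightarrow> cas (F2 u) = F2 (cas u)"
  by (intro eq_vecI) (auto simp: cas_def commutation_F2 algebra_simps)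

end

text \<open>Three times the product of \<mu> with \<mu> + 2\<rho>. For \<mu> = (a, b) the product of
  \<mu> with itself is two thirds of a^2 + ab + b^2, and that of \<mu> with \<rho> is a + b.\<close>

definition casimir_value :: "weight \<Rightarrow> int" where
  "casimir_value \<mu> = 2 * ((fst \<mu>)\<^sup>2 + fst \<mu> * snd \<mu> + (snd \<mu>)\<^sup>2) + 6 * (fst \<mu> + snd \<mu>)"

context sl3_repn
begin

lemma cas_highest_weight:
  assumes "highest_weight_vector R \<mu> v"
  shows "cas v = of_int (casimir_value \<mu>) \<cdot>\<^sub>v v"
proof -
  note v = hwv_carrier[OF assms] and E = hwv_E[OF assms]
  have H: "H1 v = of_int (fst \<mu>) \<cdot>\<^sub>v v" "H2 v = of_int (snd \<mu>) \<cdot>\<^sub>v v"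
    using hwv_weight[OF assms] by (auto simp: weight_space_iff)
  have add: "op (coroot 0 + coroot 1) v = H1 v + H2 v" using v by (simp add: op_mat_add)
  have swap: "x = y" if "0\<^sub>v n = x + (-1) \<cdot>\<^sub>v y" "x \<in> carrier_vec n" "y \<in> carrier_vec n" for x y :: "complex vec"
  proof (rule eq_vecI)
    fix i assume i: "i < dim_vec y"
    have "(0\<^sub>v n :: complex vec) $ i = (x + (-1) \<cdot>\<^sub>v y) $ i" using that(1) by simp
    hence "0 = x $ i - y $ i" using i that(2,3) by simp
    thus "x $ i = y $ i" by simp
  qed (use that in auto)
  have z: "F1 (0\<^sub>v n) = 0\<^sub>v n" "F2 (0\<^sub>v n) = 0\<^sub>v n" "F3 (0\<^sub>v n) = 0\<^sub>v n" by simp_all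
  \<comment> \<open>As the raising operators kill \<open>v\<close>, the commutator turns E F v into
    the coroot applied to \<open>v\<close>; the coroot of \<theta> is the sum of the simple
    ones.\<close>
  have 1: "E1 (F1 v) = H1 v"
    by (rule swap[OF trans[OF z(1)[symmetric] commutation(1)[OF v, unfolded E(1)]]]) (use v in simp_all)
  have 2: "E2 (F2 v) = H2 v"
    by (rule swap[OF trans[OF z(2)[symmetric] commutation(9)[OF v, unfolded E(2)]]]) (use v in simp_all)
  have 3: "E3 (F3 v) = H1 v + H2 v"
    using commutation(23)[OF v, unfolded E(3) z(3) add] v by simp
  show ?thesis
    unfolding cas_def 1 2 3 E
    by (intro eq_vecI) (use v in \<open>auto simp: H[unfolded One_nat_def] casimir_value_def power2_eq_square algebra_simps\<close>)
qed

lemma cas_cyc: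
  assumes "highest_weight_vector R \<mu> v" "u \<in> cyc R v"
  shows "cas u = of_int (casimir_value \<mu>) \<cdot>\<^sub>v u"
  using assms(2)
proof (induction rule: cyc.induct)
  case cyc_base
  show ?case by (rule cas_highest_weight[OF assms(1)])
next
  case (cyc_add u w)
  note c = cyc_carrier[OF assms(1) cyc_add(1)] cyc_carrier[OF assms(1) cyc_add(2)]
  show ?case using cyc_add c by (simp add: cas_add[OF c] smult_add_distrib_vec[OF c])
next
  case (cyc_smult u c)
  note cc = cyc_carrier[OF assms(1) cyc_smult(1)]
  show ?case using cyc_smult by (simp add: cas_smult[OF cc] smult_smult_assoc mult.commute)
next
  case (cyc_f1 u)
  note cc = cyc_carrier[OF assms(1) cyc_f1(1)]
  show ?case using cyc_f1 cc unfolding op_def[symmetric] cas_F1[OF cc] by simp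
next
  case (cyc_f2 u)
  note cc = cyc_carrier[OF assms(1) cyc_f2(1)]
  show ?case using cyc_f2 cc unfolding op_def[symmetric] cas_F2[OF cc] by simp
qed

end

section \<open>Uniqueness of the irreducible module of given highest weight\<close>

lemma linear_map_matrix:
  fixes \<phi> :: "complex vec \<Rightarrow> complex vec"
  assumes car: "\<And>u. u \<in> carrier_vec n \<Longrightarrow> \<phi> u \<in> carrier_vec m"
    and add: "\<And>u w. u \<in> carrier_vec n \<Longrightarrow> w \<in> carrier_vec n \<Longrightarrow> \<phi> (u + w) = \<phi> u + \<phi> w"
    and smult: "\<And>c u. u \<in> carrier_vec n \<Longrightarrow> \<phi> (c \<cdot>\<^sub>v u) = c \<cdot>\<^sub>v \<phi> u"
  shows "\<exists>P\<in>carrier_mat m n. \<forall>u\<in>carrier_vec n. P *\<^sub>v u = \<phi> u"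
proof (intro bexI ballI)
  define P where "P = mat m n (\<lambda>(i, j). \<phi> (unit_vec n j) $ i)"
  show P: "P \<in> carrier_mat m n" by (simp add: P_def)
  fix u :: "complex vec" assume u: "u \<in> carrier_vec n"
  have "\<phi> (vec n (\<lambda>i. if i < k then u $ i else 0)) = vec m (\<lambda>i. \<Sum>j<k. P $$ (i, j) * u $ j)" if "k \<le> n" for k
    using that
  proof (induction k)
    case 0
    have "vec n (\<lambda>i. if i < 0 then u $ i else 0) = 0 \<cdot>\<^sub>v u" using u by (intro eq_vecI) auto
    hence "\<phi> (vec n (\<lambda>i. if i < 0 then u $ i else 0)) = 0 \<cdot>\<^sub>v \<phi> u" using smult[OF u] by simp
    thus ?case using car[OF u] by (simp only:) (intro eq_vecI, auto)
  next
    case (Suc k)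
    have eq: "vec n (\<lambda>i. if i < Suc k then u $ i else 0) = vec n (\<lambda>i. if i < k then u $ i else 0) + u $ k \<cdot>\<^sub>v unit_vec n k"
      using Suc.prems by (intro eq_vecI) (auto simp: less_Suc_eq)
    have "\<phi> (vec n (\<lambda>i. if i < Suc k then u $ i else 0)) = \<phi> (vec n (\<lambda>i. if i < k then u $ i else 0)) + u $ k \<cdot>\<^sub>v \<phi> (unit_vec n k)"
      unfolding eq by (subst add) (auto simp: smult)
    also have "\<dots> = vec m (\<lambda>i. \<Sum>j<Suc k. P $$ (i, j) * u $ j)"
      using Suc car[OF unit_vec_carrier, of k] by (intro eq_vecI) (auto simp: P_def)
    finally show ?case .
  qed
  from this[of n] have "\<phi> (vec n (\<lambda>i. if i < n then u $ i else 0)) = vec m (\<lambda>i. \<Sum>j<n. P $$ (i, j) * u $ j)" by simp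
  moreover have "vec n (\<lambda>i. if i < n then u $ i else 0) = u" using u by (intro eq_vecI) auto
  moreover have "P *\<^sub>v u = vec m (\<lambda>i. \<Sum>j<n. P $$ (i, j) * u $ j)"
    using P u by (intro eq_vecI) (auto simp: scalar_prod_def lessThan_atLeast0 intro!: sum.cong)
  ultimately show "P *\<^sub>v u = \<phi> u" by simp
qed

text \<open>The submodule of the direct sum generated by the pair of highest weight vectors is the graph
  of an isomorphism.\<close>

lemma irreducible_highest_weight_unique:
  assumes iR: "irreducible_repn R" and iS: "irreducible_repn S"
    and v: "highest_weight_vector R \<mu> v" and s: "highest_weight_vector S \<mu> s"
  shows "iso_repn R S"
proof -
  have R: "is_repn R" and S: "is_repn S" using iR iS by (auto simp: irreducible_repn_def)
  let ?r = "deg R" and ?s = "deg S"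
  note vc = highest_weight_vector_carrier[OF v] and sc = highest_weight_vector_carrier[OF s]
  define M where "M = dsum R S"
  have M: "is_repn M" unfolding M_def by (rule is_repn_dsum[OF R S])
  have dM: "deg M = ?r + ?s" by (simp add: M_def)
  interpret M: sl3_repn M by unfold_locales (rule M)
  note arith = append_vec_arith[where a = "deg R" and b = "deg S"]
  have actM: "act M X *\<^sub>v (u @\<^sub>v t) = (act R X *\<^sub>v u) @\<^sub>v (act S X *\<^sub>v t)"
    if "X \<in> sl3" "u \<in> carrier_vec ?r" "t \<in> carrier_vec ?s" for X u t
    using that R S by (simp add: M_def act_dsum_append)
  have hM: "highest_weight_vector M \<mu> (v @\<^sub>v s)"
    unfolding highest_weight_vector_def
  proof (intro conjI allI impI)
    show "v @\<^sub>v s \<in> weight_space M \<mu>"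
      using v s vc sc arith(3)[OF vc vc sc sc] by (auto simp: highest_weight_vector_def weight_space_def dM actM coroot_sl3)
    show "v @\<^sub>v s \<noteq> 0\<^sub>v (deg M)"
      using v vc sc by (simp add: highest_weight_vector_def dM zero_vec_append append_vec_eq_iff[OF vc zero_carrier_vec])
    fix i j :: nat assume "j < 3" "i < j"
    thus "act M (elem_mat i j) *\<^sub>v (v @\<^sub>v s) = 0\<^sub>v (deg M)"
      using v s vc sc by (simp add: actM elem_mat_sl3 highest_weight_vector_def dM zero_vec_append)
  qed
  define G where "G u t \<longleftrightarrow> u \<in> carrier_vec ?r \<and> t \<in> carrier_vec ?s \<and> u @\<^sub>v t \<in> cyc M (v @\<^sub>v s)" for u t
  note inv = invariant_subspaceD[OF M.cyc_invariant[OF hM]]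
  have G0: "G (0\<^sub>v ?r) (0\<^sub>v ?s)" using inv(2) by (simp add: G_def dM zero_vec_append)
  have Gadd: "G (u + u') (t + t')" if "G u t" "G u' t'" for u t u' t'
    using that inv(3)[of "u @\<^sub>v t" "u' @\<^sub>v t'"] arith(1)[of u u' t t'] by (auto simp: G_def)
  have Gsmult: "G (c \<cdot>\<^sub>v u) (c \<cdot>\<^sub>v t)" if "G u t" for c u t
    using that inv(4)[of "u @\<^sub>v t" c] arith(3)[of u u t t c] by (auto simp: G_def)
  have Gact: "G (act R X *\<^sub>v u) (act S X *\<^sub>v t)" if "X \<in> sl3" "G u t" for X u t
    using that inv(5)[of X "u @\<^sub>v t"] R S by (auto simp: G_def actM)
  have Gvs: "G v s" using cyc_base[of "v @\<^sub>v s" M] vc sc by (simp add: G_def)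
  have Gmu: "\<exists>c. u = c \<cdot>\<^sub>v v \<and> t = c \<cdot>\<^sub>v s" if "G u t" "u \<in> weight_space R \<mu>" "t \<in> weight_space S \<mu>" for u t
  proof -
    have ut: "u \<in> carrier_vec ?r" "t \<in> carrier_vec ?s" "u @\<^sub>v t \<in> cyc M (v @\<^sub>v s)"
      using that by (auto simp: G_def)
    have "u @\<^sub>v t \<in> weight_space M \<mu>"
      using that ut arith(3)[OF ut(1,1) ut(2,2)] by (auto simp: weight_space_def dM actM coroot_sl3)
    then obtain c where "u @\<^sub>v t = c \<cdot>\<^sub>v (v @\<^sub>v s)"
      using M.cyc_weight_space[OF hM ut(3)] by blast
    hence "u @\<^sub>v t = (c \<cdot>\<^sub>v v) @\<^sub>v (c \<cdot>\<^sub>v s)" using arith(3)[OF vc vc sc sc] by simp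
    thus ?thesis using append_vec_eq_iff[of u ?r "c \<cdot>\<^sub>v v"] ut vc by auto
  qed
  have zR: "0\<^sub>v ?r \<in> weight_space R \<mu>" and zS: "0\<^sub>v ?s \<in> weight_space S \<mu>"
    using weight_space_subspace[OF R] weight_space_subspace[OF S] by (auto simp: subspace_iff)
  have vw: "v \<in> weight_space R \<mu>" "v \<noteq> 0\<^sub>v ?r" and sw: "s \<in> weight_space S \<mu>" "s \<noteq> 0\<^sub>v ?s"
    using v s by (auto simp: highest_weight_vector_def)
  have smult_zero: "c = 0" if "c \<cdot>\<^sub>v u = 0\<^sub>v k" "u \<in> carrier_vec k" "u \<noteq> 0\<^sub>v k" for c k and u :: "complex vec"
    using that by (auto simp: vec_eq_iff)
  have diff: "G (u - u') (t - t')" if "G u t" "G u' t'" for u t u' t'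
  proof -
    have "u + (-1) \<cdot>\<^sub>v u' = u - u'" "t + (-1) \<cdot>\<^sub>v t' = t - t'" using that by (auto simp: G_def intro!: eq_vecI)
    thus ?thesis using Gadd[OF that(1) Gsmult[OF that(2)], of "-1"] by simp
  qed
  have irr: "U = {0\<^sub>v (deg T)} \<or> U = carrier_vec (deg T)"
    if "irreducible_repn T" "U \<subseteq> carrier_vec (deg T)" "0\<^sub>v (deg T) \<in> U"
      "\<And>u v. u \<in> U \<Longrightarrow> v \<in> U \<Longrightarrow> u + v \<in> U" "\<And>c u. u \<in> U \<Longrightarrow> c \<cdot>\<^sub>v u \<in> U"
      "\<And>X u. X \<in> sl3 \<Longrightarrow> u \<in> U \<Longrightarrow> act T X *\<^sub>v u \<in> U" for T U
    using that by (auto simp: irreducible_repn_def invariant_subspace_def subspace_iff)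
  have Gc: "u \<in> carrier_vec ?r" "t \<in> carrier_vec ?s" if "G u t" for u t using that by (auto simp: G_def)
  have z: "act R X *\<^sub>v 0\<^sub>v ?r = 0\<^sub>v ?r" "act S X *\<^sub>v 0\<^sub>v ?s = 0\<^sub>v ?s" if "X \<in> sl3" for X
    using mult_mat_zero_vec is_repn_carrier R S that by blast+
  have z': "c \<cdot>\<^sub>v 0\<^sub>v k = (0\<^sub>v k :: complex vec)" for c k by (intro eq_vecI) auto
  have zz: "0\<^sub>v k + 0\<^sub>v k = (0\<^sub>v k :: complex vec)" for k by (intro eq_vecI) auto
  \<comment> \<open>The projections of the submodule to the two factors are invariant and contain
    \<open>v\<close> and \<open>s\<close>, so they are everything and \<open>G\<close> is total in
    both directions.\<close>
  have "{u. \<exists>t. G u t} = {0\<^sub>v ?r} \<or> {u. \<exists>t. G u t} = carrier_vec ?r"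
  proof (rule irr[OF iR])
    show "{u. \<exists>t. G u t} \<subseteq> carrier_vec ?r" using Gc(1) by auto
    show "0\<^sub>v ?r \<in> {u. \<exists>t. G u t}" using G0 by auto
    show "x + y \<in> {u. \<exists>t. G u t}" if "x \<in> {u. \<exists>t. G u t}" "y \<in> {u. \<exists>t. G u t}" for x y
    proof -
      from that obtain x' y' where "G x x'" "G y y'" by auto
      from Gadd[OF this] show ?thesis by auto
    qed
    show "c \<cdot>\<^sub>v x \<in> {u. \<exists>t. G u t}" if "x \<in> {u. \<exists>t. G u t}" for c x
    proof -
      from that obtain x' where "G x x'" by auto
      from Gsmult[OF this] show ?thesis by auto
    qed
    show "act R X *\<^sub>v x \<in> {u. \<exists>t. G u t}" if "X \<in> sl3" "x \<in> {u. \<exists>t. G u t}" for X x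
    proof -
      from that obtain x' where "G x x'" by auto
      from Gact[OF that(1) this] show ?thesis by auto
    qed
  qed
  hence exR: "\<exists>t. G u t" if "u \<in> carrier_vec ?r" for u using Gvs vw(2) that by blast
  have "{t. \<exists>u. G u t} = {0\<^sub>v ?s} \<or> {t. \<exists>u. G u t} = carrier_vec ?s"
  proof (rule irr[OF iS])
    show "{t. \<exists>u. G u t} \<subseteq> carrier_vec ?s" using Gc(2) by auto
    show "0\<^sub>v ?s \<in> {t. \<exists>u. G u t}" using G0 by auto
    show "x + y \<in> {t. \<exists>u. G u t}" if "x \<in> {t. \<exists>u. G u t}" "y \<in> {t. \<exists>u. G u t}" for x y
    proof -
      from that obtain x' y' where "G x' x" "G y' y" by auto
      from Gadd[OF this] show ?thesis by auto
    qed
    show "c \<cdot>\<^sub>v x \<in> {t. \<exists>u. G u t}" if "x \<in> {t. \<exists>u. G u t}" for c x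
    proof -
      from that obtain x' where "G x' x" by auto
      from Gsmult[OF this] show ?thesis by auto
    qed
    show "act S X *\<^sub>v x \<in> {t. \<exists>u. G u t}" if "X \<in> sl3" "x \<in> {t. \<exists>u. G u t}" for X x
    proof -
      from that obtain x' where "G x' x" by auto
      from Gact[OF that(1) this] show ?thesis by auto
    qed
  qed
  hence exS: "\<exists>u. G u t" if "t \<in> carrier_vec ?s" for t using Gvs sw(2) that by blast
  \<comment> \<open>The fibre over zero is invariant. If it were everything it would contain
    \<open>s\<close>, and the pair of zero and \<open>s\<close> would be a vector of weight
    \<open>\<mu>\<close> that is no multiple of the generator, against
    \<open>cyc_weight_space\<close>. The other fibre is treated alike.\<close>
  have "{t. G (0\<^sub>v ?r) t} = {0\<^sub>v ?s} \<or> {t. G (0\<^sub>v ?r) t} = carrier_vec ?s"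
  proof (rule irr[OF iS])
    show "u + v \<in> {t. G (0\<^sub>v ?r) t}" if "u \<in> {t. G (0\<^sub>v ?r) t}" "v \<in> {t. G (0\<^sub>v ?r) t}" for u v
      using Gadd[of "0\<^sub>v ?r" u "0\<^sub>v ?r" v] that zz by simp
    show "c \<cdot>\<^sub>v u \<in> {t. G (0\<^sub>v ?r) t}" if "u \<in> {t. G (0\<^sub>v ?r) t}" for c u
      using Gsmult[of "0\<^sub>v ?r" u c] that z' by simp
    show "act S X *\<^sub>v u \<in> {t. G (0\<^sub>v ?r) t}" if "X \<in> sl3" "u \<in> {t. G (0\<^sub>v ?r) t}" for X u
      using Gact[OF that(1), of "0\<^sub>v ?r" u] that z by simp
  qed (use Gc G0 in auto)
  moreover have "\<not> G (0\<^sub>v ?r) s"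
  proof
    assume "G (0\<^sub>v ?r) s"
    then obtain c where c: "0\<^sub>v ?r = c \<cdot>\<^sub>v v" "s = c \<cdot>\<^sub>v s" using Gmu zR sw by blast
    hence "c = 0" using smult_zero[OF c(1)[symmetric] vc vw(2)] by simp
    hence "s = 0 \<cdot>\<^sub>v s" using c(2) by simp
    moreover have "0 \<cdot>\<^sub>v s = 0\<^sub>v ?s" using sc by (intro eq_vecI) auto
    ultimately show False using sw(2) by metis
  qed
  ultimately have "{t. G (0\<^sub>v ?r) t} = {0\<^sub>v ?s}" using sc by blast
  hence uniqS: "t = t'" if "G u t" "G u t'" for u t t'
  proof -
    assume *: "{t. G (0\<^sub>v ?r) t} = {0\<^sub>v ?s}"
    have "u - u = 0\<^sub>v ?r" using Gc(1)[OF that(1)] by (intro eq_vecI) auto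
    hence "t - t' = 0\<^sub>v ?s" using diff[OF that] * by auto
    thus "t = t'" using minus_vec_eq_zero Gc that by blast
  qed
  have "{u. G u (0\<^sub>v ?s)} = {0\<^sub>v ?r} \<or> {u. G u (0\<^sub>v ?s)} = carrier_vec ?r"
  proof (rule irr[OF iR])
    show "u + v \<in> {t. G t (0\<^sub>v ?s)}" if "u \<in> {t. G t (0\<^sub>v ?s)}" "v \<in> {t. G t (0\<^sub>v ?s)}" for u v
      using Gadd[of u "0\<^sub>v ?s" v "0\<^sub>v ?s"] that zz by simp
    show "c \<cdot>\<^sub>v u \<in> {t. G t (0\<^sub>v ?s)}" if "u \<in> {t. G t (0\<^sub>v ?s)}" for c u
      using Gsmult[of u "0\<^sub>v ?s" c] that z' by simp
    show "act R X *\<^sub>v u \<in> {t. G t (0\<^sub>v ?s)}" if "X \<in> sl3" "u \<in> {t. G t (0\<^sub>v ?s)}" for X u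
      using Gact[OF that(1), of u "0\<^sub>v ?s"] that z by simp
  qed (use Gc G0 in auto)
  moreover have "\<not> G v (0\<^sub>v ?s)"
  proof
    assume "G v (0\<^sub>v ?s)"
    then obtain c where c: "v = c \<cdot>\<^sub>v v" "0\<^sub>v ?s = c \<cdot>\<^sub>v s" using Gmu zS vw by blast
    hence "c = 0" using smult_zero[OF c(2)[symmetric] sc sw(2)] by simp
    hence "v = 0 \<cdot>\<^sub>v v" using c(1) by simp
    moreover have "0 \<cdot>\<^sub>v v = 0\<^sub>v ?r" using vc by (intro eq_vecI) auto
    ultimately show False using vw(2) by metis
  qed
  ultimately have "{u. G u (0\<^sub>v ?s)} = {0\<^sub>v ?r}" using vc by blast
  hence uniqR: "u = u'" if "G u t" "G u' t" for u u' t
  proof -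
    assume *: "{u. G u (0\<^sub>v ?s)} = {0\<^sub>v ?r}"
    have "t - t = 0\<^sub>v ?s" using Gc(2)[OF that(1)] by (intro eq_vecI) auto
    hence "u - u' = 0\<^sub>v ?r" using diff[OF that] * by auto
    thus "u = u'" using minus_vec_eq_zero Gc that by blast
  qed
  define \<phi> where "\<phi> u = (THE t. G u t)" for u
  define \<psi> where "\<psi> t = (THE u. G u t)" for t
  have \<phi>: "\<phi> u = t" if "G u t" for u t unfolding \<phi>_def using that uniqS by blast
  have \<psi>: "\<psi> t = u" if "G u t" for u t unfolding \<psi>_def using that uniqR by blast
  have \<phi>G: "G u (\<phi> u)" if "u \<in> carrier_vec ?r" for u using exR[OF that] \<phi> by blast
  have \<psi>G: "G (\<psi> t) t" if "t \<in> carrier_vec ?s" for t using exS[OF that] \<psi> by blast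
  have "\<exists>P\<in>carrier_mat ?s ?r. \<forall>u\<in>carrier_vec ?r. P *\<^sub>v u = \<phi> u"
  proof (rule linear_map_matrix)
    fix u w :: "complex vec" assume u: "u \<in> carrier_vec ?r" and w: "w \<in> carrier_vec ?r"
    show "\<phi> (u + w) = \<phi> u + \<phi> w" by (rule \<phi>[OF Gadd[OF \<phi>G[OF u] \<phi>G[OF w]]])
  next
    fix u :: "complex vec" and c assume u: "u \<in> carrier_vec ?r"
    show "\<phi> u \<in> carrier_vec ?s" by (rule Gc(2)[OF \<phi>G[OF u]])
    show "\<phi> (c \<cdot>\<^sub>v u) = c \<cdot>\<^sub>v \<phi> u" by (rule \<phi>[OF Gsmult[OF \<phi>G[OF u]]])
  qed
  then obtain P where P: "P \<in> carrier_mat ?s ?r" "\<And>u. u \<in> carrier_vec ?r \<Longrightarrow> P *\<^sub>v u = \<phi> u" by blast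
  have "\<exists>Q\<in>carrier_mat ?r ?s. \<forall>u\<in>carrier_vec ?s. Q *\<^sub>v u = \<psi> u"
  proof (rule linear_map_matrix)
    fix u w :: "complex vec" assume u: "u \<in> carrier_vec ?s" and w: "w \<in> carrier_vec ?s"
    show "\<psi> (u + w) = \<psi> u + \<psi> w" by (rule \<psi>[OF Gadd[OF \<psi>G[OF u] \<psi>G[OF w]]])
  next
    fix u :: "complex vec" and c assume u: "u \<in> carrier_vec ?s"
    show "\<psi> u \<in> carrier_vec ?r" by (rule Gc(1)[OF \<psi>G[OF u]])
    show "\<psi> (c \<cdot>\<^sub>v u) = c \<cdot>\<^sub>v \<psi> u" by (rule \<psi>[OF Gsmult[OF \<psi>G[OF u]]])
  qed
  then obtain Q where Q: "Q \<in> carrier_mat ?r ?s" "\<And>t. t \<in> carrier_vec ?s \<Longrightarrow> Q *\<^sub>v t = \<psi> t" by blast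
  have "intertwines R S P"
    unfolding intertwines_def
  proof (intro conjI ballI P)
    fix X and u :: "complex vec" assume X: "X \<in> sl3" and u: "u \<in> carrier_vec ?r"
    show "P *\<^sub>v (act R X *\<^sub>v u) = act S X *\<^sub>v (P *\<^sub>v u)"
      using \<phi>[OF Gact[OF X \<phi>G[OF u]]] u X R by (simp add: P)
  qed
  moreover have "intertwines S R Q"
    unfolding intertwines_def
  proof (intro conjI ballI Q)
    fix X and t :: "complex vec" assume X: "X \<in> sl3" and t: "t \<in> carrier_vec ?s"
    show "Q *\<^sub>v (act S X *\<^sub>v t) = act R X *\<^sub>v (Q *\<^sub>v t)"
      using \<psi>[OF Gact[OF X \<psi>G[OF t]]] t X S by (simp add: Q)
  qed
  moreover have "Q *\<^sub>v (P *\<^sub>v u) = u" if "u \<in> carrier_vec ?r" for u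
    using \<psi>[OF \<phi>G[OF that]] Gc(2)[OF \<phi>G[OF that]] that by (simp add: P Q)
  moreover have "P *\<^sub>v (Q *\<^sub>v t) = t" if "t \<in> carrier_vec ?s" for t
    using \<phi>[OF \<psi>G[OF that]] Gc(1)[OF \<psi>G[OF that]] that by (simp add: P Q)
  ultimately show ?thesis by (subst iso_repn_iff[OF R S]) blast
qed

text \<open>The coroots act by Hermitian matrices, so weight spaces are orthogonal. A maximal
  orthonormal family of weight vectors therefore fixes every weight vector, and these span an
  irreducible highest weight module; in the resulting basis the coroots are diagonal.\<close>

lemma unitary_irreducible_has_weights:
  assumes u: "unitary_repn R" and ir: "irreducible_repn R" and v: "highest_weight_vector R \<mu> v"
  shows "\<exists>ws. has_weights R ws"
proof -
  have R: "is_repn R" using u by (simp add: unitary_repn_def)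
  interpret sl3_repn R by unfold_locales (rule R)
  define G where "G = (\<Union>\<kappa>. weight_space R \<kappa>)"
  have adjc: "adj (coroot i) = coroot i" for i
    by (intro eq_matI) (auto simp: coroot_index)
  have herm: "(\<Sum>i<n. cnj (op X w $ i) * z $ i) = (\<Sum>i<n. cnj (w $ i) * op X z $ i)"
    if X: "X \<in> sl3" "adj X = X" and w: "w \<in> carrier_vec n" and z: "z \<in> carrier_vec n" for X w z
  proof -
    note A = act_carrier[OF X(1)]
    have A': "cnj (act R X $$ (i, j)) = act R X $$ (j, i)" if "i < n" "j < n" for i j
    proof -
      have "act R (adj X) = adj (act R X)" using u X(1) unfolding unitary_repn_def by blast
      hence "act R X = adj (act R X)" unfolding X(2) .
      hence "act R X $$ (j, i) = adj (act R X) $$ (j, i)" by simp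
      thus ?thesis using that A by simp
    qed
    have opi: "op X y $ i = (\<Sum>j<n. act R X $$ (i, j) * y $ j)" if "i < n" "y \<in> carrier_vec n" for i y
      using A that by (auto simp: op_def scalar_prod_def lessThan_atLeast0 intro!: sum.cong)
    have "(\<Sum>i<n. cnj (op X w $ i) * z $ i) = (\<Sum>i<n. \<Sum>j<n. act R X $$ (j, i) * cnj (w $ j) * z $ i)"
      using w by (auto simp: opi A' sum_distrib_right intro!: sum.cong)
    also have "\<dots> = (\<Sum>j<n. \<Sum>i<n. act R X $$ (j, i) * cnj (w $ j) * z $ i)" by (rule sum.swap)
    also have "\<dots> = (\<Sum>j<n. cnj (w $ j) * op X z $ j)"
      using z by (auto simp: opi sum_distrib_left ac_simps intro!: sum.cong)
    finally show ?thesis .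
  qed
  have orth: "(\<Sum>i<n. cnj (w $ i) * z $ i) = 0"
    if w: "w \<in> weight_space R \<kappa>" and z: "z \<in> weight_space R \<kappa>'" and "\<kappa> \<noteq> \<kappa>'" for w z \<kappa> \<kappa>'
  proof -
    have *: "a = b \<or> (\<Sum>i<n. cnj (w $ i) * z $ i) = 0"
      if "X \<in> sl3" "adj X = X" "op X w = of_int a \<cdot>\<^sub>v w" "op X z = of_int b \<cdot>\<^sub>v z" for X a b
    proof -
      have "of_int a * (\<Sum>i<n. cnj (w $ i) * z $ i) = of_int b * (\<Sum>i<n. cnj (w $ i) * z $ i)"
        using herm[OF that(1,2) weight_space_carrier[OF w] weight_space_carrier[OF z]] that(3,4)
          weight_space_carrier[OF w] weight_space_carrier[OF z]
        by (simp add: sum_distrib_left ac_simps)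
      thus ?thesis by auto
    qed
    show ?thesis
      using *[OF coroot_sl3 adjc, of 0 "fst \<kappa>" "fst \<kappa>'"] *[OF coroot_sl3 adjc, of 1 "snd \<kappa>" "snd \<kappa>'"] w z that(3)
      by (auto simp: weight_space_iff prod_eq_iff)
  qed
  have W: "0\<^sub>v n \<in> weight_space R \<kappa>" "\<And>u v. u \<in> weight_space R \<kappa> \<Longrightarrow> v \<in> weight_space R \<kappa> \<Longrightarrow> u + v \<in> weight_space R \<kappa>"
    "\<And>c u. u \<in> weight_space R \<kappa> \<Longrightarrow> c \<cdot>\<^sub>v u \<in> weight_space R \<kappa>" for \<kappa>
    using weight_space_subspace[OF R] by (auto simp: subspace_iff)
  have "\<exists>r J. J \<in> carrier_mat n r \<and> adj J * J = 1\<^sub>m r \<and> (\<forall>k<r. col J k \<in> G) \<and> (\<forall>u\<in>G. J *\<^sub>v (adj J *\<^sub>v u) = u)"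
  proof (rule orthonormal_family_exists)
    show "G \<subseteq> carrier_vec n" by (auto simp: G_def weight_space_carrier)
    show "c \<cdot>\<^sub>v u \<in> G" if "u \<in> G" for c u using that W(3) unfolding G_def by blast
    fix J r z assume J: "J \<in> carrier_mat n r" and col: "\<And>k. k < r \<Longrightarrow> col J k \<in> G" and "z \<in> G"
    then obtain \<kappa> where z: "z \<in> weight_space R \<kappa>" by (auto simp: G_def)
    note zc = weight_space_carrier[OF z]
    \<comment> \<open>A column whose weight differs from that of \<open>z\<close> is orthogonal to
      \<open>z\<close>, so the projection of \<open>z\<close> uses only columns in its own weight
      space.\<close>
    have Jz: "J *\<^sub>v (adj J *\<^sub>v z) \<in> weight_space R \<kappa>"
    proof (rule mult_vec_in_subspace[OF J])
      show "adj J *\<^sub>v z \<in> carrier_vec r" using adj_carrier[OF J] zc by auto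
      fix k assume k: "k < r" and nz: "(adj J *\<^sub>v z) $ k \<noteq> 0"
      obtain \<kappa>' where \<kappa>': "col J k \<in> weight_space R \<kappa>'" using col[OF k] by (auto simp: G_def)
      have "(\<Sum>i<n. cnj (col J k $ i) * z $ i) \<noteq> 0"
        using nz J k by (simp add: adj_mult_vec_index[OF J zc k])
      hence "\<kappa>' = \<kappa>" using orth[OF \<kappa>' z] by blast
      thus "col J k \<in> weight_space R \<kappa>" using \<kappa>' by simp
    qed (use W in auto)
    have "z - J *\<^sub>v (adj J *\<^sub>v z) = z + (-1) \<cdot>\<^sub>v (J *\<^sub>v (adj J *\<^sub>v z))"
      using zc J by (intro eq_vecI) auto
    thus "z - J *\<^sub>v (adj J *\<^sub>v z) \<in> G"
      using W(2)[OF z W(3)[OF Jz], of "-1"] unfolding G_def by (simp only:) (rule UN_I[OF UNIV_I])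
  qed
  then obtain r J where J: "J \<in> carrier_mat n r" and JJ: "adj J * J = 1\<^sub>m r" and col: "\<And>k. k < r \<Longrightarrow> col J k \<in> G"
    and fix_G: "\<And>u. u \<in> G \<Longrightarrow> J *\<^sub>v (adj J *\<^sub>v u) = u" by blast
  note aJ = adj_carrier[OF J]
  have LJ: "adj J *\<^sub>v (J *\<^sub>v x) = x" if "x \<in> carrier_vec r" for x
    using one_mat_iff[OF aJ J] JJ that by blast
  have JL: "J *\<^sub>v (adj J *\<^sub>v z) = z" if z: "z \<in> carrier_vec n" for z
  proof -
    \<comment> \<open>Irreducibility enters here: the module is generated by \<open>v\<close> and
      hence consists of sums of weight vectors.\<close>
    have "z \<in> wspan R (below \<mu>)"
      using irreducible_cyc[OF ir v] cyc_wspan[OF v] z by auto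
    thus ?thesis
    proof (induction rule: wspan.induct)
      case wspan_zero
      thus ?case by (simp add: mult_mat_zero_vec[OF aJ] mult_mat_zero_vec[OF J])
    next
      case (wspan_step z w \<kappa>)
      have wc: "w \<in> carrier_vec n" and zc: "z \<in> carrier_vec n"
        using weight_space_carrier[OF wspan_step(2)] wspan_carrier[OF wspan_step(1)] by auto
      have "w \<in> G" using wspan_step(2) unfolding G_def by blast
      moreover have "adj J *\<^sub>v z \<in> carrier_vec r" "adj J *\<^sub>v w \<in> carrier_vec r" using aJ zc wc by auto
      ultimately show ?case
        using fix_G[of w] wspan_step(4)
        by (simp add: mult_add_distrib_mat_vec[OF aJ zc wc] mult_add_distrib_mat_vec[OF J])
    qed
  qed
  define D where "D = compress (adj J) J R"
  have D: "unitary_repn D" "intertwines D R J" "intertwines R D (adj J)" "deg D = r"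
  proof -
    have "J *\<^sub>v (adj J *\<^sub>v (act R X *\<^sub>v (J *\<^sub>v x))) = act R X *\<^sub>v (J *\<^sub>v x)"
      if "X \<in> sl3" "x \<in> carrier_vec r" for X x
      by (rule JL) (use op_carrier[OF that(1), unfolded op_def] J that(2) in simp)
    from unitary_compress[OF u J JJ this] show "unitary_repn D" "intertwines D R J" "intertwines R D (adj J)" "deg D = r"
      unfolding D_def by blast+
  qed
  have rD: "is_repn D" using D(1) by (simp add: unitary_repn_def)
  have iso: "iso_repn R D"
    unfolding iso_repn_iff[OF R rD]
    by (rule exI[of _ "adj J"], rule exI[of _ J]) (simp add: D JL LJ)
  have "\<forall>k. \<exists>\<kappa>. k < r \<longrightarrow> col J k \<in> weight_space R \<kappa>"
    using col unfolding G_def by blast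
  then obtain \<kappa> where \<kappa>: "\<And>k. k < r \<Longrightarrow> col J k \<in> weight_space R (\<kappa> k)"
    using choice[of "\<lambda>k \<kappa>. k < r \<longrightarrow> col J k \<in> weight_space R \<kappa>"] by blast
  define ws where "ws = map \<kappa> [0..<r]"
  have len: "length ws = r" by (simp add: ws_def)
  have diag: "act D X = weight_diag f ws"
    if X: "X \<in> sl3" and f: "\<And>\<kappa> w. w \<in> weight_space R \<kappa> \<Longrightarrow> act R X *\<^sub>v w = of_int (f \<kappa>) \<cdot>\<^sub>v w" for X f
  proof (rule eq_matI)
    fix i k assume "i < dim_row (weight_diag f ws)" "k < dim_col (weight_diag f ws)"
    hence ik: "i < r" "k < r" by (simp_all add: weight_diag_def len)
    have A: "act D X \<in> carrier_mat r r" using is_repn_carrier[OF rD X] D(4) by simp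
    have c: "J *\<^sub>v unit_vec r k = col J k" using J ik by (intro eq_vecI) auto
    have "adj J *\<^sub>v col J k = unit_vec r k" using LJ[of "unit_vec r k"] c by simp
    hence "act D X *\<^sub>v unit_vec r k = adj J *\<^sub>v (act R X *\<^sub>v col J k)"
      using intertwinesD(2)[OF D(3) X weight_space_carrier[OF \<kappa>[OF ik(2)]]] by simp
    also have "\<dots> = of_int (f (\<kappa> k)) \<cdot>\<^sub>v (adj J *\<^sub>v col J k)"
      using f[OF \<kappa>[OF ik(2)]] weight_space_carrier[OF \<kappa>[OF ik(2)]] by (simp add: mult_mat_vec[OF aJ])
    also have "adj J *\<^sub>v col J k = unit_vec r k" by fact
    finally have "(act D X *\<^sub>v unit_vec r k) $ i = (of_int (f (\<kappa> k)) \<cdot>\<^sub>v unit_vec r k) $ i" by simp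
    thus "act D X $$ (i, k) = weight_diag f ws $$ (i, k)"
      using A ik by (simp add: weight_diag_def ws_def)
  qed (use is_repn_carrier[OF rD X] D(4) len in \<open>auto simp: weight_diag_def\<close>)
  have "diag_repn D ws"
    unfolding diag_repn_def
    using rD D(4) len diag[OF coroot_sl3, of 0 fst] diag[OF coroot_sl3, of 1 snd]
    by (auto simp: weight_space_def)
  thus ?thesis using iso by (auto simp: has_weights_def)
qed

lemma irreducible_iso:
  assumes R: "irreducible_repn R" and S: "is_repn S" and iso: "iso_repn R S"
  shows "irreducible_repn S"
proof -
  have rR: "is_repn R" using R by (simp add: irreducible_repn_def)
  from iso obtain P Q where P: "intertwines R S P" "intertwines S R Q"
    "\<And>v. v\<in>carrier_vec (deg R) \<Longrightarrow> Q *\<^sub>v (P *\<^sub>v v) = v"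
    "\<And>v. v\<in>carrier_vec (deg S) \<Longrightarrow> P *\<^sub>v (Q *\<^sub>v v) = v" by (auto simp: iso_repn_iff rR S)
  note Pc = intertwinesD[OF P(1)] and Qc = intertwinesD[OF P(2)]
  have "U = {0\<^sub>v (deg S)} \<or> U = carrier_vec (deg S)" if U: "invariant_subspace S U" for U
  proof -
    note i = invariant_subspaceD[OF U]
    define V where "V = {v \<in> carrier_vec (deg R). P *\<^sub>v v \<in> U}"
    have "invariant_subspace R V"
      unfolding invariant_subspace_def subspace_iff
      using i rR Pc mult_mat_zero_vec[OF Pc(1)]
      by (auto simp: V_def mult_add_distrib_mat_vec[OF Pc(1)] mult_mat_vec[OF Pc(1)])
    hence "V = {0\<^sub>v (deg R)} \<or> V = carrier_vec (deg R)" using R by (auto simp: irreducible_repn_def)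
    moreover have UV: "Q *\<^sub>v u \<in> V" if "u \<in> U" for u
    proof -
      have "u \<in> carrier_vec (deg S)" using i(1) that by blast
      thus ?thesis using P(4)[of u] Qc(3)[of u] that by (simp add: V_def)
    qed
    moreover have "U = {0\<^sub>v (deg S)}" if "V = {0\<^sub>v (deg R)}"
    proof -
      have "u = 0\<^sub>v (deg S)" if "u \<in> U" for u
      proof -
        have u: "u \<in> carrier_vec (deg S)" using i(1) that by blast
        have "Q *\<^sub>v u = 0\<^sub>v (deg R)" using UV[OF that] \<open>V = {0\<^sub>v (deg R)}\<close> by blast
        thus ?thesis using P(4)[OF u] mult_mat_zero_vec[OF Pc(1)] by simp
      qed
      thus ?thesis using i(2) by blast
    qed
    moreover have "U = carrier_vec (deg S)" if "V = carrier_vec (deg R)"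
    proof -
      have "u \<in> U" if "u \<in> carrier_vec (deg S)" for u
      proof -
        have "Q *\<^sub>v u \<in> V" using \<open>V = carrier_vec (deg R)\<close> Qc(3)[OF that] by simp
        thus ?thesis using P(4)[OF that] by (simp add: V_def)
      qed
      thus ?thesis using i(1) by blast
    qed
    ultimately show ?thesis by blast
  qed
  moreover have "deg S > 0" using R iso by (auto simp: irreducible_repn_def iso_repn_def)
  ultimately show ?thesis using S by (auto simp: irreducible_repn_def)
qed

lemma highest_weight_vector_iso:
  assumes R: "is_repn R" and S: "is_repn S" and iso: "iso_repn R S" and v: "highest_weight_vector R \<mu> v"
  shows "\<exists>w. highest_weight_vector S \<mu> w"
proof -
  from iso obtain P Q where P: "intertwines R S P" "intertwines S R Q"
    "\<And>v. v\<in>carrier_vec (deg R) \<Longrightarrow> Q *\<^sub>v (P *\<^sub>v v) = v" by (auto simp: iso_repn_iff R S)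
  have "P *\<^sub>v v \<noteq> 0\<^sub>v (deg S)"
  proof
    assume "P *\<^sub>v v = 0\<^sub>v (deg S)"
    hence "v = 0\<^sub>v (deg R)"
      using P(3)[OF highest_weight_vector_carrier[OF v]] mult_mat_zero_vec[OF intertwinesD(1)[OF P(2)]] by simp
    thus False using v by (simp add: highest_weight_vector_def)
  qed
  thus ?thesis using intertwines_highest_weight_vector[OF R P(1) v] by blast
qed

text \<open>\<open>R\<close> need not be unitary itself; it is isomorphic to a unitary module of the
  same highest weight and inherits the diagonal coordinates.\<close>

lemma irreducible_diag_model:
  assumes "irreducible_of_highest_weight R \<mu>" "\<mu> \<in> dominant"
  shows "\<exists>D ws. diag_repn D ws \<and> iso_repn R D \<and> irreducible_of_highest_weight D \<mu>"
proof -
  obtain S where S: "unitary_repn S" "irreducible_of_highest_weight S \<mu>"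
    using unitary_irreducible_exists[OF assms(2)] by blast
  obtain s where s: "highest_weight_vector S \<mu> s" "irreducible_repn S" "is_repn S"
    using S(2) by (auto simp: irreducible_of_highest_weight_iff irreducible_repn_def)
  obtain v where v: "highest_weight_vector R \<mu> v" "irreducible_repn R" "is_repn R"
    using assms(1) by (auto simp: irreducible_of_highest_weight_iff irreducible_repn_def)
  obtain ws D where D: "diag_repn D ws" "iso_repn S D"
    using unitary_irreducible_has_weights[OF S(1) s(2,1)] by (auto simp: has_weights_def)
  have rD: "is_repn D" using D by (simp add: diag_repn_def)
  have iso: "iso_repn R D"
    using iso_repn_trans[OF v(3) s(3) rD irreducible_highest_weight_unique[OF v(2) s(2) v(1) s(1)] D(2)] .
  have "irreducible_of_highest_weight D \<mu>"
    using irreducible_iso[OF v(2) rD iso] highest_weight_vector_iso[OF v(3) rD iso v(1)]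
    by (simp add: irreducible_of_highest_weight_iff)
  thus ?thesis using D(1) iso by blast
qed

subsection \<open>Weyl invariance of weight multiplicities\<close>

text \<open>Abstracted from \<open>sl3_repn\<close> so that it can be used four times: for both
  simple roots, and for each of them with raising and lowering exchanged.\<close>

locale sl2_action =
  fixes n :: nat and E F :: "complex vec \<Rightarrow> complex vec" and W :: "int \<Rightarrow> complex vec set"
  assumes W_carrier: "v \<in> W m \<Longrightarrow> v \<in> carrier_vec n"
    and E_carrier: "v \<in> carrier_vec n \<Longrightarrow> E v \<in> carrier_vec n"
    and F_carrier: "v \<in> carrier_vec n \<Longrightarrow> F v \<in> carrier_vec n"
    and E_zero: "E (0\<^sub>v n) = 0\<^sub>v n"
    and F_add: "u \<in> carrier_vec n \<Longrightarrow> v \<in> carrier_vec n \<Longrightarrow> F (u + v) = F u + F v"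
    and F_smult: "v \<in> carrier_vec n \<Longrightarrow> F (c \<cdot>\<^sub>v v) = c \<cdot>\<^sub>v F v"
    and E_W: "v \<in> W m \<Longrightarrow> E v \<in> W (m + 2)"
    and F_W: "v \<in> W m \<Longrightarrow> F v \<in> W (m - 2)"
    and EF: "v \<in> W m \<Longrightarrow> E (F v) = F (E v) + of_int m \<cdot>\<^sub>v v"
begin

lemma F_zero: "F (0\<^sub>v n) = 0\<^sub>v n"
proof -
  have "0\<^sub>v n = 0 \<cdot>\<^sub>v (0\<^sub>v n :: complex vec)" by (intro eq_vecI) auto
  hence "F (0\<^sub>v n) = 0 \<cdot>\<^sub>v F (0\<^sub>v n)" by (metis F_smult zero_carrier_vec)
  also have "\<dots> = 0\<^sub>v n" using F_carrier[OF zero_carrier_vec] by (intro eq_vecI) auto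
  finally show ?thesis .
qed

lemma F_power_zero: "(F ^^ j) (0\<^sub>v n) = 0\<^sub>v n"
  by (induction j) (auto simp: F_zero)

lemma F_power_carrier: "v \<in> carrier_vec n \<Longrightarrow> (F ^^ j) v \<in> carrier_vec n"
  by (induction j) (auto simp: F_carrier)

lemma F_power_W: "v \<in> W m \<Longrightarrow> (F ^^ j) v \<in> W (m - 2 * int j)"
proof (induction j)
  case (Suc j)
  thus ?case using F_W[of "(F ^^ j) v" "m - 2 * int j"] by (simp add: algebra_simps)
qed simp

text \<open>Each passage of \<open>E\<close> past an \<open>F\<close> contributes the weight met
  there, and the sum of m, m - 2, ..., m - 2j is (j + 1)(m - j).\<close>

lemma E_F_power:
  assumes v: "v \<in> W m"
  shows "E ((F ^^ Suc j) v) = (F ^^ Suc j) (E v) + of_int ((int j + 1) * (m - int j)) \<cdot>\<^sub>v (F ^^ j) v"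
proof (induction j)
  case 0
  show ?case using EF[OF v] by simp
next
  case (Suc j)
  note vc = W_carrier[OF v]
  let ?u = "(F ^^ Suc j) v" and ?c = "of_int ((int j + 1) * (m - int j)) :: complex"
  have u: "?u \<in> W (m - 2 * int (Suc j))" using F_power_W[OF v, of "Suc j"] by simp
  have c: "(F ^^ Suc j) (E v) \<in> carrier_vec n" "(F ^^ j) v \<in> carrier_vec n" "?u \<in> carrier_vec n"
    using vc E_carrier F_power_carrier by blast+
  have "E ((F ^^ Suc (Suc j)) v) = F (E ?u) + of_int (m - 2 * int (Suc j)) \<cdot>\<^sub>v ?u"
    using EF[OF u] by simp
  also have "F (E ?u) = F ((F ^^ Suc j) (E v)) + ?c \<cdot>\<^sub>v F ((F ^^ j) v)"
    unfolding Suc using c by (simp add: F_add F_smult del: funpow.simps)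
  also have "\<dots> + of_int (m - 2 * int (Suc j)) \<cdot>\<^sub>v ?u =
      (F ^^ Suc (Suc j)) (E v) + of_int ((int (Suc j) + 1) * (m - int (Suc j))) \<cdot>\<^sub>v ?u"
    using F_carrier[OF c(1)] F_carrier[OF c(2)] by (intro eq_vecI) (auto simp: algebra_simps)
  finally show ?case .
qed

lemma smult_eq_zero:
  assumes "c \<cdot>\<^sub>v u = 0\<^sub>v n" "u \<in> carrier_vec n" "c \<noteq> (0 :: complex)"
  shows "u = 0\<^sub>v n"
proof (rule eq_vecI)
  fix i assume i: "i < dim_vec (0\<^sub>v n :: complex vec)"
  have "(c \<cdot>\<^sub>v u) $ i = 0" using assms(1) i by simp
  thus "u $ i = 0\<^sub>v n $ i" using i assms(2,3) by simp
qed (use assms in auto)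

text \<open>When \<open>E\<close> kills \<open>v\<close>, only the last term of
  \<open>E_F_power\<close> survives, and its coefficient vanishes only for j = m.\<close>

lemma F_power_descend:
  assumes v: "v \<in> W m" and E0: "E v = 0\<^sub>v n" and F0: "(F ^^ Suc j) v = 0\<^sub>v n" and j: "int j \<noteq> m"
  shows "(F ^^ j) v = 0\<^sub>v n"
proof (rule smult_eq_zero)
  note c = F_power_carrier[OF W_carrier[OF v], of j]
  have "0\<^sub>v n = 0\<^sub>v n + of_int ((int j + 1) * (m - int j)) \<cdot>\<^sub>v (F ^^ j) v"
    using E_F_power[OF v, of j] unfolding F0 E0 F_power_zero E_zero .
  thus "of_int ((int j + 1) * (m - int j)) \<cdot>\<^sub>v (F ^^ j) v = 0\<^sub>v n" using c by simp
  show "(of_int ((int j + 1) * (m - int j)) :: complex) \<noteq> 0" using j by (simp del: of_int_mult of_int_diff)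
qed (rule F_power_carrier[OF W_carrier[OF v]])

text \<open>If \<open>F ^^ k\<close> kills \<open>v\<close> of weight \<open>k\<close>, then \<open>F ^^ (k + 2)\<close> kills \<open>E v\<close>, which is zero by induction
  on the nilpotency index; then \<open>v\<close> is a highest weight vector.\<close>

lemma F_power_inj:
  assumes "v \<in> W (int k)" "(E ^^ N) v = 0\<^sub>v n" "(F ^^ k) v = 0\<^sub>v n"
  shows "v = 0\<^sub>v n"
  using assms
proof (induction N arbitrary: v k)
  case 0
  thus ?case by simp
next
  case (Suc N)
  note vW = Suc.prems(1)
  have Fk: "(F ^^ Suc k) v = 0\<^sub>v n" using Suc.prems(3) by (simp add: F_zero)
  have EN: "(E ^^ N) (E v) = 0\<^sub>v n" using Suc.prems(2) by (simp only: funpow_Suc_right o_apply)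
  have "0\<^sub>v n = (F ^^ Suc k) (E v) + 0 \<cdot>\<^sub>v (F ^^ k) v"
    using E_F_power[OF Suc.prems(1), of k] unfolding Fk E_zero by (simp del: funpow.simps)
  moreover have "0 \<cdot>\<^sub>v 0\<^sub>v n = (0\<^sub>v n :: complex vec)" by (intro eq_vecI) auto
  ultimately have "(F ^^ Suc k) (E v) = 0\<^sub>v n"
    using F_power_carrier[OF E_carrier[OF W_carrier[OF Suc.prems(1)]], of "Suc k"] Suc.prems(3)
    by (simp del: funpow.simps)
  hence "(F ^^ (k + 2)) (E v) = 0\<^sub>v n" by (simp add: F_zero)
  moreover have "E v \<in> W (int (k + 2))" using E_W[OF Suc.prems(1)] by (simp add: algebra_simps)
  ultimately have E0: "E v = 0\<^sub>v n" using Suc.IH[of "E v" "k + 2"] EN by blast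
  \<comment> \<open>Descent from \<open>F ^^ k\<close> to \<open>v\<close> itself. The exponents
    reached lie strictly below \<open>k\<close>, so the exceptional case of
    \<open>F_power_descend\<close> is never met.\<close>
  have "(F ^^ (k - d)) v = 0\<^sub>v n" for d
  proof (induction d)
    case 0
    show ?case using Suc.prems(3) by simp
  next
    case (Suc d)
    show ?case
    proof (cases "d < k")
      case True
      have "(F ^^ Suc (k - Suc d)) v = 0\<^sub>v n" using Suc True by (simp only: Suc_diff_Suc)
      moreover have "int (k - Suc d) \<noteq> int k" using True by simp
      ultimately show ?thesis by (rule F_power_descend[OF vW E0])
    next
      case False
      thus ?thesis using Suc by simp
    qed
  qed
  from this[of k] show ?case by simp
qed

text \<open>For negative \<open>m\<close> the exception j = m never occurs, so no power of
  \<open>F\<close> could kill \<open>v\<close>.\<close>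

lemma highest_weight_nonneg:
  assumes v: "v \<in> W m" and E0: "E v = 0\<^sub>v n" and "v \<noteq> 0\<^sub>v n" and N: "(F ^^ N) v = 0\<^sub>v n"
  shows "0 \<le> m"
proof (rule ccontr)
  assume "\<not> 0 \<le> m"
  have "(F ^^ j) v \<noteq> 0\<^sub>v n" for j
  proof (induction j)
    case (Suc j)
    thus ?case using F_power_descend[OF v E0, of j] \<open>\<not> 0 \<le> m\<close> by auto
  qed (use assms in simp)
  thus False using N by blast
qed

end

text \<open>A weight is a pair of eigenvalues of the two coroot matrices, and these are roots of
  nonzero characteristic polynomials.\<close>

lemma finite_weights:
  assumes "is_repn R"
  shows "finite {\<kappa>. weight_space R \<kappa> \<noteq> {0\<^sub>v (deg R)}}"
proof -
  interpret sl3_repn R by unfold_locales (rule assms)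
  have fin: "finite {a :: int. eigenvalue A (of_int a :: complex)}" if A: "A \<in> carrier_mat n n" for A
  proof -
    have "char_poly A \<noteq> 0" using degree_monic_char_poly[OF A] by auto
    hence "finite {k. poly (char_poly A) k = 0}" by (rule poly_roots_finite)
    hence "finite ((of_int :: int \<Rightarrow> complex) -` {k. poly (char_poly A) k = 0})"
      by (rule finite_vimageI) (simp add: inj_on_def)
    thus ?thesis by (simp add: eigenvalue_root_char_poly[OF A] vimage_def)
  qed
  have "{\<kappa>. weight_space R \<kappa> \<noteq> {0\<^sub>v n}} \<subseteq>
    {a. eigenvalue (act R (coroot 0)) (of_int a)} \<times> {a. eigenvalue (act R (coroot 1)) (of_int a)}"
  proof
    fix \<kappa> assume "\<kappa> \<in> {\<kappa>. weight_space R \<kappa> \<noteq> {0\<^sub>v n}}"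
    moreover have "0\<^sub>v n \<in> weight_space R \<kappa>" using weight_space_subspace[OF assms] by (simp add: subspace_iff)
    ultimately obtain v where "v \<in> weight_space R \<kappa>" "v \<noteq> 0\<^sub>v n" by auto
    thus "\<kappa> \<in> {a. eigenvalue (act R (coroot 0)) (of_int a)} \<times> {a. eigenvalue (act R (coroot 1)) (of_int a)}"
      using act_carrier[of "coroot 0"] act_carrier[of "coroot 1"]
      by (auto simp: weight_space_def eigenvalue_def eigenvector_def mem_Times_iff)
  qed
  thus ?thesis
    by (rule finite_subset) (intro finite_cartesian_product fin act_carrier coroot_sl3; simp)
qed

context sl3_repn
begin

text \<open>Eigenspaces of a single coroot, because \<open>sl2_action\<close> indexes its spaces by
  one integer.\<close>

definition H1_space :: "int \<Rightarrow> complex vec set" where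
  "H1_space m = {v \<in> carrier_vec n. H1 v = of_int m \<cdot>\<^sub>v v}"

definition H2_space :: "int \<Rightarrow> complex vec set" where
  "H2_space m = {v \<in> carrier_vec n. H2 v = of_int m \<cdot>\<^sub>v v}"

lemma eigen_shift:
  assumes "X \<in> sl3" "H \<in> sl3" "v \<in> carrier_vec n" "op H v = a \<cdot>\<^sub>v v" "op X (op H v) = op H (op X v) + c \<cdot>\<^sub>v op X v"
  shows "op H (op X v) = (a - c) \<cdot>\<^sub>v op X v"
proof (rule eq_vecI)
  fix i assume "i < dim_vec ((a - c) \<cdot>\<^sub>v op X v)"
  hence i: "i < n" using assms by simp
  have "a \<cdot>\<^sub>v op X v = op H (op X v) + c \<cdot>\<^sub>v op X v" using assms by simp
  hence "(a \<cdot>\<^sub>v op X v) $ i = (op H (op X v) + c \<cdot>\<^sub>v op X v) $ i" by simp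
  thus "op H (op X v) $ i = ((a - c) \<cdot>\<^sub>v op X v) $ i" using i assms by (simp add: algebra_simps)
qed (use assms in simp)

lemma bracket_swap:
  assumes "y = x + (-1) \<cdot>\<^sub>v h" "h = c \<cdot>\<^sub>v v" "x \<in> carrier_vec n" "y \<in> carrier_vec n" "v \<in> carrier_vec n"
  shows "x = y + c \<cdot>\<^sub>v (v :: complex vec)" "y = x + (- c) \<cdot>\<^sub>v v"
  by (rule eq_vecI; use assms in simp)+

sublocale sl2_1: sl2_action n E1 F1 H1_space
proof
  fix v m assume v: "v \<in> H1_space m"
  show "E1 v \<in> H1_space (m + 2)" "F1 v \<in> H1_space (m - 2)" "v \<in> carrier_vec n"
    using v eigen_shift[OF _ _ _ _ commutation(15)] eigen_shift[OF _ _ _ _ commutation(6)] by (auto simp: H1_space_def)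
  show "E1 (F1 v) = F1 (E1 v) + of_int m \<cdot>\<^sub>v v"
    using v by (intro bracket_swap(1)[OF commutation(1)]) (auto simp: H1_space_def)
qed auto

text \<open>The opposite sl(2), with the sign of the weight reversed. It serves weights with a
  negative coordinate, which are reflected upwards by powers of the raising operator.\<close>

sublocale sl2_1': sl2_action n F1 E1 "\<lambda>m. H1_space (- m)"
proof
  fix v m assume v: "v \<in> H1_space (- m)"
  show "E1 v \<in> H1_space (- (m - 2))" "F1 v \<in> H1_space (- (m + 2))" "v \<in> carrier_vec n"
    using v eigen_shift[OF _ _ _ _ commutation(15)] eigen_shift[OF _ _ _ _ commutation(6)] by (auto simp: H1_space_def)
  show "F1 (E1 v) = E1 (F1 v) + of_int m \<cdot>\<^sub>v v"
    using v bracket_swap(2)[OF commutation(1), of v "- of_int m" v] by (auto simp: H1_space_def)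
qed auto

sublocale sl2_2: sl2_action n E2 F2 H2_space
proof
  fix v m assume v: "v \<in> H2_space m"
  show "E2 v \<in> H2_space (m + 2)" "F2 v \<in> H2_space (m - 2)" "v \<in> carrier_vec n"
    using v eigen_shift[OF _ _ _ _ commutation(18)] eigen_shift[OF _ _ _ _ commutation(14)] by (auto simp: H2_space_def)
  show "E2 (F2 v) = F2 (E2 v) + of_int m \<cdot>\<^sub>v v"
    using v by (intro bracket_swap(1)[OF commutation(9)]) (auto simp: H2_space_def)
qed auto

sublocale sl2_2': sl2_action n F2 E2 "\<lambda>m. H2_space (- m)"
proof
  fix v m assume v: "v \<in> H2_space (- m)"
  show "E2 v \<in> H2_space (- (m - 2))" "F2 v \<in> H2_space (- (m + 2))" "v \<in> carrier_vec n"
    using v eigen_shift[OF _ _ _ _ commutation(18)] eigen_shift[OF _ _ _ _ commutation(14)] by (auto simp: H2_space_def)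
  show "F2 (E2 v) = E2 (F2 v) + of_int m \<cdot>\<^sub>v v"
    using v bracket_swap(2)[OF commutation(9), of v "- of_int m" v] by (auto simp: H2_space_def)
qed auto

lemma weight_shift_power:
  assumes "\<And>\<kappa> v. v \<in> weight_space R \<kappa> \<Longrightarrow> f v \<in> weight_space R (\<kappa> + \<alpha>)" "v \<in> weight_space R \<kappa>"
  shows "(f ^^ N) v \<in> weight_space R (\<kappa> + scale (int N) \<alpha>)"
proof (induction N)
  case 0
  thus ?case using assms(2) by (simp add: scale_def zero_prod_def[symmetric])
next
  case (Suc N)
  have "\<kappa> + scale (int N) \<alpha> + \<alpha> = \<kappa> + scale (int (Suc N)) \<alpha>"
    by (simp add: scale_def prod_eq_iff algebra_simps)
  thus ?case using assms(1)[OF Suc] by (simp only: funpow.simps o_apply)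
qed

text \<open>If no power killed \<open>v\<close>, the images would give infinitely many distinct
  weights, against \<open>finite_weights\<close>.\<close>

lemma weight_nilpotent:
  assumes "\<And>\<kappa> v. v \<in> weight_space R \<kappa> \<Longrightarrow> f v \<in> weight_space R (\<kappa> + \<alpha>)" "v \<in> weight_space R \<kappa>" "\<alpha> \<noteq> 0"
  shows "\<exists>N. (f ^^ N) v = 0\<^sub>v n"
proof (rule ccontr)
  assume "\<not> ?thesis"
  hence "weight_space R (\<kappa> + scale (int N) \<alpha>) \<noteq> {0\<^sub>v n}" for N
    using weight_shift_power[of f, OF assms(1,2), of N] by blast
  hence "range (\<lambda>N. \<kappa> + scale (int N) \<alpha>) \<subseteq> {\<kappa>. weight_space R \<kappa> \<noteq> {0\<^sub>v n}}" by blast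
  hence "finite (range (\<lambda>N. \<kappa> + scale (int N) \<alpha>))"
    using finite_weights[OF is_repn] finite_subset by blast
  moreover have "inj (\<lambda>N. \<kappa> + scale (int N) \<alpha>)"
    using assms(3) by (auto simp: inj_def scale_def prod_eq_iff)
  ultimately show False using finite_imageD infinite_UNIV_nat by blast
qed

lemma weight_in_H_space: "v \<in> weight_space R \<kappa> \<Longrightarrow> v \<in> H1_space (fst \<kappa>)" "v \<in> weight_space R \<kappa> \<Longrightarrow> v \<in> H2_space (snd \<kappa>)"
  by (auto simp: weight_space_iff H1_space_def H2_space_def)

lemma roots_nonzero: "\<alpha>1 \<noteq> 0" "\<alpha>2 \<noteq> 0" "- \<alpha>1 \<noteq> 0" "- \<alpha>2 \<noteq> 0"
  by (auto simp: \<alpha>1_def \<alpha>2_def zero_prod_def)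

lemma highest_weight_dominant:
  assumes v: "highest_weight_vector R \<mu> v"
  shows "\<mu> \<in> dominant"
proof -
  note w = hwv_weight[OF v]
  obtain N where N: "(F1 ^^ N) v = 0\<^sub>v n" using weight_nilpotent[of F1, OF weight_shift(3) w roots_nonzero(3)] by blast
  obtain M where M: "(F2 ^^ M) v = 0\<^sub>v n" using weight_nilpotent[of F2, OF weight_shift(4) w roots_nonzero(4)] by blast
  show ?thesis
    using sl2_1.highest_weight_nonneg[OF weight_in_H_space(1)[OF w] hwv_E(1)[OF v] hwv_nonzero[OF v] N]
      sl2_2.highest_weight_nonneg[OF weight_in_H_space(2)[OF w] hwv_E(2)[OF v] hwv_nonzero[OF v] M]
    by (simp add: dominant_def)
qed

text \<open>Multiplicities are compared through a linear map that is injective on a weight space; in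
  coordinates it is a matrix without kernel, to which \<open>injective_dim_le\<close>
  applies.\<close>

lemma weight_count_le:
  assumes D: "diag_repn R ws"
    and car: "\<And>v. v \<in> carrier_vec n \<Longrightarrow> f v \<in> carrier_vec n"
    and add: "\<And>u v. u \<in> carrier_vec n \<Longrightarrow> v \<in> carrier_vec n \<Longrightarrow> f (u + v) = f u + f v"
    and smult: "\<And>c v. v \<in> carrier_vec n \<Longrightarrow> f (c \<cdot>\<^sub>v v) = c \<cdot>\<^sub>v f v"
    and W: "\<And>v. v \<in> weight_space R \<kappa> \<Longrightarrow> f v \<in> weight_space R \<kappa>'"
    and inj: "\<And>v. v \<in> weight_space R \<kappa> \<Longrightarrow> f v = 0\<^sub>v n \<Longrightarrow> v = 0\<^sub>v n"
  shows "count_list ws \<kappa> \<le> count_list ws \<kappa>'"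
proof -
  let ?r = "count_list ws \<kappa>" and ?r' = "count_list ws \<kappa>'"
  have n: "n = length ws" using D by (simp add: diag_repn_def)
  obtain J L where J: "J \<in> carrier_mat n ?r" "L \<in> carrier_mat ?r n"
    "\<And>x. x \<in> carrier_vec ?r \<Longrightarrow> J *\<^sub>v x \<in> weight_space R \<kappa>" "\<And>x. x \<in> carrier_vec ?r \<Longrightarrow> L *\<^sub>v (J *\<^sub>v x) = x"
    using weight_space_basis[OF D, of \<kappa>] unfolding n by blast
  obtain J' L' where J': "L' \<in> carrier_mat ?r' n" "J' \<in> carrier_mat n ?r'"
    "\<And>u. u \<in> weight_space R \<kappa>' \<Longrightarrow> J' *\<^sub>v (L' *\<^sub>v u) = u"
    using weight_space_basis[OF D, of \<kappa>'] unfolding n by blast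
  have Jc: "J *\<^sub>v x \<in> carrier_vec n" if "x \<in> carrier_vec ?r" for x using J(1) that by simp
  have "\<exists>P\<in>carrier_mat ?r' ?r. \<forall>u\<in>carrier_vec ?r. P *\<^sub>v u = L' *\<^sub>v f (J *\<^sub>v u)"
  proof (rule linear_map_matrix)
    fix u w :: "complex vec" assume u: "u \<in> carrier_vec ?r" and w: "w \<in> carrier_vec ?r"
    show "L' *\<^sub>v f (J *\<^sub>v (u + w)) = L' *\<^sub>v f (J *\<^sub>v u) + L' *\<^sub>v f (J *\<^sub>v w)"
      using car[OF Jc[OF u]] car[OF Jc[OF w]]
      by (simp add: mult_add_distrib_mat_vec[OF J(1) u w] add[OF Jc[OF u] Jc[OF w]] mult_add_distrib_mat_vec[OF J'(1)])
  next
    fix u :: "complex vec" and c assume u: "u \<in> carrier_vec ?r"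
    show "L' *\<^sub>v f (J *\<^sub>v u) \<in> carrier_vec ?r'" using J'(1) car[OF Jc[OF u]] by simp
    show "L' *\<^sub>v f (J *\<^sub>v (c \<cdot>\<^sub>v u)) = c \<cdot>\<^sub>v (L' *\<^sub>v f (J *\<^sub>v u))"
      by (simp add: mult_mat_vec[OF J(1) u] smult[OF Jc[OF u]] mult_mat_vec[OF J'(1) car[OF Jc[OF u]]])
  qed
  then obtain P where P: "P \<in> carrier_mat ?r' ?r" "\<And>u. u \<in> carrier_vec ?r \<Longrightarrow> P *\<^sub>v u = L' *\<^sub>v f (J *\<^sub>v u)"
    by blast
  show ?thesis
  proof (rule injective_dim_le[OF P(1)])
    fix x :: "complex vec" assume x: "x \<in> carrier_vec ?r" and "P *\<^sub>v x = 0\<^sub>v ?r'"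
    hence "J' *\<^sub>v (L' *\<^sub>v f (J *\<^sub>v x)) = 0\<^sub>v n" using P(2) mult_mat_zero_vec[OF J'(2)] by simp
    hence "f (J *\<^sub>v x) = 0\<^sub>v n" using J'(3)[OF W[OF J(3)[OF x]]] by simp
    hence "J *\<^sub>v x = 0\<^sub>v n" using inj[OF J(3)[OF x]] by simp
    thus "x = 0\<^sub>v ?r" using J(4)[OF x] mult_mat_zero_vec[OF J(2)] by simp
  qed
qed

lemma op_power:
  assumes "X \<in> sl3" "u \<in> carrier_vec n" "v \<in> carrier_vec n"
  shows "(op X ^^ k) u \<in> carrier_vec n" "(op X ^^ k) (u + v) = (op X ^^ k) u + (op X ^^ k) v"
    "(op X ^^ k) (c \<cdot>\<^sub>v u) = c \<cdot>\<^sub>v (op X ^^ k) u"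
proof -
  have c: "(op X ^^ k) u \<in> carrier_vec n" if "u \<in> carrier_vec n" for u
    by (induction k) (use assms(1) that in auto)
  show "(op X ^^ k) u \<in> carrier_vec n" using c assms(2) .
  show "(op X ^^ k) (c \<cdot>\<^sub>v u) = c \<cdot>\<^sub>v (op X ^^ k) u"
  proof (induction k)
    case (Suc k)
    have "(op X ^^ k) u \<in> carrier_vec n" by (induction k) (use assms in auto)
    thus ?case using Suc assms(1) by simp
  qed simp
  show "(op X ^^ k) (u + v) = (op X ^^ k) u + (op X ^^ k) v"
  proof (induction k)
    case (Suc k)
    have "(op X ^^ k) u \<in> carrier_vec n" "(op X ^^ k) v \<in> carrier_vec n" by (induction k) (use assms in auto)
    thus ?case using Suc assms(1) by simp
  qed simp
qed

text \<open>A reflection subtracts the coordinate k times the simple root. For k at least zero the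
  k-th power of the lowering operator maps the weight space injectively to the reflected one, for
  negative k a power of the raising operator does.\<close>

lemma weight_count_refl_le:
  assumes D: "diag_repn R ws"
  shows "count_list ws \<kappa> \<le> count_list ws (refl1 \<kappa>)" "count_list ws \<kappa> \<le> count_list ws (refl2 \<kappa>)"
proof -
  have le: "count_list ws \<kappa> \<le> count_list ws (\<kappa> + scale (int k) \<alpha>)"
    if X: "X \<in> sl3" and sh: "\<And>\<kappa> v. v \<in> weight_space R \<kappa> \<Longrightarrow> op X v \<in> weight_space R (\<kappa> + \<alpha>)"
      and inj: "\<And>v. v \<in> weight_space R \<kappa> \<Longrightarrow> (op X ^^ k) v = 0\<^sub>v n \<Longrightarrow> v = 0\<^sub>v n" for X \<alpha> k
    using op_power[OF X] weight_shift_power[of "op X", OF sh] inj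
    by (intro weight_count_le[OF D, of "op X ^^ k"]) auto
  show "count_list ws \<kappa> \<le> count_list ws (refl1 \<kappa>)"
  proof (cases "0 \<le> fst \<kappa>")
    case True
    define k where "k = nat (fst \<kappa>)"
    have k: "fst \<kappa> = int k" using True by (simp add: k_def)
    have "v = 0\<^sub>v n" if v: "v \<in> weight_space R \<kappa>" and 0: "(F1 ^^ k) v = 0\<^sub>v n" for v
    proof -
      obtain N where "(E1 ^^ N) v = 0\<^sub>v n" using weight_nilpotent[of E1, OF weight_shift(1) v roots_nonzero(1)] by blast
      thus ?thesis using sl2_1.F_power_inj[of v k N] weight_in_H_space(1)[OF v] 0 k by simp
    qed
    moreover have "refl1 \<kappa> = \<kappa> + scale (int k) (- \<alpha>1)" by (simp add: refl1_def k scale_def prod_eq_iff)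
    ultimately show ?thesis using le[OF _ weight_shift(3), of k] by (simp add: in_sl3[unfolded One_nat_def])
  next
    case False
    define k where "k = nat (- fst \<kappa>)"
    have k: "fst \<kappa> = - int k" using False by (simp add: k_def)
    have "v = 0\<^sub>v n" if v: "v \<in> weight_space R \<kappa>" and 0: "(E1 ^^ k) v = 0\<^sub>v n" for v
    proof -
      obtain N where "(F1 ^^ N) v = 0\<^sub>v n" using weight_nilpotent[of F1, OF weight_shift(3) v roots_nonzero(3)] by blast
      thus ?thesis using sl2_1'.F_power_inj[of v k N] weight_in_H_space(1)[OF v] 0 k by simp
    qed
    moreover have "refl1 \<kappa> = \<kappa> + scale (int k) \<alpha>1" by (simp add: refl1_def k scale_def prod_eq_iff)
    ultimately show ?thesis using le[OF _ weight_shift(1), of k] by (simp add: in_sl3[unfolded One_nat_def])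
  qed
  show "count_list ws \<kappa> \<le> count_list ws (refl2 \<kappa>)"
  proof (cases "0 \<le> snd \<kappa>")
    case True
    define k where "k = nat (snd \<kappa>)"
    have k: "snd \<kappa> = int k" using True by (simp add: k_def)
    have "v = 0\<^sub>v n" if v: "v \<in> weight_space R \<kappa>" and 0: "(F2 ^^ k) v = 0\<^sub>v n" for v
    proof -
      obtain N where "(E2 ^^ N) v = 0\<^sub>v n" using weight_nilpotent[of E2, OF weight_shift(2) v roots_nonzero(2)] by blast
      thus ?thesis using sl2_2.F_power_inj[of v k N] weight_in_H_space(2)[OF v] 0 k by simp
    qed
    moreover have "refl2 \<kappa> = \<kappa> + scale (int k) (- \<alpha>2)" by (simp add: refl2_def k scale_def prod_eq_iff)
    ultimately show ?thesis using le[OF _ weight_shift(4), of k] by (simp add: in_sl3[unfolded One_nat_def])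
  next
    case False
    define k where "k = nat (- snd \<kappa>)"
    have k: "snd \<kappa> = - int k" using False by (simp add: k_def)
    have "v = 0\<^sub>v n" if v: "v \<in> weight_space R \<kappa>" and 0: "(E2 ^^ k) v = 0\<^sub>v n" for v
    proof -
      obtain N where "(F2 ^^ N) v = 0\<^sub>v n" using weight_nilpotent[of F2, OF weight_shift(4) v roots_nonzero(4)] by blast
      thus ?thesis using sl2_2'.F_power_inj[of v k N] weight_in_H_space(2)[OF v] 0 k by simp
    qed
    moreover have "refl2 \<kappa> = \<kappa> + scale (int k) \<alpha>2" by (simp add: refl2_def k scale_def prod_eq_iff)
    ultimately show ?thesis using le[OF _ weight_shift(2), of k] by (simp add: in_sl3[unfolded One_nat_def])
  qed
qed

text \<open>A reflection is an involution, so applying the inequality twice gives equality.\<close>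

lemma weight_count_refl:
  assumes D: "diag_repn R ws"
  shows "count_list ws (refl1 \<kappa>) = count_list ws \<kappa>" "count_list ws (refl2 \<kappa>) = count_list ws \<kappa>"
proof -
  have "refl1 (refl1 \<kappa>) = \<kappa>" "refl2 (refl2 \<kappa>) = \<kappa>"
    by (auto simp: refl1_def refl2_def scale_def \<alpha>1_def \<alpha>2_def prod_eq_iff)
  thus "count_list ws (refl1 \<kappa>) = count_list ws \<kappa>" "count_list ws (refl2 \<kappa>) = count_list ws \<kappa>"
    using weight_count_refl_le[OF D, of \<kappa>] weight_count_refl_le[OF D, of "refl1 \<kappa>"]
      weight_count_refl_le[OF D, of "refl2 \<kappa>"] by (auto intro: antisym)
qed

end

subsection \<open>The Weyl character formula\<close>

text \<open>The coefficient at \<open>\<xi>\<close> of the character \<open>m\<close> multiplied by the Weyl denominator: the shifts are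
  the images of \<open>\<rho>\<close> under the Weyl group.\<close>

definition altsum :: "(weight \<Rightarrow> int) \<Rightarrow> weight \<Rightarrow> int" where
  "altsum m \<xi> = m (\<xi> - (1, 1)) - m (\<xi> - (2, -1)) - m (\<xi> - (-1, 2))
     + m (\<xi> - (-2, 1)) + m (\<xi> - (1, -2)) - m (\<xi> - (-1, -1))"

text \<open>The coefficient at \<xi> of the alternating sum of exponentials over the Weyl group
  images of \<eta>, which is the numerator of the character formula.\<close>

definition altdelta :: "weight \<Rightarrow> weight \<Rightarrow> int" where
  "altdelta \<eta> \<xi> = of_bool (\<xi> = \<eta>) - of_bool (\<xi> = refl1 \<eta>) - of_bool (\<xi> = refl2 \<eta>)
     + of_bool (\<xi> = refl1 (refl2 \<eta>)) + of_bool (\<xi> = refl2 (refl1 \<eta>)) - of_bool (\<xi> = refl1 (refl2 (refl1 \<eta>)))"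

text \<open>Three halves of the invariant square norm, which keeps it integral.\<close>

definition qform :: "weight \<Rightarrow> int" where
  "qform \<xi> = (fst \<xi>)\<^sup>2 + fst \<xi> * snd \<xi> + (snd \<xi>)\<^sup>2"

lemma refl_simps: "refl1 (a, b) = (- a, a + b)" "refl2 (a, b) = (a + b, - b)"
  by (simp_all add: refl1_def refl2_def scale_def \<alpha>1_def \<alpha>2_def)

text \<open>Here \<open>m\<close> stands for the weight multiplicities and \<open>t1\<close>, \<open>t2\<close>, \<open>t3\<close> for the traces of \<open>F\<^sub>\<alpha> E\<^sub>\<alpha>\<close> on the
  weight spaces. In the alternating sum of the Casimir identity these traces cancel by the recursion
  along the root strings.\<close>

lemma freudenthal_altsum:
  fixes m t1 t2 t3 :: "int \<Rightarrow> int \<Rightarrow> real" and x y :: int and c :: real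
  assumes t1: "\<And>a b. t1 (a - 2) (b + 1) = t1 a b + a * m a b"
    and t2: "\<And>a b. t2 (a + 1) (b - 2) = t2 a b + b * m a b"
    and t3: "\<And>a b. t3 (a - 1) (b - 1) = t3 a b + (a + b) * m a b"
    and cas: "\<And>a b. (c - 2 * (a^2 + a * b + b^2) - 6 * (a + b)) * m a b = 6 * (t1 a b + t2 a b + t3 a b)"
  shows "(c + 6 - 2 * (x^2 + x * y + y^2)) *
    (m (x - 1) (y - 1) - m (x - 2) (y + 1) - m (x + 1) (y - 2) + m (x + 2) (y - 1) + m (x - 1) (y + 2) - m (x + 1) (y + 1)) = 0"
proof -
  \<comment> \<open>With \<open>c\<close> the Casimir eigenvalue this is twice the difference of
    \<open>qform\<close> at \<mu> + \<rho> and at \<open>(x, y)\<close>. Measured against this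
    common factor, the coefficients at the six shifted weights lose their quadratic terms and only
    terms linear in x and y remain.\<close>
  define K where "K = c + 6 - 2 * (x^2 + x * y + y^2)"
  have p: "K * m a b = 6 * (t1 a b + t2 a b + t3 a b) + (6 + 2 * (a^2 + a * b + b^2) - 2 * (x^2 + x * y + y^2) + 6 * (a + b)) * m a b" for a b
    unfolding cas[of a b, symmetric] K_def by (simp add: algebra_simps)
  have k1: "K * m (x - 1) (y - 1) = 6 * (t1 (x - 1) (y - 1) + t2 (x - 1) (y - 1) + t3 (x - 1) (y - 1))"
    unfolding p by (simp add: power2_eq_square algebra_simps)
  have k2: "K * m (x - 2) (y + 1) = 6 * (t1 (x - 2) (y + 1) + t2 (x - 2) (y + 1) + t3 (x - 2) (y + 1)) + (6 + 6 * y) * m (x - 2) (y + 1)"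
    unfolding p by (simp add: power2_eq_square algebra_simps)
  have k3: "K * m (x + 1) (y - 2) = 6 * (t1 (x + 1) (y - 2) + t2 (x + 1) (y - 2) + t3 (x + 1) (y - 2)) + (6 + 6 * x) * m (x + 1) (y - 2)"
    unfolding p by (simp add: power2_eq_square algebra_simps)
  have k4: "K * m (x + 2) (y - 1) = 6 * (t1 (x + 2) (y - 1) + t2 (x + 2) (y - 1) + t3 (x + 2) (y - 1)) + (18 + 12 * x + 6 * y) * m (x + 2) (y - 1)"
    unfolding p by (simp add: power2_eq_square algebra_simps)
  have k5: "K * m (x - 1) (y + 2) = 6 * (t1 (x - 1) (y + 2) + t2 (x - 1) (y + 2) + t3 (x - 1) (y + 2)) + (18 + 12 * y + 6 * x) * m (x - 1) (y + 2)"
    unfolding p by (simp add: power2_eq_square algebra_simps)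
  have k6: "K * m (x + 1) (y + 1) = 6 * (t1 (x + 1) (y + 1) + t2 (x + 1) (y + 1) + t3 (x + 1) (y + 1)) + (24 + 12 * (x + y)) * m (x + 1) (y + 1)"
    unfolding p by (simp add: power2_eq_square algebra_simps)
  \<comment> \<open>For each positive root the strings join the six weights in three pairs. One of
    these strings passes through \<open>(x, y)\<close> itself, and the three resulting terms with
    \<open>m x y\<close> cancel.\<close>
  have r1: "t1 (x - 2) (y + 1) = t1 x y + x * m x y"
    "t1 x y = t1 (x + 2) (y - 1) + (x + 2) * m (x + 2) (y - 1)"
    "t1 (x - 1) (y - 1) = t1 (x + 1) (y - 2) + (x + 1) * m (x + 1) (y - 2)"
    "t1 (x - 1) (y + 2) = t1 (x + 1) (y + 1) + (x + 1) * m (x + 1) (y + 1)"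
    using t1[of x y] t1[of "x + 2" "y - 1"] t1[of "x + 1" "y - 2"] t1[of "x + 1" "y + 1"] by (simp_all add: algebra_simps)
  have r2: "t2 (x + 1) (y - 2) = t2 x y + y * m x y"
    "t2 x y = t2 (x - 1) (y + 2) + (y + 2) * m (x - 1) (y + 2)"
    "t2 (x - 1) (y - 1) = t2 (x - 2) (y + 1) + (y + 1) * m (x - 2) (y + 1)"
    "t2 (x + 2) (y - 1) = t2 (x + 1) (y + 1) + (y + 1) * m (x + 1) (y + 1)"
    using t2[of x y] t2[of "x - 1" "y + 2"] t2[of "x - 2" "y + 1"] t2[of "x + 1" "y + 1"] by (simp_all add: algebra_simps)
  have r3: "t3 (x - 1) (y - 1) = t3 x y + (x + y) * m x y"
    "t3 x y = t3 (x + 1) (y + 1) + (x + y + 2) * m (x + 1) (y + 1)"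
    "t3 (x - 2) (y + 1) = t3 (x - 1) (y + 2) + (x + y + 1) * m (x - 1) (y + 2)"
    "t3 (x + 1) (y - 2) = t3 (x + 2) (y - 1) + (x + y + 1) * m (x + 2) (y - 1)"
    using t3[of x y] t3[of "x + 1" "y + 1"] t3[of "x - 1" "y + 2"] t3[of "x + 2" "y - 1"] by (simp_all add: algebra_simps)
  have "K * (m (x - 1) (y - 1) - m (x - 2) (y + 1) - m (x + 1) (y - 2) + m (x + 2) (y - 1) + m (x - 1) (y + 2) - m (x + 1) (y + 1))
    = K * m (x - 1) (y - 1) - K * m (x - 2) (y + 1) - K * m (x + 1) (y - 2) + K * m (x + 2) (y - 1) + K * m (x - 1) (y + 2) - K * m (x + 1) (y + 1)"
    by (simp only: distrib_left right_diff_distrib)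
  also have "\<dots> = 0"
    unfolding k1 k2 k3 k4 k5 k6 r1 r2 r3 by (simp add: algebra_simps)
  finally show ?thesis unfolding K_def .
qed

text \<open>A weight whose coordinate sum is nonnegative needs at most one reflection to become
  dominant; any other weight reaches that half plane by one or two reflections.\<close>

lemma weyl_chamber_induct:
  assumes dom: "\<And>\<xi>. \<xi> \<in> dominant \<Longrightarrow> P \<xi>"
    and r1: "\<And>\<xi>. P (refl1 \<xi>) \<Longrightarrow> P \<xi>" and r2: "\<And>\<xi>. P (refl2 \<xi>) \<Longrightarrow> P \<xi>"
  shows "P (\<xi> :: weight)"
proof (cases \<xi>)
  case (Pair x y)
  have dom': "P (a, b)" if "0 \<le> a" "0 \<le> b" for a b using dom[of "(a, b)"] that by (simp add: dominant_def)
  have r1': "P (- a, a + b) \<Longrightarrow> P (a, b)" and r2': "P (a + b, - b) \<Longrightarrow> P (a, b)" for a b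
    using r1[of "(a, b)"] r2[of "(a, b)"] by (simp_all add: refl_simps)
  have half: "P (a, b)" if "0 \<le> a + b" for a b
  proof -
    consider "0 \<le> a" "0 \<le> b" | "a < 0" | "b < 0" by linarith
    thus ?thesis
    proof cases
      case 2
      show ?thesis by (rule r1', rule dom') (use 2 that in auto)
    next
      case 3
      show ?thesis by (rule r2', rule dom') (use 3 that in auto)
    qed (rule dom')
  qed
  have "P (x, y)"
  proof (cases "0 \<le> x + y")
    case False
    then consider "y > 0" | "x > 0" | "x \<le> 0" "y \<le> 0" by linarith
    thus ?thesis
    proof cases
      case 1
      show ?thesis by (rule r1', rule half) (use 1 in auto)
    next
      case 2
      show ?thesis by (rule r2', rule half) (use 2 in auto)
    next
      case 3
      show ?thesis by (rule r1', rule r2', rule half) (use 3 in auto)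
    qed
  qed (rule half)
  thus ?thesis using Pair by simp
qed

text \<open>Both sides are antisymmetric under the Weyl group, and on the dominant chamber the norm
  condition leaves only the highest weight.\<close>

lemma weyl_character:
  assumes \<mu>: "\<mu> \<in> dominant" and supp: "\<And>\<kappa>. m \<kappa> \<noteq> 0 \<Longrightarrow> \<kappa> \<in> below \<mu>" and top: "m \<mu> = 1"
    and inv: "\<And>\<kappa>. m (refl1 \<kappa>) = m \<kappa>" "\<And>\<kappa>. m (refl2 \<kappa>) = m \<kappa>"
    and norm: "\<And>\<xi>. altsum m \<xi> \<noteq> 0 \<Longrightarrow> qform \<xi> = qform (\<mu> + \<rho>)"
  shows "altsum m \<xi> = altdelta (\<mu> + \<rho>) \<xi>"
proof -
  obtain A B where AB: "\<mu> + \<rho> = (A, B)" by (cases "\<mu> + \<rho>")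
  have mu: "\<mu> = (A - 1, B - 1)" and pos: "A \<ge> 1" "B \<ge> 1"
    using AB \<mu> by (auto simp: \<rho>_def \<Lambda>1_def \<Lambda>2_def dominant_def prod_eq_iff)
  have belowE: "\<exists>k l. k \<ge> 0 \<and> l \<ge> 0 \<and> a = A - 1 - 2 * k + l \<and> b = B - 1 + k - 2 * l" if "m (a, b) \<noteq> 0" for a b
  proof -
    from supp[OF that] obtain k l where "(a, b) = \<mu> - (scale (int k) \<alpha>1 + scale (int l) \<alpha>2)"
      by (auto simp: below_def)
    thus ?thesis by (intro exI[of _ "int k"] exI[of _ "int l"]) (auto simp: mu scale_def \<alpha>1_def \<alpha>2_def)
  qed
  have i1: "m (- a, a + b) = m (a, b)" and i2: "m (a + b, - b) = m (a, b)" for a b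
    using inv[of "(a, b)"] by (simp_all add: refl_simps)
  have i1': "m p = m (a, b)" if "p = (- a, a + b)" for p a b using i1 that by simp
  have i2': "m p = m (a, b)" if "p = (a + b, - b)" for p a b using i2 that by simp
  have a1: "altsum m (refl1 \<xi>) = - altsum m \<xi>" for \<xi>
  proof (cases \<xi>)
    case (Pair x y)
    have "m (- x - 1, x + y - 1) = m (x - (-1), y - 2)" "m (- x - 2, x + y - (-1)) = m (x - (-2), y - 1)"
      "m (- x - (-1), x + y - 2) = m (x - 1, y - 1)" "m (- x - (-2), x + y - 1) = m (x - 2, y - (-1))"
      "m (- x - 1, x + y - (-2)) = m (x - (-1), y - (-1))" "m (- x - (-1), x + y - (-1)) = m (x - 1, y - (-2))"
      by (rule i1'; simp)+
    thus ?thesis unfolding altsum_def Pair refl_simps diff_Pair by linarith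
  qed
  have a2: "altsum m (refl2 \<xi>) = - altsum m \<xi>" for \<xi>
  proof (cases \<xi>)
    case (Pair x y)
    have "m (x + y - 1, - y - 1) = m (x - 2, y - (-1))" "m (x + y - 2, - y - (-1)) = m (x - 1, y - 1)"
      "m (x + y - (-1), - y - 2) = m (x - 1, y - (-2))" "m (x + y - (-2), - y - 1) = m (x - (-1), y - (-1))"
      "m (x + y - 1, - y - (-2)) = m (x - (-1), y - 2)" "m (x + y - (-1), - y - (-1)) = m (x - (-2), y - 1)"
      by (rule i2'; simp)+
    thus ?thesis unfolding altsum_def Pair refl_simps diff_Pair by linarith
  qed
  have swap1: "refl1 \<xi> = \<eta> \<longleftrightarrow> \<xi> = refl1 \<eta>" and swap2: "refl2 \<xi> = \<eta> \<longleftrightarrow> \<xi> = refl2 \<eta>" for \<xi> \<eta>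
    by (cases \<xi>; cases \<eta>; auto simp: refl_simps)+
  have r11: "refl1 (refl1 \<xi>) = \<xi>" "refl2 (refl2 \<xi>) = \<xi>" and braid: "refl2 (refl1 (refl2 \<xi>)) = refl1 (refl2 (refl1 \<xi>))" for \<xi>
    by (cases \<xi>; simp add: refl_simps)+
  have d1: "altdelta \<eta> (refl1 \<xi>) = - altdelta \<eta> \<xi>" and d2: "altdelta \<eta> (refl2 \<xi>) = - altdelta \<eta> \<xi>" for \<eta> \<xi>
    unfolding altdelta_def swap1 swap2 r11 braid braid[symmetric, of "refl1 _"] by (simp_all add: r11 braid)
  have at_top: "altsum m (A, B) = 1"
  proof -
    \<comment> \<open>The numbers 2i + j and i + 2j are three times the coordinates of
      \<open>(i, j)\<close> in the simple roots. If one is positive, the shifted weight is not below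
      \<mu>; this removes all terms of the alternating sum but the first.\<close>
    have z: "m (A - 1 + i, B - 1 + j) = 0" if "2 * i + j > 0 \<or> i + 2 * j > 0" for i j
    proof (rule ccontr)
      assume "m (A - 1 + i, B - 1 + j) \<noteq> 0"
      then obtain k l where "k \<ge> 0" "l \<ge> 0" "A - 1 + i = A - 1 - 2 * k + l" "B - 1 + j = B - 1 + k - 2 * l"
        using belowE by blast
      hence "2 * i + j = - 3 * k" "i + 2 * j = - 3 * l" by auto
      thus False using that \<open>k \<ge> 0\<close> \<open>l \<ge> 0\<close> by auto
    qed
    have "m (A - 1, B - 1) = 1" using top mu by simp
    thus "altsum m (A, B) = 1"
      using z[of "-1" 2] z[of 2 "-1"] z[of 3 0] z[of 0 3] z[of 2 2]
      by (simp add: altsum_def algebra_simps)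
  qed
  show ?thesis
  proof (induction \<xi> rule: weyl_chamber_induct)
    case (1 \<xi>)
    obtain x y where \<xi>: "\<xi> = (x, y)" by (cases \<xi>)
    have xy: "x \<ge> 0" "y \<ge> 0" using 1 by (auto simp: dominant_def \<xi>)
    have delta: "altdelta (\<mu> + \<rho>) \<xi> = of_bool (\<xi> = (A, B))"
      using xy pos by (auto simp: altdelta_def AB \<xi> refl_simps)
    show ?case
    proof (cases "altsum m \<xi> = 0")
      case True
      have "\<xi> \<noteq> (A, B)"
      proof
        assume "\<xi> = (A, B)"
        thus False using True at_top by simp
      qed
      thus ?thesis using True delta by simp
    next
      case False
      have q: "qform \<xi> = qform (A, B)" using norm[OF False] AB by simp
      \<comment> \<open>Some term of the alternating sum is nonzero, so \<xi> minus an image of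
        \<rho> lies below \<mu>. As \<rho> minus any of its images is a nonnegative combination p
        \<alpha>1 + q \<alpha>2, also \<xi> lies below \<mu> + \<rho>.\<close>
      have "\<exists>k l. k \<ge> 0 \<and> l \<ge> 0 \<and> x = A - 2 * k + l \<and> y = B + k - 2 * l"
      proof -
        have *: "\<exists>k l. k \<ge> 0 \<and> l \<ge> 0 \<and> x = A - 2 * k + l \<and> y = B + k - 2 * l"
          if "m (x - i, y - j) \<noteq> 0" "1 - i = 2 * p - q" "1 - j = 2 * q - p" "p \<ge> 0" "q \<ge> 0" for i j p q
        proof -
          from belowE[OF that(1)] obtain k l
            where "k \<ge> 0" "l \<ge> 0" "x - i = A - 1 - 2 * k + l" "y - j = B - 1 + k - 2 * l" by blast
          thus ?thesis using that(2-) by (intro exI[of _ "k + p"] exI[of _ "l + q"]) auto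
        qed
        have "m (x - 1, y - 1) \<noteq> 0 \<or> m (x - 2, y - (-1)) \<noteq> 0 \<or> m (x - (-1), y - 2) \<noteq> 0 \<or> m (x - (-2), y - 1) \<noteq> 0
          \<or> m (x - 1, y - (-2)) \<noteq> 0 \<or> m (x - (-1), y - (-1)) \<noteq> 0"
          using False by (auto simp: altsum_def \<xi>)
        thus ?thesis
          using *[of 1 1 0 0] *[of 2 "-1" 0 1] *[of "-1" 2 1 0] *[of "-2" 1 2 1] *[of 1 "-2" 1 2] *[of "-1" "-1" 2 2] by auto
      qed
      then obtain k l where kl: "k \<ge> 0" "l \<ge> 0" "x = A - 2 * k + l" "y = B + k - 2 * l" by blast
      \<comment> \<open>A difference of square norms is the product of difference and sum. With
        \<mu> + \<rho> strictly dominant and \<xi> dominant, A + x and B + y are positive, so equal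
        norms force k = l = 0.\<close>
      have "2 * (qform (A, B) - qform (x, y)) = 3 * ((A + x) * k + (B + y) * l)"
        unfolding qform_def kl(3,4) by (simp add: power2_eq_square algebra_simps)
      hence sum0: "(A + x) * k + (B + y) * l = 0" using q \<xi> by simp
      have nonneg: "(A + x) * k \<ge> 0" "(B + y) * l \<ge> 0" using pos xy kl by auto
      hence "(A + x) * k = 0" "(B + y) * l = 0" using sum0 by linarith+
      hence "k = 0" "l = 0" using pos xy by auto
      hence eq: "\<xi> = (A, B)" using kl \<xi> by simp
      have "altsum m \<xi> = 1" using at_top eq by simp
      thus ?thesis using delta eq by simp
    qed
  next
    case (2 \<xi>)
    thus ?case using a1[of \<xi>] d1[of "\<mu> + \<rho>" \<xi>] by simp
  next
    case (3 \<xi>)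
    thus ?case using a2[of \<xi>] d2[of "\<mu> + \<rho>" \<xi>] by simp
  qed
qed

text \<open>Adding \<rho> makes both weights strictly dominant, and the nontrivial images of a
  strictly dominant weight leave the dominant chamber; only the first term can contribute.\<close>

lemma altdelta_dominant:
  assumes "\<mu> \<in> dominant" "\<nu> \<in> dominant"
  shows "altdelta (\<mu> + \<rho>) (\<nu> + \<rho>) = of_bool (\<mu> = \<nu>)"
  using assms by (cases \<mu>; cases \<nu>) (auto simp: altdelta_def refl_simps \<rho>_def \<Lambda>1_def \<Lambda>2_def dominant_def)

section \<open>Traces on weight spaces and the character of an irreducible module\<close>

definition wcount :: "weight list \<Rightarrow> weight \<Rightarrow> int" where
  "wcount ws \<kappa> = int (count_list ws \<kappa>)"

lemma wcount_sum: "wcount ws \<kappa> = (\<Sum>i<length ws. of_bool (ws ! i = \<kappa>))"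
  unfolding wcount_def count_list_sum of_nat_sum by (intro sum.cong refl) simp

context sl3_repn
begin

context
  fixes ws \<mu> v
  assumes D: "diag_repn R ws" and irr: "irreducible_repn R" and hwv: "highest_weight_vector R \<mu> v"
begin

lemma length_ws: "length ws = n"
  using D by (simp add: diag_repn_def)

lemma unit_weight: "i < n \<Longrightarrow> unit_vec n i \<in> weight_space R (ws ! i)"
  using length_ws by (auto simp: weight_space_diag[OF D] unit_vec_def)

lemma weight_entry: "w \<in> weight_space R \<kappa> \<Longrightarrow> i < n \<Longrightarrow> w $ i \<noteq> 0 \<Longrightarrow> ws ! i = \<kappa>"
  using length_ws by (auto simp: weight_space_diag[OF D])

lemma wspan_entry: "w \<in> wspan R M \<Longrightarrow> i < n \<Longrightarrow> w $ i \<noteq> 0 \<Longrightarrow> ws ! i \<in> M"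
proof (induction rule: wspan.induct)
  case (wspan_step u w \<kappa>)
  have "u $ i \<noteq> 0 \<or> w $ i \<noteq> 0"
    using wspan_step.prems weight_space_carrier[OF wspan_step(2)] by auto
  thus ?case using wspan_step weight_entry by blast
qed simp

lemma wcount_below:
  assumes "wcount ws \<kappa> \<noteq> 0"
  shows "\<kappa> \<in> below \<mu>"
proof -
  have "\<kappa> \<in> set ws" using assms by (simp add: wcount_def count_list_0_iff)
  then obtain i where i: "i < n" "ws ! i = \<kappa>" using length_ws by (auto simp: in_set_conv_nth)
  have "unit_vec n i \<in> cyc R v" using irreducible_cyc[OF irr hwv] by simp
  hence "unit_vec n i \<in> wspan R (below \<mu>)" by (rule cyc_wspan[OF hwv])
  thus ?thesis using wspan_entry[of "unit_vec n i" "below \<mu>" i] i by simp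
qed

text \<open>The top weight space is the line through \<open>v\<close>, and two different unit
  vectors cannot both be multiples of \<open>v\<close>.\<close>

lemma wcount_top: "wcount ws \<mu> = 1"
proof -
  obtain i0 where i0: "i0 < n" "v $ i0 \<noteq> 0"
    using hwv_nonzero[OF hwv] hwv_carrier[OF hwv] by (auto simp: vec_eq_iff)
  have ws0: "ws ! i0 = \<mu>" by (rule weight_entry[OF hwv_weight[OF hwv] i0])
  have uniq: "j = i0" if j: "j < n" "ws ! j = \<mu>" for j
  proof -
    have "unit_vec n j \<in> cyc R v" using irreducible_cyc[OF irr hwv] by simp
    moreover have "unit_vec n j \<in> weight_space R \<mu>" using unit_weight[OF j(1)] j(2) by simp
    ultimately obtain c where c: "unit_vec n j = c \<cdot>\<^sub>v v" using cyc_weight_space[OF hwv] by blast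
    have e: "unit_vec n j $ k = c * v $ k" if "k < n" for k
      unfolding c using that hwv_carrier[OF hwv] by simp
    have "c \<noteq> 0" using e[OF j(1)] j(1) by auto
    hence "unit_vec n j $ i0 \<noteq> (0 :: complex)" unfolding e[OF i0(1)] using i0(2) by simp
    thus ?thesis using i0 j by (auto split: if_splits)
  qed
  have "ws ! j = \<mu> \<longleftrightarrow> j = i0" if "j < n" for j using uniq[OF that] ws0 by blast
  hence "wcount ws \<mu> = (\<Sum>j<n. of_bool (j = i0))"
    unfolding wcount_sum length_ws by (intro sum.cong refl) simp
  thus ?thesis using i0(1) by (simp add: of_bool_def)
qed

text \<open>The trace of the product on the weight space of \<kappa>, expressed by diagonal entries
  in the basis of weight vectors.\<close>

definition tr :: "complex mat \<Rightarrow> complex mat \<Rightarrow> weight \<Rightarrow> complex" where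
  "tr X Y \<kappa> = (\<Sum>i<n. of_bool (ws ! i = \<kappa>) * op X (op Y (unit_vec n i)) $ i)"

lemma op_index:
  "X \<in> sl3 \<Longrightarrow> w \<in> carrier_vec n \<Longrightarrow> i < n \<Longrightarrow> op X w $ i = (\<Sum>j<n. act R X $$ (i, j) * w $ j)"
  using act_carrier[of X] by (auto simp: op_def scalar_prod_def lessThan_atLeast0 intro!: sum.cong)

lemma op_unit_index: "X \<in> sl3 \<Longrightarrow> i < n \<Longrightarrow> j < n \<Longrightarrow> op X (unit_vec n j) $ i = act R X $$ (i, j)"
  using act_carrier[of X] by (simp add: op_def)

lemma op_op_unit_index:
  assumes "X \<in> sl3" "Y \<in> sl3" "i < n"
  shows "op X (op Y (unit_vec n i)) $ i = (\<Sum>j<n. act R X $$ (i, j) * act R Y $$ (j, i))"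
  using assms by (subst op_index) (auto simp: op_unit_index intro!: sum.cong)

text \<open>Cyclicity of the trace across two weight spaces: \<open>X\<close> carries weight
  \<kappa> - \<alpha> to \<kappa>, so a nonzero entry of its matrix links the two conditions on the
  indices.\<close>

lemma tr_swap:
  assumes X: "X \<in> sl3" and Y: "Y \<in> sl3"
    and shX: "\<And>\<kappa> w. w \<in> weight_space R \<kappa> \<Longrightarrow> op X w \<in> weight_space R (\<kappa> + \<alpha>)"
  shows "tr X Y \<kappa> = tr Y X (\<kappa> - \<alpha>)"
proof -
  have entry: "of_bool (ws ! i = \<kappa>) * act R X $$ (i, j) = of_bool (ws ! j = \<kappa> - \<alpha>) * act R X $$ (i, j)"
    if ij: "i < n" "j < n" for i j
  proof (cases "act R X $$ (i, j) = 0")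
    case False
    have "op X (unit_vec n j) $ i \<noteq> 0" using False by (simp add: op_unit_index X ij)
    hence "ws ! i = ws ! j + \<alpha>" using weight_entry[OF shX[OF unit_weight[OF ij(2)]] ij(1)] by simp
    thus ?thesis by (auto simp: algebra_simps)
  qed simp
  have "tr X Y \<kappa> = (\<Sum>i<n. \<Sum>j<n. of_bool (ws ! i = \<kappa>) * act R X $$ (i, j) * act R Y $$ (j, i))"
    unfolding tr_def using X Y by (intro sum.cong refl) (simp add: op_op_unit_index sum_distrib_left mult.assoc)
  also have "\<dots> = (\<Sum>j<n. \<Sum>i<n. of_bool (ws ! j = \<kappa> - \<alpha>) * act R X $$ (i, j) * act R Y $$ (j, i))"
    by (subst sum.swap) (intro sum.cong refl, simp add: entry)
  also have "\<dots> = tr Y X (\<kappa> - \<alpha>)"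
    unfolding tr_def using X Y
    by (intro sum.cong refl) (simp add: op_op_unit_index sum_distrib_left mult_ac)
  finally show ?thesis .
qed

lemma tr_commute:
  assumes "\<And>i. i < n \<Longrightarrow> op X (op Y (unit_vec n i)) $ i = op Y (op X (unit_vec n i)) $ i + of_int (f (ws ! i))"
  shows "tr X Y \<kappa> = tr Y X \<kappa> + of_int (f \<kappa> * wcount ws \<kappa>)"
proof -
  have "tr X Y \<kappa> = (\<Sum>i<n. of_bool (ws ! i = \<kappa>) * op Y (op X (unit_vec n i)) $ i + of_int (f \<kappa>) * of_bool (ws ! i = \<kappa>))"
    unfolding tr_def using assms by (intro sum.cong refl) (auto simp: algebra_simps)
  thus ?thesis
    by (simp add: tr_def sum.distrib wcount_sum length_ws sum_distrib_left)
qed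

lemma unit_H: "i < n \<Longrightarrow> H1 (unit_vec n i) = of_int (fst (ws ! i)) \<cdot>\<^sub>v unit_vec n i"
  "i < n \<Longrightarrow> H2 (unit_vec n i) = of_int (snd (ws ! i)) \<cdot>\<^sub>v unit_vec n i"
  using unit_weight[of i] by (simp_all add: weight_space_iff)

lemma unit_commutation:
  assumes i: "i < n"
  shows "E1 (F1 (unit_vec n i)) $ i = F1 (E1 (unit_vec n i)) $ i + of_int (fst (ws ! i))"
    "E2 (F2 (unit_vec n i)) $ i = F2 (E2 (unit_vec n i)) $ i + of_int (snd (ws ! i))"
    "E3 (F3 (unit_vec n i)) $ i = F3 (E3 (unit_vec n i)) $ i + of_int (ht (ws ! i))"
proof -
  let ?u = "unit_vec n i :: complex vec"
  have u: "?u \<in> carrier_vec n" by simp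
  have "F1 (E1 ?u) $ i = (E1 (F1 ?u) + (-1) \<cdot>\<^sub>v H1 ?u) $ i" using commutation(1)[OF u] by simp
  thus "E1 (F1 ?u) $ i = F1 (E1 ?u) $ i + of_int (fst (ws ! i))" using i by (simp add: unit_H[OF i])
  have "F2 (E2 ?u) $ i = (E2 (F2 ?u) + (-1) \<cdot>\<^sub>v H2 ?u) $ i" using commutation(9)[OF u] by simp
  thus "E2 (F2 ?u) $ i = F2 (E2 ?u) $ i + of_int (snd (ws ! i))" using i by (simp add: unit_H[OF i, unfolded One_nat_def])
  have "op (coroot 0 + coroot 1) ?u = H1 ?u + H2 ?u" using u by (simp add: op_mat_add)
  hence "E3 (F3 ?u) $ i = (F3 (E3 ?u) + 1 \<cdot>\<^sub>v (H1 ?u + H2 ?u)) $ i" using commutation(23)[OF u] by simp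
  thus "E3 (F3 ?u) $ i = F3 (E3 ?u) $ i + of_int (ht (ws ! i))"
    using i by (simp add: unit_H[OF i, unfolded One_nat_def] ht_def)
qed

text \<open>Cyclicity replaces F E at the lower weight by E F at \<kappa>; the commutator then adds
  the trace of the coroot, a scalar times the multiplicity.\<close>

lemma tr_root_string:
  "tr (elem_mat 1 0) (elem_mat 0 1) (\<kappa> - \<alpha>1) = tr (elem_mat 1 0) (elem_mat 0 1) \<kappa> + of_int (fst \<kappa> * wcount ws \<kappa>)"
  "tr (elem_mat 2 1) (elem_mat 1 2) (\<kappa> - \<alpha>2) = tr (elem_mat 2 1) (elem_mat 1 2) \<kappa> + of_int (snd \<kappa> * wcount ws \<kappa>)"
  "tr (elem_mat 2 0) (elem_mat 0 2) (\<kappa> - (\<alpha>1 + \<alpha>2)) = tr (elem_mat 2 0) (elem_mat 0 2) \<kappa> + of_int (ht \<kappa> * wcount ws \<kappa>)"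
proof -
  note s = in_sl3[folded One_nat_def]
  show "tr (elem_mat 1 0) (elem_mat 0 1) (\<kappa> - \<alpha>1) = tr (elem_mat 1 0) (elem_mat 0 1) \<kappa> + of_int (fst \<kappa> * wcount ws \<kappa>)"
    by (rule trans[OF tr_swap[OF s(1,4) weight_shift(1), symmetric] tr_commute[OF unit_commutation(1)]])
  show "tr (elem_mat 2 1) (elem_mat 1 2) (\<kappa> - \<alpha>2) = tr (elem_mat 2 1) (elem_mat 1 2) \<kappa> + of_int (snd \<kappa> * wcount ws \<kappa>)"
    by (rule trans[OF tr_swap[OF s(2,5) weight_shift(2), symmetric] tr_commute[OF unit_commutation(2)]])
  show "tr (elem_mat 2 0) (elem_mat 0 2) (\<kappa> - (\<alpha>1 + \<alpha>2)) = tr (elem_mat 2 0) (elem_mat 0 2) \<kappa> + of_int (ht \<kappa> * wcount ws \<kappa>)"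
    by (rule trans[OF tr_swap[OF s(3,6) weight_shift(5), symmetric] tr_commute[OF unit_commutation(3)]])
qed

text \<open>Each E F is rewritten as F E plus a coroot, so that only F E is left. The three coroot
  values add up to 2 \<open>ht\<close>, which with the factor 3 gives the term 6
  \<open>ht\<close>.\<close>

lemma unit_casimir:
  assumes i: "i < n"
  shows "of_int (casimir_value \<mu> - 2 * qform (ws ! i) - 6 * ht (ws ! i)) =
    6 * (F1 (E1 (unit_vec n i)) $ i + F2 (E2 (unit_vec n i)) $ i + F3 (E3 (unit_vec n i)) $ i)"
proof -
  let ?u = "unit_vec n i :: complex vec"
  have "?u \<in> cyc R v" using irreducible_cyc[OF irr hwv] by simp
  hence "cas ?u $ i = (of_int (casimir_value \<mu>) \<cdot>\<^sub>v ?u) $ i" using cas_cyc[OF hwv] by simp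
  hence "of_int (casimir_value \<mu>) = cas ?u $ i" using i by simp
  also have "\<dots> = 2 * (of_int (fst (ws ! i)) * of_int (fst (ws ! i)) + of_int (fst (ws ! i)) * of_int (snd (ws ! i))
      + of_int (snd (ws ! i)) * of_int (snd (ws ! i)))
    + 3 * (E1 (F1 ?u) $ i + F1 (E1 ?u) $ i + (E2 (F2 ?u) $ i + F2 (E2 ?u) $ i) + (E3 (F3 ?u) $ i + F3 (E3 ?u) $ i))"
    using i by (simp add: cas_def unit_H[OF i, unfolded One_nat_def])
  finally show ?thesis
    unfolding unit_commutation[OF i] by (simp add: qform_def ht_def power2_eq_square algebra_simps)
qed

lemma tr_casimir:
  "of_int ((casimir_value \<mu> - 2 * qform \<kappa> - 6 * ht \<kappa>) * wcount ws \<kappa>) =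
    6 * (tr (elem_mat 1 0) (elem_mat 0 1) \<kappa> + tr (elem_mat 2 1) (elem_mat 1 2) \<kappa> + tr (elem_mat 2 0) (elem_mat 0 2) \<kappa>)"
proof -
  have "of_int ((casimir_value \<mu> - 2 * qform \<kappa> - 6 * ht \<kappa>) * wcount ws \<kappa>) =
    (\<Sum>i<n. of_bool (ws ! i = \<kappa>) * (of_int (casimir_value \<mu> - 2 * qform (ws ! i) - 6 * ht (ws ! i)) :: complex))"
    unfolding wcount_sum length_ws of_int_mult of_int_sum sum_distrib_left
    by (intro sum.cong refl) auto
  also have "\<dots> = (\<Sum>i<n. of_bool (ws ! i = \<kappa>) *
     (6 * (F1 (E1 (unit_vec n i)) $ i + F2 (E2 (unit_vec n i)) $ i + F3 (E3 (unit_vec n i)) $ i)))"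
    by (intro sum.cong refl) (simp only: unit_casimir lessThan_iff)
  also have "\<dots> = 6 * (tr (elem_mat 1 0) (elem_mat 0 1) \<kappa> + tr (elem_mat 2 1) (elem_mat 1 2) \<kappa> + tr (elem_mat 2 0) (elem_mat 0 2) \<kappa>)"
    unfolding tr_def sum_distrib_left sum.distrib[symmetric] by (intro sum.cong refl) (simp only: distrib_left mult_ac)
  finally show ?thesis .
qed

lemma diag_irreducible_character: "altsum (wcount ws) \<xi> = altdelta (\<mu> + \<rho>) \<xi>"
proof (rule weyl_character[where m = "wcount ws" and \<mu> = \<mu>])
  show "\<mu> \<in> dominant" by (rule highest_weight_dominant[OF hwv])
  show "wcount ws \<mu> = 1" by (rule wcount_top)
  show "wcount ws \<kappa> \<noteq> 0 \<Longrightarrow> \<kappa> \<in> below \<mu>" for \<kappa> by (rule wcount_below)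
  show "wcount ws (refl1 \<kappa>) = wcount ws \<kappa>" "wcount ws (refl2 \<kappa>) = wcount ws \<kappa>" for \<kappa>
    using weight_count_refl[OF D] by (simp_all add: wcount_def)
  fix \<xi> assume nz: "altsum (wcount ws) \<xi> \<noteq> 0"
  obtain x y where \<xi>: "\<xi> = (x, y)" by (cases \<xi>)
  \<comment> \<open>All coefficients in the identities are real, so they survive passing to real
    parts, and the trace identities become hypotheses over the reals.\<close>
  define m where "m = (\<lambda>a b. real_of_int (wcount ws (a, b)))"
  define t1 where "t1 = (\<lambda>a b. Re (tr (elem_mat 1 0) (elem_mat 0 1) (a, b)))"
  define t2 where "t2 = (\<lambda>a b. Re (tr (elem_mat 2 1) (elem_mat 1 2) (a, b)))"
  define t3 where "t3 = (\<lambda>a b. Re (tr (elem_mat 2 0) (elem_mat 0 2) (a, b)))"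
  have "(real_of_int (casimir_value \<mu>) + 6 - real_of_int (2 * (x^2 + x * y + y^2))) *
    (m (x - 1) (y - 1) - m (x - 2) (y + 1) - m (x + 1) (y - 2) + m (x + 2) (y - 1) + m (x - 1) (y + 2) - m (x + 1) (y + 1)) = 0"
  proof (rule freudenthal_altsum)
    fix a b
    show "t1 (a - 2) (b + 1) = t1 a b + a * m a b"
      using arg_cong[OF tr_root_string(1)[of "(a, b)"], of Re] by (simp add: t1_def m_def \<alpha>1_def)
    show "t2 (a + 1) (b - 2) = t2 a b + b * m a b"
      using arg_cong[OF tr_root_string(2)[of "(a, b)"], of Re] by (simp add: t2_def m_def \<alpha>2_def)
    show "t3 (a - 1) (b - 1) = t3 a b + (real_of_int a + real_of_int b) * m a b"
      using arg_cong[OF tr_root_string(3)[of "(a, b)"], of Re] by (simp add: t3_def m_def \<alpha>1_def \<alpha>2_def ht_def)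
    show "(real_of_int (casimir_value \<mu>) - 2 * ((real_of_int a)\<^sup>2 + real_of_int a * real_of_int b + (real_of_int b)\<^sup>2) - 6 * (real_of_int a + real_of_int b)) * m a b = 6 * (t1 a b + t2 a b + t3 a b)"
      using arg_cong[OF tr_casimir[of "(a, b)"], of Re]
      by (simp add: t1_def t2_def t3_def m_def qform_def ht_def)
  qed
  hence "real_of_int (casimir_value \<mu> + 6 - 2 * qform \<xi>) * real_of_int (altsum (wcount ws) \<xi>) = 0"
    by (simp add: m_def altsum_def qform_def \<xi>)
  hence "casimir_value \<mu> + 6 - 2 * qform \<xi> = 0" using nz by simp
  \<comment> \<open>Completing the square: 6 is twice the value of \<open>qform\<close> at
    \<rho>.\<close>
  moreover have "casimir_value \<mu> + 6 = 2 * qform (\<mu> + \<rho>)"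
    by (simp add: casimir_value_def qform_def \<rho>_def \<Lambda>1_def \<Lambda>2_def power2_eq_square algebra_simps)
  ultimately show "qform \<xi> = qform (\<mu> + \<rho>)" by simp
qed

end

end

definition ch :: "repn \<Rightarrow> weight \<Rightarrow> int" where
  "ch R \<kappa> = int (weight_mult R \<kappa>)"

lemma ch_has_weights: "is_repn R \<Longrightarrow> has_weights R ws \<Longrightarrow> ch R = wcount ws"
  by (intro ext) (simp add: ch_def wcount_def weight_mult_has_weights)

lemma irreducible_of_highest_weightD:
  assumes "irreducible_of_highest_weight R \<mu>"
  shows "is_repn R" "irreducible_repn R" "\<mu> \<in> dominant" "\<exists>v. highest_weight_vector R \<mu> v"
proof -
  show R: "irreducible_repn R" "\<exists>v. highest_weight_vector R \<mu> v"
    using assms by (auto simp: irreducible_of_highest_weight_iff)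
  thus "is_repn R" by (simp add: irreducible_repn_def)
  then interpret sl3_repn R by unfold_locales
  show "\<mu> \<in> dominant" using R highest_weight_dominant by blast
qed

text \<open>Everything is verified on the diagonal model and read back, since the multiplicities of
  \<open>R\<close> are the counts in the list of weights of that model.\<close>

lemma irreducible_character:
  assumes "irreducible_of_highest_weight R \<mu>"
  shows "\<exists>ws. has_weights R ws" "altsum (ch R) \<xi> = altdelta (\<mu> + \<rho>) \<xi>"
    "ch R (refl1 \<kappa>) = ch R \<kappa>" "ch R (refl2 \<kappa>) = ch R \<kappa>"
proof -
  note R = irreducible_of_highest_weightD[OF assms]
  obtain D ws where D: "diag_repn D ws" "iso_repn R D" "irreducible_of_highest_weight D \<mu>"
    using irreducible_diag_model[OF assms R(3)] by blast
  note D' = irreducible_of_highest_weightD[OF D(3)]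
  interpret D: sl3_repn D by unfold_locales (rule D')
  have w: "has_weights R ws" using D by (auto simp: has_weights_def)
  thus "\<exists>ws. has_weights R ws" by blast
  have c: "ch R = wcount ws" by (rule ch_has_weights[OF R(1) w])
  show "altsum (ch R) \<xi> = altdelta (\<mu> + \<rho>) \<xi>"
    unfolding c using D'(4) D.diag_irreducible_character[OF D(1) D'(2)] by blast
  show "ch R (refl1 \<kappa>) = ch R \<kappa>" "ch R (refl2 \<kappa>) = ch R \<kappa>"
    unfolding c using D.weight_count_refl[OF D(1)] by (simp_all add: wcount_def)
qed

subsection \<open>Tensor product multiplicities\<close>

lemma vec_first_last_simps:
  "u \<in> carrier_vec a \<Longrightarrow> vec_first (u @\<^sub>v w) a = u" "w \<in> carrier_vec b \<Longrightarrow> vec_last (u @\<^sub>v w) b = w"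
  by (auto simp: vec_first_def vec_last_def intro!: eq_vecI)

section \<open>Projections of direct sums onto their summands\<close>

definition surjective_on :: "repn \<Rightarrow> repn \<Rightarrow> complex mat \<Rightarrow> bool" where
  "surjective_on R S K \<longleftrightarrow> intertwines R S K \<and> (\<forall>w\<in>carrier_vec (deg S). \<exists>v\<in>carrier_vec (deg R). K *\<^sub>v v = w)"

lemma surjective_on_comp:
  assumes "surjective_on R S K" "surjective_on S T K'" "is_repn R"
  shows "surjective_on R T (K' * K)"
proof -
  have i: "intertwines R S K" "intertwines S T K'" using assms by (auto simp: surjective_on_def)
  note c = intertwinesD(1)[OF i(1)] intertwinesD(1)[OF i(2)]
  have "\<exists>v\<in>carrier_vec (deg R). (K' * K) *\<^sub>v v = w" if "w \<in> carrier_vec (deg T)" for w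
  proof -
    obtain u where u: "u \<in> carrier_vec (deg S)" "K' *\<^sub>v u = w" using assms(2) \<open>w \<in> _\<close> by (auto simp: surjective_on_def)
    obtain v where v: "v \<in> carrier_vec (deg R)" "K *\<^sub>v v = u" using assms(1) u by (auto simp: surjective_on_def)
    thus ?thesis using u assoc_mult_mat_vec[OF c(2,1) v(1)] by auto
  qed
  thus ?thesis using intertwines_comp[OF i assms(3)] by (simp add: surjective_on_def)
qed

lemma iso_surjective:
  assumes "is_repn R" "is_repn S" "iso_repn R S"
  shows "\<exists>K. surjective_on R S K"
proof -
  obtain P Q where P: "intertwines R S P" "intertwines S R Q" "\<And>v. v\<in>carrier_vec (deg S) \<Longrightarrow> P *\<^sub>v (Q *\<^sub>v v) = v"
    using assms(3) by (auto simp: iso_repn_iff[OF assms(1,2)])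
  have "\<exists>v\<in>carrier_vec (deg R). P *\<^sub>v v = w" if "w \<in> carrier_vec (deg S)" for w
    using P(3)[OF that] intertwinesD(3)[OF P(2) that] by (intro bexI[of _ "Q *\<^sub>v w"])
  thus ?thesis using P(1) by (auto simp: surjective_on_def)
qed

lemma dsum_projections:
  assumes R: "is_repn R" and S: "is_repn S"
  shows "\<exists>K. surjective_on (dsum R S) R K" "\<exists>K. surjective_on (dsum R S) S K"
proof -
  let ?r = "deg R" and ?s = "deg S"
  note arith = append_vec_arith[where a = ?r and b = ?s]
  have "\<exists>P\<in>(carrier_mat ?r (?r + ?s) :: complex mat set). \<forall>u\<in>carrier_vec (?r + ?s). P *\<^sub>v u = vec_first u ?r"
    by (rule linear_map_matrix) (auto simp: vec_first_def intro!: eq_vecI)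
  then obtain P :: "complex mat" where P: "P \<in> carrier_mat ?r (?r + ?s)" "\<And>u. u \<in> carrier_vec (?r + ?s) \<Longrightarrow> P *\<^sub>v u = vec_first u ?r" by blast
  have "intertwines (dsum R S) R P"
    unfolding intertwines_def
  proof (intro conjI ballI)
    fix X and v :: "complex vec" assume X: "X \<in> sl3" and v: "v \<in> carrier_vec (deg (dsum R S))"
    then obtain u w where uw: "u \<in> carrier_vec ?r" "w \<in> carrier_vec ?s" "v = u @\<^sub>v w"
      by (auto elim: vec_append_cases)
    show "P *\<^sub>v (act (dsum R S) X *\<^sub>v v) = act R X *\<^sub>v (P *\<^sub>v v)"
      using uw X R S by (simp add: act_dsum_append P vec_first_last_simps)
  qed (use P in simp)
  moreover have "\<exists>v\<in>carrier_vec (?r + ?s). P *\<^sub>v v = w" if "w \<in> carrier_vec ?r" for w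
    using that by (intro bexI[of _ "w @\<^sub>v 0\<^sub>v ?s"]) (auto simp: P vec_first_last_simps)
  ultimately show "\<exists>K. surjective_on (dsum R S) R K" by (auto simp: surjective_on_def)
  have "\<exists>P\<in>(carrier_mat ?s (?r + ?s) :: complex mat set). \<forall>u\<in>carrier_vec (?r + ?s). P *\<^sub>v u = vec_last u ?s"
    by (rule linear_map_matrix) (auto simp: vec_last_def intro!: eq_vecI)
  then obtain P :: "complex mat" where P: "P \<in> carrier_mat ?s (?r + ?s)" "\<And>u. u \<in> carrier_vec (?r + ?s) \<Longrightarrow> P *\<^sub>v u = vec_last u ?s" by blast
  have "intertwines (dsum R S) S P"
    unfolding intertwines_def
  proof (intro conjI ballI)
    fix X and v :: "complex vec" assume X: "X \<in> sl3" and v: "v \<in> carrier_vec (deg (dsum R S))"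
    then obtain u w where uw: "u \<in> carrier_vec ?r" "w \<in> carrier_vec ?s" "v = u @\<^sub>v w"
      by (auto elim: vec_append_cases)
    show "P *\<^sub>v (act (dsum R S) X *\<^sub>v v) = act S X *\<^sub>v (P *\<^sub>v v)"
      using uw X R S by (simp add: act_dsum_append P vec_first_last_simps)
  qed (use P in simp)
  moreover have "\<exists>v\<in>carrier_vec (?r + ?s). P *\<^sub>v v = w" if "w \<in> carrier_vec ?s" for w
    using that by (intro bexI[of _ "0\<^sub>v ?r @\<^sub>v w"]) (auto simp: P vec_first_last_simps)
  ultimately show "\<exists>K. surjective_on (dsum R S) S K" by (auto simp: surjective_on_def)
qed

lemma direct_sum_projection:
  assumes "\<forall>R\<in>set Rs. is_repn R" "S \<in> set Rs"
  shows "\<exists>K. surjective_on (direct_sum_repn Rs) S K"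
  using assms
proof (induction Rs)
  case (Cons R Rs)
  have r: "is_repn R" "\<forall>S\<in>set Rs. is_repn S" using Cons by auto
  note d = is_repn_direct_sum(1)[OF r(2)] and d' = is_repn_direct_sum(1)[OF Cons.prems(1)]
  obtain K where K: "surjective_on (direct_sum_repn (R # Rs)) (dsum R (direct_sum_repn Rs)) K"
    using iso_surjective[OF d' is_repn_dsum[OF r(1) d] iso_direct_sum_Cons[OF r]] by blast
  show ?case
  proof (cases "S = R")
    case True
    thus ?thesis
      using surjective_on_comp[OF K _ d'] dsum_projections(1)[OF r(1) d] by blast
  next
    case False
    then obtain L where "surjective_on (direct_sum_repn Rs) S L" using Cons by auto
    thus ?thesis
      using surjective_on_comp[OF surjective_on_comp[OF K _ d'] _ d'] dsum_projections(2)[OF r(1) d] by blast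
  qed
qed simp

text \<open>Some vector of a weight basis survives in the quotient, which gives \<open>S\<close> a
  weight with integral coordinates. Among its finitely many weights one has maximal
  \<open>ht\<close>; raising operators would increase \<open>ht\<close>, so they kill its weight
  vectors.\<close>

lemma surjective_image_highest_weight:
  assumes K: "surjective_on R S K" and R: "is_repn R" "has_weights R ws" and S: "irreducible_repn S"
  shows "\<exists>\<nu>. irreducible_of_highest_weight S \<nu>"
proof -
  have rS: "is_repn S" and dS: "deg S > 0" using S by (auto simp: irreducible_repn_def)
  interpret S: sl3_repn S by unfold_locales (rule rS)
  obtain D where D: "diag_repn D ws" "iso_repn R D" using R(2) by (auto simp: has_weights_def)
  have rD: "is_repn D" and dD: "deg D = length ws" using D by (auto simp: diag_repn_def)
  obtain L where "surjective_on D R L" using iso_surjective[OF rD R(1) iso_repn_sym[OF R(1) rD D(2)]] by blast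
  from surjective_on_comp[OF this K rD] obtain P where P: "surjective_on D S P" by blast
  have iP: "intertwines D S P" using P by (simp add: surjective_on_def)
  have "\<exists>i<deg D. P *\<^sub>v unit_vec (deg D) i \<noteq> 0\<^sub>v (deg S)"
  proof (rule ccontr)
    assume "\<not> ?thesis"
    hence 0: "P *\<^sub>v unit_vec (deg D) i = 0\<^sub>v (deg S)" if "i < deg D" for i using that by blast
    have "P = 0\<^sub>m (deg S) (deg D)"
    proof (rule eq_matI)
      fix i j assume ij: "i < dim_row (0\<^sub>m (deg S) (deg D) :: complex mat)" "j < dim_col (0\<^sub>m (deg S) (deg D) :: complex mat)"
      hence "(P *\<^sub>v unit_vec (deg D) j) $ i = 0" using 0 by simp
      thus "P $$ (i, j) = 0\<^sub>m (deg S) (deg D) $$ (i, j)" using ij intertwinesD(1)[OF iP] by simp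
    qed (use intertwinesD(1)[OF iP] in auto)
    moreover have "\<exists>v\<in>carrier_vec (deg D). P *\<^sub>v v = unit_vec (deg S) 0"
      using P unit_vec_carrier[of "deg S" 0] unfolding surjective_on_def by blast
    then obtain v where "v \<in> carrier_vec (deg D)" "P *\<^sub>v v = unit_vec (deg S) 0" by blast
    ultimately have z: "unit_vec (deg S) 0 = (0\<^sub>v (deg S) :: complex vec)" by (simp add: zero_mat_mult_vec)
    have "unit_vec (deg S) 0 $ 0 = (0 :: complex)" unfolding z using dS by simp
    thus False using dS by simp
  qed
  then obtain i where i: "i < deg D" "P *\<^sub>v unit_vec (deg D) i \<noteq> 0\<^sub>v (deg S)" by blast
  have "unit_vec (deg D) i \<in> weight_space D (ws ! i)"
    using i dD by (auto simp: weight_space_diag[OF D(1)] unit_vec_def)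
  hence "P *\<^sub>v unit_vec (deg D) i \<in> weight_space S (ws ! i)" by (rule intertwines_weight_space[OF iP])
  hence ne: "{\<kappa>. weight_space S \<kappa> \<noteq> {0\<^sub>v (deg S)}} \<noteq> {}" using i by blast
  let ?A = "{\<kappa>. weight_space S \<kappa> \<noteq> {0\<^sub>v (deg S)}}"
  have "Max (ht ` ?A) \<in> ht ` ?A" using finite_weights[OF rS] ne by (intro Max_in) blast+
  then obtain \<nu> where \<nu>: "weight_space S \<nu> \<noteq> {0\<^sub>v (deg S)}" and "ht \<nu> = Max (ht ` ?A)" by force
  hence max: "ht \<kappa> \<le> ht \<nu>" if "weight_space S \<kappa> \<noteq> {0\<^sub>v (deg S)}" for \<kappa>
    using finite_weights[OF rS] that by simp
  have z: "0\<^sub>v (deg S) \<in> weight_space S \<nu>" using weight_space_subspace[OF rS] by (simp add: subspace_iff)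
  then obtain v where v: "v \<in> weight_space S \<nu>" "v \<noteq> 0\<^sub>v (deg S)" using \<nu> by blast
  have kill: "w = 0\<^sub>v (deg S)" if "w \<in> weight_space S \<kappa>" "ht \<kappa> > ht \<nu>" for w \<kappa>
  proof (rule ccontr)
    assume "w \<noteq> 0\<^sub>v (deg S)"
    hence "weight_space S \<kappa> \<noteq> {0\<^sub>v (deg S)}" using that(1) by blast
    thus False using max that(2) by fastforce
  qed
  have E: "S.E1 v = 0\<^sub>v (deg S)" "S.E2 v = 0\<^sub>v (deg S)" "S.E3 v = 0\<^sub>v (deg S)"
    by (rule kill[OF S.weight_shift(1)[OF v(1)]] kill[OF S.weight_shift(2)[OF v(1)]] kill[OF S.weight_shift(5)[OF v(1)]];
        simp add: ht_def \<alpha>1_def \<alpha>2_def)+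
  have "highest_weight_vector S \<nu> v"
    unfolding highest_weight_vector_def
  proof (intro conjI allI impI v)
    fix i j :: nat assume "j < 3" "i < j"
    hence "(i, j) = (0, 1) \<or> (i, j) = (0, 2) \<or> (i, j) = (1, 2)" by auto
    thus "act S (elem_mat i j) *\<^sub>v v = 0\<^sub>v (deg S)" using E unfolding S.op_def by auto
  qed
  thus ?thesis using S unfolding irreducible_of_highest_weight_iff by blast
qed

lemma altsum_sum_list: "altsum (\<lambda>\<kappa>. \<Sum>S\<leftarrow>Rs. f S \<kappa>) \<xi> = (\<Sum>S\<leftarrow>Rs. altsum (f S) \<xi>)"
  by (induction Rs) (auto simp: altsum_def)

lemma altsum_sum: "altsum (\<lambda>\<kappa>. \<Sum>i\<in>A. f i \<kappa>) \<xi> = (\<Sum>i\<in>A. altsum (f i) \<xi>)"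
  by (simp add: altsum_def sum.distrib sum_subtractf)

lemma ch_direct_sum:
  assumes "list_all2 has_weights Rs wss" "\<forall>R\<in>set Rs. is_repn R"
  shows "wcount (concat wss) \<kappa> = (\<Sum>S\<leftarrow>Rs. ch S \<kappa>)"
  using assms by (induction rule: list_all2_induct) (auto simp: wcount_def ch_has_weights)

text \<open>The summands of highest weight \<open>\<nu>\<close> are counted by the coefficient at \<open>\<nu> + \<rho>\<close> of the character
  multiplied by the Weyl denominator, whatever the decomposition.\<close>

lemma irreducible_summand_count:
  assumes T: "is_repn T" "has_weights T ws"
    and irr: "\<forall>S\<in>set Rs. irreducible_repn S" and iso: "iso_repn T (direct_sum_repn Rs)"
    and \<nu>: "\<nu> \<in> dominant"
  shows "int (length (filter (\<lambda>S. irreducible_of_highest_weight S \<nu>) Rs)) = altsum (ch T) (\<nu> + \<rho>)"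
proof -
  have r: "\<forall>S\<in>set Rs. is_repn S" using irr by (auto simp: irreducible_repn_def)
  note DS = is_repn_direct_sum(1)[OF r]
  obtain K where K: "surjective_on T (direct_sum_repn Rs) K" using iso_surjective[OF T(1) DS iso] by blast
  have hw: "\<exists>\<mu>. irreducible_of_highest_weight S \<mu>" if S: "S \<in> set Rs" for S
  proof -
    obtain K' where "surjective_on (direct_sum_repn Rs) S K'" using direct_sum_projection[OF r S] by (rule exE)
    thus ?thesis by (rule surjective_image_highest_weight[OF surjective_on_comp[OF K _ T(1)] T bspec[OF irr S]])
  qed
  have "has_weights S (SOME ws. has_weights S ws)" if S: "S \<in> set Rs" for S
  proof -
    obtain \<mu> where "irreducible_of_highest_weight S \<mu>" using hw[OF S] by (rule exE)
    thus ?thesis by (rule someI_ex[OF irreducible_character(1)])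
  qed
  hence "list_all2 has_weights Rs (map (\<lambda>S. SOME ws. has_weights S ws) Rs)"
    by (simp add: list_all2_conv_all_nth)
  then obtain wss where wss: "list_all2 has_weights Rs wss" by blast
  have "has_weights T (concat wss)"
    by (rule has_weights_iso[OF T(1) DS iso has_weights_direct_sum[OF wss r]])
  hence "ch T = (\<lambda>\<kappa>. \<Sum>S\<leftarrow>Rs. ch S \<kappa>)"
    using ch_has_weights[OF T(1)] ch_direct_sum[OF wss r] by auto
  hence "altsum (ch T) (\<nu> + \<rho>) = (\<Sum>S\<leftarrow>Rs. altsum (ch S) (\<nu> + \<rho>))"
    by (simp only: altsum_sum_list)
  \<comment> \<open>A summand of highest weight \<mu> contributes the coefficient of its numerator
    at \<nu> + \<rho>, which is 1 for \<mu> = \<nu> and 0 otherwise.\<close>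
  also have "\<dots> = (\<Sum>S\<leftarrow>Rs. of_bool (irreducible_of_highest_weight S \<nu>))"
  proof (rule arg_cong[where f = sum_list], rule map_cong[OF refl])
    fix S assume "S \<in> set Rs"
    then obtain \<mu> where \<mu>: "irreducible_of_highest_weight S \<mu>" using hw by blast
    note d = irreducible_of_highest_weightD(3)
    show "altsum (ch S) (\<nu> + \<rho>) = of_bool (irreducible_of_highest_weight S \<nu>)"
    proof (cases "irreducible_of_highest_weight S \<nu>")
      case True
      thus ?thesis using irreducible_character(2)[OF True] altdelta_dominant[OF \<nu> \<nu>] by simp
    next
      case False
      hence "\<mu> \<noteq> \<nu>" using \<mu> by auto
      thus ?thesis using irreducible_character(2)[OF \<mu>] altdelta_dominant[OF d[OF \<mu>] \<nu>] False by simp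
    qed
  qed
  also have "\<dots> = int (length (filter (\<lambda>S. irreducible_of_highest_weight S \<nu>) Rs))"
    by (induction Rs) auto
  finally show ?thesis by simp
qed

lemma irrep_highest_weight: "\<mu> \<in> dominant \<Longrightarrow> irreducible_of_highest_weight (irrep \<mu>) \<mu>"
  unfolding irrep_def by (rule someI_ex) (use unitary_irreducible_exists in blast)

text \<open>The chosen modules \<open>irrep\<close> need not be unitary, so both factors are first
  replaced by isomorphic unitary ones, whose tensor product is unitary.\<close>

lemma tensor_irrep_decomposition:
  assumes "l \<in> dominant" "\<mu> \<in> dominant"
  shows "\<exists>Rs. (\<forall>S\<in>set Rs. irreducible_repn S) \<and> iso_repn (tensor_repn (irrep l) (irrep \<mu>)) (direct_sum_repn Rs)"
proof -
  have u: "\<exists>U. unitary_repn U \<and> is_repn U \<and> iso_repn (irrep \<kappa>) U" if "\<kappa> \<in> dominant" for \<kappa>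
    using unitary_irreducible_exists[OF that] irrep_highest_weight[OF that] irreducible_highest_weight_unique
    unfolding irreducible_of_highest_weight_iff by (metis unitary_repn_def)
  obtain U where U: "unitary_repn U" "is_repn U" "iso_repn (irrep l) U" using u[OF assms(1)] by blast
  obtain V where V: "unitary_repn V" "is_repn V" "iso_repn (irrep \<mu>) V" using u[OF assms(2)] by blast
  note r = irreducible_of_highest_weightD(1)[OF irrep_highest_weight[OF assms(1)]]
    irreducible_of_highest_weightD(1)[OF irrep_highest_weight[OF assms(2)]]
  obtain Rs where Rs: "\<forall>S\<in>set Rs. irreducible_repn S" "iso_repn (tensor_repn U V) (direct_sum_repn Rs)"
    using unitary_decomposition[OF unitary_tensor[OF U(1) V(1)]] by blast
  have d: "is_repn (direct_sum_repn Rs)" using Rs(1) by (intro is_repn_direct_sum(1)) (auto simp: irreducible_repn_def)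
  have "iso_repn (tensor_repn (irrep l) (irrep \<mu>)) (direct_sum_repn Rs)"
    by (rule iso_repn_trans[OF is_repn_tensor[OF r] is_repn_tensor[OF U(2) V(2)] d
          iso_tensor_cong[OF r(1) U(2) r(2) V(2) U(3) V(3)] Rs(2)])
  thus ?thesis using Rs(1) by blast
qed

text \<open>\<open>altsum\<close> commutes with translations, so the Weyl denominator can be applied
  to the second factor alone. It turns that character into its six-term numerator, and the remaining
  sum over \<open>ws\<close> counts weights of the first factor.\<close>

lemma Nbar_formula:
  assumes l: "l \<in> dominant" and \<mu>: "\<mu> \<in> dominant" and \<nu>: "\<nu> \<in> dominant"
  defines "\<eta> \<equiv> \<mu> + \<rho>" and "\<xi> \<equiv> \<nu> + \<rho>"
  shows "int (Nbar \<nu> l \<mu>) = ch (irrep l) (\<xi> - \<eta>) - ch (irrep l) (\<xi> - refl1 \<eta>) - ch (irrep l) (\<xi> - refl2 \<eta>)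
    + ch (irrep l) (\<xi> - refl1 (refl2 \<eta>)) + ch (irrep l) (\<xi> - refl2 (refl1 \<eta>)) - ch (irrep l) (\<xi> - refl1 (refl2 (refl1 \<eta>)))"
proof -
  let ?R = "irrep l" and ?S = "irrep \<mu>"
  note hR = irrep_highest_weight[OF l] and hS = irrep_highest_weight[OF \<mu>]
  note R = irreducible_of_highest_weightD(1)[OF hR] and S = irreducible_of_highest_weightD(1)[OF hS]
  obtain ws where ws: "has_weights ?R ws" using irreducible_character(1)[OF hR] by blast
  obtain vs where vs: "has_weights ?S vs" using irreducible_character(1)[OF hS] by blast
  obtain D where D: "diag_repn D ws" "iso_repn ?R D" using ws by (auto simp: has_weights_def)
  obtain E where E: "diag_repn E vs" "iso_repn ?S E" using vs by (auto simp: has_weights_def)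
  have rDE: "is_repn D" "is_repn E" using D E by (auto simp: diag_repn_def)
  have T: "is_repn (tensor_repn ?R ?S)" by (rule is_repn_tensor[OF R S])
  have wT: "has_weights (tensor_repn ?R ?S) (tensor_weights ws vs)"
    unfolding has_weights_def using diag_repn_tensor[OF D(1) E(1)] iso_tensor_cong[OF R rDE(1) S rDE(2) D(2) E(2)] by blast
  define k where "k = altsum (ch (tensor_repn ?R ?S)) \<xi>"
  obtain Rs where Rs: "\<forall>S\<in>set Rs. irreducible_repn S" "iso_repn (tensor_repn ?R ?S) (direct_sum_repn Rs)"
    using tensor_irrep_decomposition[OF l \<mu>] by blast
  have count: "int (length (filter (\<lambda>S. irreducible_of_highest_weight S \<nu>) Rs)) = k"
    if "\<forall>S\<in>set Rs. irreducible_repn S" "iso_repn (tensor_repn ?R ?S) (direct_sum_repn Rs)" for Rs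
    unfolding k_def \<xi>_def by (rule irreducible_summand_count[OF T wT that \<nu>])
  have "Nbar \<nu> l \<mu> = length (filter (\<lambda>S. irreducible_of_highest_weight S \<nu>) Rs)"
    unfolding Nbar_def irrep_multiplicity_def
  \<comment> \<open>\<open>count\<close> gives the same number for every decomposition, so the
    definite description is determined by any one of them.\<close>
  proof (rule the_equality)
    show "\<exists>Rs'. (\<forall>S\<in>set Rs'. irreducible_repn S) \<and> iso_repn (tensor_repn ?R ?S) (direct_sum_repn Rs') \<and>
      length (filter (\<lambda>S. irreducible_of_highest_weight S \<nu>) Rs) = length (filter (\<lambda>S. irreducible_of_highest_weight S \<nu>) Rs')"
      using Rs by blast
    fix j assume "\<exists>Rs'. (\<forall>S\<in>set Rs'. irreducible_repn S) \<and> iso_repn (tensor_repn ?R ?S) (direct_sum_repn Rs') \<and>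
      j = length (filter (\<lambda>S. irreducible_of_highest_weight S \<nu>) Rs')"
    then obtain Rs' where "\<forall>S\<in>set Rs'. irreducible_repn S" "iso_repn (tensor_repn ?R ?S) (direct_sum_repn Rs')"
      "j = length (filter (\<lambda>S. irreducible_of_highest_weight S \<nu>) Rs')" by blast
    thus "j = length (filter (\<lambda>S. irreducible_of_highest_weight S \<nu>) Rs)"
      using count[OF Rs] count[of Rs'] by simp
  qed
  hence "int (Nbar \<nu> l \<mu>) = k" using count[OF Rs] by simp
  also have "k = altsum (\<lambda>\<kappa>. \<Sum>i<length ws. wcount vs (\<kappa> - ws ! i)) \<xi>"
    unfolding k_def ch_has_weights[OF T wT] wcount_def count_tensor_weights of_nat_sum ..
  also have "\<dots> = (\<Sum>i<length ws. altsum (\<lambda>\<kappa>. wcount vs (\<kappa> - ws ! i)) \<xi>)"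
    by (rule altsum_sum)
  also have "\<dots> = (\<Sum>i<length ws. altsum (wcount vs) (\<xi> - ws ! i))"
    by (intro sum.cong refl) (simp add: altsum_def algebra_simps)
  also have "\<dots> = (\<Sum>i<length ws. altdelta \<eta> (\<xi> - ws ! i))"
    unfolding \<eta>_def using irreducible_character(2)[OF hS] ch_has_weights[OF S vs] by simp
  also have "\<dots> = wcount ws (\<xi> - \<eta>) - wcount ws (\<xi> - refl1 \<eta>) - wcount ws (\<xi> - refl2 \<eta>)
    + wcount ws (\<xi> - refl1 (refl2 \<eta>)) + wcount ws (\<xi> - refl2 (refl1 \<eta>)) - wcount ws (\<xi> - refl1 (refl2 (refl1 \<eta>)))"
  proof -
    have "\<xi> - w = \<zeta> \<longleftrightarrow> w = \<xi> - \<zeta>" for w \<zeta> by (auto simp: algebra_simps)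
    thus ?thesis unfolding altdelta_def wcount_sum by (simp only: sum.distrib sum_subtractf)
  qed
  finally show ?thesis unfolding ch_has_weights[OF R ws] .
qed

subsection \<open>The extended affine Weyl group\<close>

lemma refl_refl [simp]:
  "refl1 (refl1 \<kappa>) = \<kappa>" "refl2 (refl2 \<kappa>) = \<kappa>"
  "refl2 (refl1 (refl2 \<kappa>)) = refl1 (refl2 (refl1 \<kappa>))"
  by (cases \<kappa>; simp add: refl_simps)+

lemma Wbar_eq: "Wbar = {id, refl1, refl2, refl1 \<circ> refl2, refl2 \<circ> refl1, refl1 \<circ> refl2 \<circ> refl1}" (is "_ = ?W")
proof
  have rr: "f \<circ> refl1 \<circ> refl1 = f" "f \<circ> refl2 \<circ> refl2 = f"
    "refl1 \<circ> refl1 = id" "refl2 \<circ> refl2 = id" "refl2 \<circ> refl1 \<circ> refl2 = refl1 \<circ> refl2 \<circ> refl1"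
    "refl1 \<circ> refl2 \<circ> refl1 \<circ> refl2 = refl2 \<circ> refl1" for f :: "weight \<Rightarrow> weight"
    by (simp_all add: fun_eq_iff)
  show "Wbar \<subseteq> ?W"
  proof
    fix w assume "w \<in> Wbar"
    thus "w \<in> ?W"
    proof (induction rule: Wbar.induct)
      case (Wbar_refl1 w)
      thus ?case by (elim insertE emptyE; hypsubst) (simp_all only: rr id_o insert_iff simp_thms)
    next
      case (Wbar_refl2 w)
      thus ?case by (elim insertE emptyE; hypsubst) (simp_all only: rr id_o insert_iff simp_thms)
    qed simp
  qed
  have "refl1 \<in> Wbar" "refl2 \<in> Wbar" using Wbar.intros(2,3)[OF Wbar_id] by simp_all
  thus "?W \<subseteq> Wbar" by (simp add: Wbar_id Wbar_refl1 Wbar_refl2)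
qed

lemma sum_Wbar:
  "(\<Sum>w\<in>Wbar. f w) = f id + f refl1 + f refl2 + f (refl1 \<circ> refl2) + f (refl2 \<circ> refl1) + (f (refl1 \<circ> refl2 \<circ> refl1) :: int)"
proof -
  let ?ws = "[id, refl1, refl2, refl1 \<circ> refl2, refl2 \<circ> refl1, refl1 \<circ> refl2 \<circ> refl1]"
  \<comment> \<open>The six maps are told apart by their values at \<rho>, whose stabiliser is
    trivial.\<close>
  have "distinct (map (\<lambda>w. w (1, 1)) ?ws)" by (simp add: refl_simps)
  hence d: "distinct ?ws" by (rule distinct_map[THEN iffD1, THEN conjunct1])
  have "Wbar = set ?ws" by (simp add: Wbar_eq)
  hence "sum f Wbar = sum f (set ?ws)" by (rule arg_cong)
  also have "\<dots> = (\<Sum>w\<leftarrow>?ws. f w)" by (rule sum.distinct_set_conv_list[OF d])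
  finally show ?thesis by simp
qed

lemma Wbar_comp: "w \<in> Wbar \<Longrightarrow> v \<in> Wbar \<Longrightarrow> v \<circ> w \<in> Wbar"
  by (induction rule: Wbar.induct) (auto simp: o_assoc intro: Wbar.intros)

lemma Wbar_additive:
  assumes "w \<in> Wbar"
  shows "w (\<kappa> + \<kappa>') = w \<kappa> + w \<kappa>'" "w (- \<kappa>) = - w \<kappa>" "w (\<kappa> - \<kappa>') = w \<kappa> - w \<kappa>'" "w (scale k \<kappa>) = scale k (w \<kappa>)"
proof -
  have r: "refl1 (\<kappa> + \<kappa>') = refl1 \<kappa> + refl1 \<kappa>'" "refl2 (\<kappa> + \<kappa>') = refl2 \<kappa> + refl2 \<kappa>'"
    "refl1 (scale k \<kappa>) = scale k (refl1 \<kappa>)" "refl2 (scale k \<kappa>) = scale k (refl2 \<kappa>)" for \<kappa> \<kappa>' k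
    by (cases \<kappa>; cases \<kappa>'; simp add: refl_simps scale_def algebra_simps)+
  show a: "w (\<kappa> + \<kappa>') = w \<kappa> + w \<kappa>'" and s: "w (scale k \<kappa>) = scale k (w \<kappa>)" for \<kappa> \<kappa>' k
    using assms by (induction arbitrary: \<kappa> \<kappa>' rule: Wbar.induct) (auto simp: r)
  have neg: "- \<kappa> = scale (-1) \<kappa>" for \<kappa> by (simp add: scale_def prod_eq_iff)
  show n: "w (- \<kappa>) = - w \<kappa>" for \<kappa> unfolding neg by (rule s)
  show "w (\<kappa> - \<kappa>') = w \<kappa> - w \<kappa>'" using a[of \<kappa> "- \<kappa>'"] n[of \<kappa>'] by simp
qed

lemma Wbar_bij: "w \<in> Wbar \<Longrightarrow> bij w"
proof (induction rule: Wbar.induct)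
  have "bij refl1" "bij refl2"
    by (rule o_bij[of refl1], auto simp: fun_eq_iff refl_simps, rule o_bij[of refl2], auto simp: fun_eq_iff refl_simps)
  thus "bij (w \<circ> refl1)" "bij (w \<circ> refl2)" if "bij w" for w using that bij_comp by blast+
qed (rule bij_id)

lemma Wbar_inv:
  assumes "w \<in> Wbar"
  shows "inv_into UNIV w \<in> Wbar" "inv_into UNIV w (w \<kappa>) = \<kappa>" "w (inv_into UNIV w \<kappa>) = \<kappa>"
proof -
  have b: "bij w" by (rule Wbar_bij[OF assms])
  show "inv_into UNIV w (w \<kappa>) = \<kappa>" "w (inv_into UNIV w \<kappa>) = \<kappa>"
    using b by (auto simp: bij_is_inj bij_is_surj surj_f_inv_f)
  have "\<exists>v\<in>Wbar. v \<circ> w = id"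
    using assms
  proof (induction rule: Wbar.induct)
    case Wbar_id
    show ?case by (rule bexI[OF _ Wbar.Wbar_id]) simp
  next
    case (Wbar_refl1 w)
    then obtain v where v: "v \<in> Wbar" "v \<circ> w = id" by blast
    have "refl1 \<circ> v \<circ> (w \<circ> refl1) = refl1 \<circ> (v \<circ> w) \<circ> refl1" by (simp add: o_assoc)
    also have "\<dots> = id" by (auto simp: v fun_eq_iff refl_simps)
    finally show ?case using Wbar_comp[OF v(1), of refl1] Wbar_eq by blast
  next
    case (Wbar_refl2 w)
    then obtain v where v: "v \<in> Wbar" "v \<circ> w = id" by blast
    have "refl2 \<circ> v \<circ> (w \<circ> refl2) = refl2 \<circ> (v \<circ> w) \<circ> refl2" by (simp add: o_assoc)
    also have "\<dots> = id" by (auto simp: v fun_eq_iff refl_simps)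
    finally show ?case using Wbar_comp[OF v(1), of refl2] Wbar_eq by blast
  qed
  then obtain v where v: "v \<in> Wbar" "v \<circ> w = id" by blast
  have "inv_into UNIV w = v" by (rule inv_unique_comp[OF _ v(2)]) (metis b v(2) bij_is_surj comp_assoc comp_id id_comp surj_iff)
  thus "inv_into UNIV w \<in> Wbar" using v(1) by simp
qed

text \<open>The normal form used by \<open>\<iota>\<close> and \<open>Wext_pos\<close>, with the
  translation on the right and its sign reversed.\<close>

definition aff :: "(weight \<Rightarrow> weight) \<Rightarrow> weight \<Rightarrow> weight \<Rightarrow> weight" where
  "aff w l = w \<circ> transl (- l)"

lemma aff_apply: "aff w l \<kappa> = w (\<kappa> - l)"
  by (simp add: aff_def transl_def)

text \<open>Moving the translation by -l to the right past \<open>w'\<close> applies the inverse of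
  \<open>w'\<close> to \<open>l\<close>.\<close>

lemma aff_comp:
  assumes "w \<in> Wbar" "w' \<in> Wbar"
  shows "aff w l \<circ> aff w' l' = aff (w \<circ> w') (l' + inv_into UNIV w' l)"
proof
  fix \<kappa>
  have "w' (inv_into UNIV w' l) = l" by (rule Wbar_inv(3)[OF assms(2)])
  thus "(aff w l \<circ> aff w' l') \<kappa> = aff (w \<circ> w') (l' + inv_into UNIV w' l) \<kappa>"
    by (simp add: aff_apply Wbar_additive[OF assms(2)] algebra_simps)
qed

lemma aff_bij: "w \<in> Wbar \<Longrightarrow> bij (aff w l)"
  unfolding aff_def using Wbar_bij[of w]
  by (intro bij_comp) (auto simp: transl_def bij_def inj_def surj_def intro: exI[of _ "_ + l"])

lemma aff_inv:
  assumes "w \<in> Wbar"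
  shows "inv_into UNIV (aff w l) = aff (inv_into UNIV w) (- w l)"
proof (rule inv_unique_comp)
  note i = Wbar_inv[OF assms] Wbar_additive[OF assms] Wbar_additive[OF Wbar_inv(1)[OF assms]]
  show "aff w l \<circ> aff (inv_into UNIV w) (- w l) = id" "aff (inv_into UNIV w) (- w l) \<circ> aff w l = id"
    by (auto simp: fun_eq_iff aff_apply i)
qed

lemma aff_unique:
  assumes "w \<in> Wbar" "w' \<in> Wbar" "aff w l = aff w' l'"
  shows "w = w' \<and> l = l'"
proof -
  have e: "w (\<kappa> - l) = w' (\<kappa> - l')" for \<kappa> using fun_cong[OF assms(3)] by (simp add: aff_apply)
  have "w' (l - l') = 0" using e[of l] Wbar_additive(3)[OF assms(1), of 0 0] by simp
  hence "l - l' = 0" using Wbar_inv(2)[OF assms(2), of "l - l'"] Wbar_inv(2)[OF assms(2), of 0] Wbar_additive(3)[OF assms(2), of 0 0] by simp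
  hence l: "l = l'" by simp
  moreover have "w \<kappa> = w' \<kappa>" for \<kappa> using e[of "\<kappa> + l"] l by simp
  ultimately show ?thesis by auto
qed

lemma iota_aff:
  assumes "w \<in> Wbar"
  shows "\<iota> (aff w l) = scale 3 l + inv_into UNIV w \<rho> - \<rho>"
  unfolding \<iota>_def
proof (rule the_equality)
  show "\<exists>w'\<in>Wbar. \<exists>l'. aff w l = w' \<circ> transl (- l') \<and>
    scale 3 l + inv_into UNIV w \<rho> - \<rho> = scale 3 l' + dot_action (inv_into UNIV w') 0"
    using assms by (intro bexI[of _ w] exI[of _ l]) (auto simp: aff_def dot_action_def)
  fix \<nu> assume "\<exists>w'\<in>Wbar. \<exists>l'. aff w l = w' \<circ> transl (- l') \<and> \<nu> = scale 3 l' + dot_action (inv_into UNIV w') 0"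
  then obtain w' l' where w': "w' \<in> Wbar" "aff w l = aff w' l'" "\<nu> = scale 3 l' + dot_action (inv_into UNIV w') 0"
    unfolding aff_def by blast
  thus "\<nu> = scale 3 l + inv_into UNIV w \<rho> - \<rho>"
    using aff_unique[OF assms w'(1,2)] by (simp add: dot_action_def)
qed

text \<open>The class of an element of the extended affine Weyl group modulo the affine Weyl group, read
  off in the quotient of the weight lattice by the root lattice, which is cyclic of order three.\<close>

definition aff_class :: "int \<Rightarrow> (weight \<Rightarrow> weight) \<Rightarrow> bool" where
  "aff_class k f \<longleftrightarrow> (\<exists>w\<in>Wbar. \<exists>l. f = aff w l \<and> 3 dvd fst l - snd l - k)"

text \<open>A reflection changes a weight by a multiple of a simple root, and on \<alpha>1 and
  \<alpha>2 the difference of coordinates is 3 and -3; so the finite Weyl group acts trivially on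
  weights modulo roots.\<close>

lemma Wbar_class: "w \<in> Wbar \<Longrightarrow> 3 dvd (fst (w \<kappa>) - snd (w \<kappa>)) - (fst \<kappa> - snd \<kappa>)"
proof (induction arbitrary: \<kappa> rule: Wbar.induct)
  case (Wbar_refl1 w)
  have "3 dvd (fst (refl1 \<kappa>) - snd (refl1 \<kappa>)) - (fst \<kappa> - snd \<kappa>)"
    by (rule dvdI[of _ _ "- fst \<kappa>"]) (cases \<kappa>, simp add: refl_simps)
  from dvd_add[OF Wbar_refl1(2)[of "refl1 \<kappa>"] this] show ?case by (simp add: algebra_simps)
next
  case (Wbar_refl2 w)
  have "3 dvd (fst (refl2 \<kappa>) - snd (refl2 \<kappa>)) - (fst \<kappa> - snd \<kappa>)"
    by (rule dvdI[of _ _ "snd \<kappa>"]) (cases \<kappa>, simp add: refl_simps)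
  from dvd_add[OF Wbar_refl2(2)[of "refl2 \<kappa>"] this] show ?case by (simp add: algebra_simps)
qed simp

lemma aff_class_comp:
  assumes "aff_class j f" "aff_class k g"
  shows "aff_class (j + k) (f \<circ> g)"
proof -
  obtain w l where w: "w \<in> Wbar" "f = aff w l" "3 dvd fst l - snd l - j" using assms(1) by (auto simp: aff_class_def)
  obtain v m where v: "v \<in> Wbar" "g = aff v m" "3 dvd fst m - snd m - k" using assms(2) by (auto simp: aff_class_def)
  let ?l = "inv_into UNIV v l"
  have "3 dvd ((fst ?l - snd ?l) - (fst l - snd l)) + (fst l - snd l - j) + (fst m - snd m - k)"
    by (intro dvd_add Wbar_class Wbar_inv(1) v w)
  hence "3 dvd fst (m + ?l) - snd (m + ?l) - (j + k)" by (simp add: algebra_simps)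
  thus ?thesis unfolding aff_class_def w(2) v(2) aff_comp[OF w(1) v(1)] using Wbar_comp[OF v(1) w(1)] by blast
qed

lemma aff_class_inv:
  assumes "aff_class k f"
  shows "aff_class (- k) (inv_into UNIV f)"
proof -
  obtain w l where w: "w \<in> Wbar" "f = aff w l" "3 dvd fst l - snd l - k" using assms by (auto simp: aff_class_def)
  have "3 dvd - (((fst (w l) - snd (w l)) - (fst l - snd l)) + (fst l - snd l - k))"
    unfolding dvd_minus_iff by (intro dvd_add Wbar_class w)
  hence "3 dvd fst (- w l) - snd (- w l) - (- k)" by (simp add: algebra_simps)
  thus ?thesis unfolding aff_class_def w(2) aff_inv[OF w(1)] using Wbar_inv(1)[OF w(1)] by blast
qed

lemma root_lattice_iff: "\<kappa> \<in> root_lattice \<longleftrightarrow> 3 dvd fst \<kappa> - snd \<kappa>"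
proof
  assume "3 dvd fst \<kappa> - snd \<kappa>"
  then obtain t where "fst \<kappa> = snd \<kappa> + 3 * t" by (auto elim!: dvdE simp: algebra_simps)
  \<comment> \<open>The coefficients solve the linear system of the Cartan matrix; divisibility by
    three makes them integral.\<close>
  hence "\<kappa> = scale (snd \<kappa> + 2 * t) \<alpha>1 + scale (snd \<kappa> + t) \<alpha>2"
    by (simp add: scale_def \<alpha>1_def \<alpha>2_def prod_eq_iff)
  thus "\<kappa> \<in> root_lattice" unfolding root_lattice_def by blast
qed (auto simp: root_lattice_def scale_def \<alpha>1_def \<alpha>2_def intro: dvdI[of _ _ "_ - _"])

lemma Waff_iff: "f \<in> Waff \<longleftrightarrow> aff_class 0 f"
proof
  assume "f \<in> Waff"
  then obtain w \<beta> where "w \<in> Wbar" "\<beta> \<in> root_lattice" "f = aff w (- \<beta>)" by (auto simp: Waff_def aff_def)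
  moreover from this have "3 dvd fst (- \<beta>) - snd (- \<beta>) - 0"
    using dvd_minus_iff[of 3 "fst \<beta> - snd \<beta>"] by (simp add: root_lattice_iff del: dvd_minus_iff)
  ultimately show "aff_class 0 f" unfolding aff_class_def by blast
next
  assume "aff_class 0 f"
  then obtain w l where "w \<in> Wbar" "f = w \<circ> transl (- l)" "3 dvd fst l - snd l" by (auto simp: aff_class_def aff_def)
  moreover from this have "- l \<in> root_lattice"
    using dvd_minus_iff[of 3 "fst l - snd l"] by (simp add: root_lattice_iff del: dvd_minus_iff)
  ultimately show "f \<in> Waff" unfolding Waff_def by blast
qed

text \<open>Moving the translation to the right replaces \<Lambda>1 by
  \<open>refl2 (refl1 \<Lambda>1)\<close>, which is -\<Lambda>2.\<close>

lemma gamma_aff: "\<gamma> = aff (refl1 \<circ> refl2) (0, 1)"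
  by (auto simp: \<gamma>_def fun_eq_iff aff_apply transl_def refl_simps \<Lambda>1_def)

text \<open>Left multiplication by \<open>\<gamma>\<close> adds 3 \<Lambda>2 and rotates \<rho> to
  (1, -2), both moved by the inverse of \<open>w\<close>; the two together are (0, 3) + (1, -2) =
  \<rho>, so nothing changes.\<close>

lemma iota_gamma:
  assumes "aff_class k f"
  shows "\<iota> (\<gamma> \<circ> f) = \<iota> f"
proof -
  obtain w l where w: "w \<in> Wbar" "f = aff w l" using assms by (auto simp: aff_class_def)
  have s: "refl1 \<circ> refl2 \<in> Wbar" by (simp add: Wbar_eq)
  note ws = Wbar_comp[OF w(1) s] and iw = Wbar_inv[OF w(1)]
  have "inv_into UNIV (refl1 \<circ> refl2 \<circ> w) = inv_into UNIV w \<circ> (refl2 \<circ> refl1)"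
    by (rule inv_unique_comp) (simp_all add: fun_eq_iff iw)
  hence "inv_into UNIV (refl1 \<circ> refl2 \<circ> w) \<rho> = inv_into UNIV w (1, -2)"
    by (simp add: \<rho>_def \<Lambda>1_def \<Lambda>2_def refl_simps)
  moreover have "scale 3 (inv_into UNIV w (0, 1)) + inv_into UNIV w (1, -2) = inv_into UNIV w \<rho>"
    unfolding Wbar_additive(4)[OF iw(1), symmetric] Wbar_additive(1)[OF iw(1), symmetric]
    by (simp add: scale_def \<rho>_def \<Lambda>1_def \<Lambda>2_def)
  moreover have "scale 3 (l + m) = scale 3 l + scale 3 m" for m by (simp add: scale_def prod_eq_iff)
  ultimately show ?thesis
    unfolding gamma_aff w(2) aff_comp[OF s w(1)] iota_aff[OF ws] iota_aff[OF w(1)] by (simp only: add.assoc)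
qed

lemma grpA_cases:
  assumes "a \<in> grpA"
  shows "\<exists>k. aff_class k a" "\<And>f j. aff_class j f \<Longrightarrow> \<iota> (a \<circ> f) = \<iota> f"
proof -
  have id: "id = aff id 0" by (auto simp: fun_eq_iff aff_apply)
  have cid: "aff_class 0 id" unfolding aff_class_def by (rule bexI[OF _ Wbar_id], rule exI[of _ 0], rule conjI[OF id]) simp
  have cg: "aff_class (-1) \<gamma>" unfolding aff_class_def gamma_aff
    by (rule bexI[of _ "refl1 \<circ> refl2"], rule exI[of _ "(0, 1)"]) (simp_all add: Wbar_eq)
  have a: "a = id \<or> a = \<gamma> \<or> a = \<gamma> \<circ> \<gamma>" using assms by (simp add: grpA_def)
  thus "\<exists>k. aff_class k a" using cid cg aff_class_comp[OF cg cg] by blast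
  fix f j assume f: "aff_class j f"
  have "\<iota> (\<gamma> \<circ> \<gamma> \<circ> f) = \<iota> f"
    using iota_gamma[OF aff_class_comp[OF cg f]] iota_gamma[OF f] by (simp add: o_assoc)
  thus "\<iota> (a \<circ> f) = \<iota> f" using a iota_gamma[OF f] by auto
qed

text \<open>A coordinate of the inverse image of \<rho> under \<open>w\<close> is the height of the
  root to which \<open>w\<close> sends that simple root. It is negative only where \<open>w\<close>
  makes the simple root negative, and is then at least -2; subtracting \<rho> gives at least -3,
  which the positive coordinate of \<open>l\<close>, taken three times, compensates.\<close>

lemma iota_dominant:
  assumes "f \<in> Wext_pos"
  shows "\<iota> f \<in> dominant"
proof -
  obtain w l where w: "w \<in> Wbar" "f = aff w l" "l \<in> dominant"
    "w \<alpha>1 \<in> neg_roots \<longrightarrow> 0 < fst l" "w \<alpha>2 \<in> neg_roots \<longrightarrow> 0 < snd l"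
    using assms by (auto simp: Wext_pos_def aff_def)
  have inv: "inv_into UNIV w \<rho> = \<sigma>" if "w \<sigma> = \<rho>" for \<sigma> using Wbar_inv(2)[OF w(1), of \<sigma>] that by simp
  have rho: "\<rho> = (1, 1)" by (simp add: \<rho>_def \<Lambda>1_def \<Lambda>2_def)
  have "scale 3 l + inv_into UNIV w \<rho> - \<rho> \<in> dominant"
    using w(1) unfolding Wbar_eq
  proof (elim insertE emptyE)
    assume "w = id"
    thus ?thesis using w(3) inv[of "(1, 1)"] by (simp add: dominant_def rho scale_def)
  next
    assume "w = refl1"
    thus ?thesis using w(3-5) inv[of "(-1, 2)"]
      by (auto simp: dominant_def rho scale_def refl_simps neg_roots_def \<alpha>1_def \<alpha>2_def)
  next
    assume "w = refl2"
    thus ?thesis using w(3-5) inv[of "(2, -1)"]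
      by (auto simp: dominant_def rho scale_def refl_simps neg_roots_def \<alpha>1_def \<alpha>2_def)
  next
    assume "w = refl1 \<circ> refl2"
    thus ?thesis using w(3-5) inv[of "(1, -2)"]
      by (auto simp: dominant_def rho scale_def refl_simps neg_roots_def \<alpha>1_def \<alpha>2_def)
  next
    assume "w = refl2 \<circ> refl1"
    thus ?thesis using w(3-5) inv[of "(-2, 1)"]
      by (auto simp: dominant_def rho scale_def refl_simps neg_roots_def \<alpha>1_def \<alpha>2_def)
  next
    assume "w = refl1 \<circ> refl2 \<circ> refl1"
    thus ?thesis using w(3-5) inv[of "(-1, -1)"]
      by (auto simp: dominant_def rho scale_def refl_simps neg_roots_def \<alpha>1_def \<alpha>2_def)
  qed
  thus ?thesis unfolding w(2) iota_aff[OF w(1)] .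
qed

lemma coset_element:
  assumes a: "a \<in> grpA" "aff_class k a" and x: "x \<in> {a \<circ> u | u. u \<in> Waff_pos}"
  shows "aff_class k x" "\<iota> x \<in> dominant"
proof -
  obtain u where u: "x = a \<circ> u" "u \<in> Waff" "u \<in> Wext_pos" using x by (auto simp: Waff_pos_def)
  have c: "aff_class 0 u" using u(2) by (simp add: Waff_iff)
  show "aff_class k x" using aff_class_comp[OF a(2) c] u(1) by simp
  show "\<iota> x \<in> dominant" using grpA_cases(2)[OF a(1) c] iota_dominant[OF u(3)] u(1) by simp
qed

text \<open>For \<open>aff w l\<close> the vector \<open>\<iota>\<close> + \<rho> is 3l plus the
  inverse image of \<rho> under \<open>w\<close>, an expression that is linear in \<open>l\<close>
  and \<rho>. Hence in the product the contributions of \<open>z\<close> and \<open>y\<close>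
  separate.\<close>

lemma iota_conjugate:
  assumes z: "aff_class j z" and w: "w \<in> Wbar" and y: "aff_class k y"
  shows "\<exists>v\<in>Wbar. \<iota> (z \<circ> w \<circ> inv_into UNIV y) = v (\<iota> z + \<rho> - w (\<iota> y + \<rho>))"
proof -
  obtain zw \<nu> where zw: "zw \<in> Wbar" "z = aff zw \<nu>" using z by (auto simp: aff_class_def)
  obtain yw \<mu> where yw: "yw \<in> Wbar" "y = aff yw \<mu>" using y by (auto simp: aff_class_def)
  define iw where "iw = inv_into UNIV w"
  define iy where "iy = inv_into UNIV yw"
  define iz where "iz = inv_into UNIV zw"
  have I: "iw \<in> Wbar" "iy \<in> Wbar" "iz \<in> Wbar"
    unfolding iw_def iy_def iz_def by (intro Wbar_inv(1) w yw zw)+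
  have c: "iw (w \<kappa>) = \<kappa>" "w (iw \<kappa>) = \<kappa>" "iy (yw \<kappa>) = \<kappa>" "yw (iy \<kappa>) = \<kappa>" "iz (zw \<kappa>) = \<kappa>" "zw (iz \<kappa>) = \<kappa>" for \<kappa>
    unfolding iw_def iy_def iz_def using Wbar_inv(2,3)[OF w] Wbar_inv(2,3)[OF yw(1)] Wbar_inv(2,3)[OF zw(1)] by auto
  note lin = Wbar_additive[OF w] Wbar_additive[OF yw(1)] Wbar_additive[OF I(1)] Wbar_additive[OF I(2)]
  have g: "zw \<circ> w \<circ> iy \<in> Wbar" by (intro Wbar_comp zw yw w I)
  have "z \<circ> w \<circ> inv_into UNIV y = aff (zw \<circ> w \<circ> iy) (yw (iw \<nu> - \<mu>))"
    unfolding zw(2) yw(2) aff_inv[OF yw(1)] iy_def[symmetric]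
    by (auto simp: fun_eq_iff aff_apply lin c algebra_simps)
  moreover have "inv_into UNIV (zw \<circ> w \<circ> iy) = yw \<circ> iw \<circ> iz"
    by (rule inv_unique_comp) (auto simp: fun_eq_iff c)
  ultimately have "\<iota> (z \<circ> w \<circ> inv_into UNIV y) = scale 3 (yw (iw \<nu> - \<mu>)) + yw (iw (iz \<rho>)) - \<rho>"
    by (simp add: iota_aff[OF g])
  \<comment> \<open>The last \<rho> is written as \<open>yw (iy \<rho>)\<close>, after which
    \<open>yw \<circ> iw\<close> is a common factor.\<close>
  also have "\<dots> = yw (iw (scale 3 \<nu> + iz \<rho> - w (scale 3 \<mu> + iy \<rho>)))"
    by (simp add: lin c) (simp add: scale_def prod_eq_iff algebra_simps)
  also have "\<dots> = (yw \<circ> iw) (\<iota> z + \<rho> - w (\<iota> y + \<rho>))"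
    unfolding zw(2) yw(2) iota_aff[OF zw(1)] iota_aff[OF yw(1)] iz_def iy_def by simp
  finally show ?thesis using Wbar_comp[OF I(1) yw(1)] by blast
qed

theorem proposition4p6:
  fixes a a' x y z :: "weight \<Rightarrow> weight"
  assumes "a \<in> grpA" and "a' \<in> grpA"
    and "x \<in> {a \<circ> u | u. u \<in> Waff_pos}"
    and "y \<in> {a' \<circ> u | u. u \<in> Waff_pos}"
    and "z \<in> {a \<circ> a' \<circ> u | u. u \<in> Waff_pos}"
  shows "structure_const z x y = int (Nbar (\<iota> z) (\<iota> x) (\<iota> y))"
proof -
  obtain k where k: "aff_class k a" using grpA_cases(1)[OF assms(1)] by blast
  obtain k' where k': "aff_class k' a'" using grpA_cases(1)[OF assms(2)] by blast
  note x = coset_element[OF assms(1) k assms(3)] and y = coset_element[OF assms(2) k' assms(4)]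
  \<comment> \<open>Splitting off \<open>a\<close> and \<open>a'\<close> one after the other treats
    \<open>z\<close> by the facts about single elements of \<open>grpA\<close>.\<close>
  obtain u where u: "z = a \<circ> (a' \<circ> u)" "a' \<circ> u \<in> {a' \<circ> u | u. u \<in> Waff_pos}"
    using assms(5) by (auto simp: o_assoc)
  note v = coset_element[OF assms(2) k' u(2)]
  have z: "aff_class (k + k') z" "\<iota> z \<in> dominant"
    using aff_class_comp[OF k v(1)] grpA_cases(2)[OF assms(1) v(1)] v(2) unfolding u(1) by simp_all
  let ?m = "ch (irrep (\<iota> x))"
  note hx = irrep_highest_weight[OF x(2)]
  have W: "?m (w \<kappa>) = ?m \<kappa>" if "w \<in> Wbar" for w \<kappa>
    using that by (induction arbitrary: \<kappa> rule: Wbar.induct) (auto simp: irreducible_character(3,4)[OF hx])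
  have m: "int (mult_ext x (z \<circ> w \<circ> inv_into UNIV y)) = ?m (\<iota> z + \<rho> - w (\<iota> y + \<rho>))" if w: "w \<in> Wbar" for w
  proof -
    let ?g = "z \<circ> w \<circ> inv_into UNIV y"
    have "w = aff w 0" by (auto simp: fun_eq_iff aff_apply)
    hence "aff_class 0 w" unfolding aff_class_def using w by (intro bexI[of _ w] exI[of _ 0]) auto
    \<comment> \<open>The classes cancel, so the argument lies in the coset of \<open>x\<close>
      under \<open>Waff\<close>, and \<open>mult_ext\<close> takes its first branch for every
      \<open>w\<close>.\<close>
    hence "aff_class (k + k' + 0 + - k' + - k) (?g \<circ> inv_into UNIV x)"
      by (intro aff_class_comp aff_class_inv x(1) y(1) z(1))
    hence "?g \<circ> inv_into UNIV x \<in> Waff" by (simp add: Waff_iff)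
    moreover have "bij x" using x(1) aff_bij by (auto simp: aff_class_def)
    hence "?g \<circ> inv_into UNIV x \<circ> x = ?g" by (simp add: o_assoc[symmetric] bij_is_inj)
    ultimately have "?g \<in> {u \<circ> x | u. u \<in> Waff}" by (intro CollectI exI[of _ "?g \<circ> inv_into UNIV x"] conjI) (simp_all only:)
    hence "int (mult_ext x ?g) = ?m (\<iota> ?g)" by (simp add: mult_ext_def mbar_def ch_def)
    moreover obtain v where "v \<in> Wbar" "\<iota> ?g = v (\<iota> z + \<rho> - w (\<iota> y + \<rho>))"
      using iota_conjugate[OF z(1) w y(1)] by (rule bexE)
    \<comment> \<open>The Weyl group element \<open>v\<close> of \<open>iota_conjugate\<close>
      disappears because weight multiplicities are invariant.\<close>
    ultimately show ?thesis by (simp only: W)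
  qed
  have "structure_const z x y = (\<Sum>w\<in>Wbar. detW w * ?m (\<iota> z + \<rho> - w (\<iota> y + \<rho>)))"
    unfolding structure_const_def by (intro sum.cong refl) (simp only: m)
  also have "\<dots> = int (Nbar (\<iota> z) (\<iota> x) (\<iota> y))"
    \<comment> \<open>The determinants evaluate to the six signs of the multiplicity formula, in the
      same order.\<close>
    unfolding sum_Wbar Nbar_formula[OF x(2) y(2) z(2)]
    by (simp add: detW_def \<Lambda>1_def \<Lambda>2_def refl_simps)
  finally show ?thesis .
qed

end
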